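(* Assume that $\varepsilon\in C^\infty(\mathbb{R}^2)$ is real with $\varepsilon>0$. If $u\in H^1_{qp}(\Omega)$ satisfies $B_\varepsilon(u,v)=-\int_\Omega F\overline v$ for all $v\in H^1_{qp}(\Omega)$, for a source $F\in L^2(\Omega)$, then the following Rellich identity holds: $$\int_\Omega\Big[\frac2\varepsilon\Big|\frac{\partial u}{\partial x_2}\Big|^2-(x_2+H)\frac{\partial}{\partial x_2}\Big(\frac1\varepsilon\Big)|\nabla u|^2\Big]+2H\int_{\Gamma_H}\Big(\frac{-2}{\varepsilon}\Big|\frac{\partial u}{\partial x_2}\Big|^2+\frac1\varepsilon|\nabla u|^2-\kappa^2|u|^2\Big)-\int_{\Gamma_H}\overline u\,T^+(u)-\int_{\Gamma_{-H}}\overline u\,T^-(u)$$ $$=-2\int_\Omega(x_2+H)\,\Re\Big(\overline F\,\frac{\partial u}{\partial x_2}\Big)-\int_\Omega F\overline u .$$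
   Context: Fix $L_x,H,\kappa>0$, positive constants $\varepsilon_+,\varepsilon_-$, and an angle $\theta\in(-\pi/2,\pi/2)$. Put $\alpha_0=\kappa\sqrt{\varepsilon_+}\sin\theta$, $\alpha_n=\alpha_0+2\pi n/L_x$ ($n\in\mathbb{Z}$), and assume $\alpha_n^2\neq\kappa^2\varepsilon_\pm$ for all $n$. $\Omega=(0,L_x)\times(-H,H)$, $\Gamma_{\pm H}=(0,L_x)\times\{\pm H\}$. The relative permittivity $\varepsilon$ on $\mathbb{R}^2$ is $L_x$-periodic in $x_1$, with $\varepsilon=\varepsilon_+$ for $x_2>H$ and $\varepsilon=\varepsilon_-$ for $x_2<-H$. $H^1_{qp}(\Omega)$ is the closure in $H^1(\Omega)$ of restrictions to $\Omega$ of smooth functions $w$ with $w(x_1+L_x,x_2)=e^{i\alpha_0L_x}w(x_1,x_2)$. Let $\beta_n^\pm=\sqrt{\kappa^2\varepsilon_\pm-\alpha_n^2}$ if $\alpha_n^2<\kappa^2\varepsilon_\pm$ and $\beta_n^\pm=i\sqrt{\alpha_n^2-\kappa^2\varepsilon_\pm}$ if $\alpha_n^2>\kappa^2\varepsilon_\pm$. For $\phi=\sum_n\phi_ne^{i\alpha_nx_1}$ on $\Gamma_{\pm H}$, $T^\pm\phi=\frac{i}{\varepsilon_\pm}\sum_n\beta_n^\pm\phi_ne^{i\alpha_nx_1}$. The sesquilinear form is $$B_\varepsilon(w,v)=\int_\Omega\Big(\frac1\varepsilon\nabla w\cdot\nabla\overline v-\kappa^2w\overline v\Big)-\int_{\Gamma_{-H}}\overline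 v\,T^-(w)-\int_{\Gamma_H}\overline v\,T^+(w)$$ (boundary integrals are understood as $H^{-1/2}$–$H^{1/2}$ dualities). Boundary values of derivatives of $u$ are traces. *)

theory Defs
  imports "HOL-Analysis.Analysis"
begin

primrec Ck :: "nat \<Rightarrow> (real \<times> real \<Rightarrow> 'a::real_normed_vector) \<Rightarrow> bool" where
  "Ck 0 f \<longleftrightarrow> continuous_on UNIV f"
| "Ck (Suc k) f \<longleftrightarrow> (\<exists>f1 f2. Ck k f1 \<and> Ck k f2 \<and>
     (\<forall>x. (f has_derivative (\<lambda>h. fst h *\<^sub>R f1 x + snd h *\<^sub>R f2 x)) (at x)))"

definition C_infinity :: "(real \<times> real \<Rightarrow> 'a::real_normed_vector) \<Rightarrow> bool" where
  "C_infinity f \<longleftrightarrow> (\<forall>k. Ck k f)"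

definition partial :: "real \<times> real \<Rightarrow> (real \<times> real \<Rightarrow> 'a::real_normed_vector) \<Rightarrow> real \<times> real \<Rightarrow> 'a" where
  "partial b f x = frechet_derivative f (at x) b"

definition test_functions :: "(real \<times> real) set \<Rightarrow> (real \<times> real \<Rightarrow> complex) set" where
  "test_functions S = {\<phi>. C_infinity \<phi> \<and> compact (closure {x. \<phi> x \<noteq> 0}) \<and> closure {x. \<phi> x \<noteq> 0} \<subseteq> S}"

text \<open>Elements of \<open>L\<^sup>2(S)\<close> and \<open>H\<^sup>1(S)\<close> are represented by functions on the whole space; only their
  values almost everywhere on \<open>S\<close> matter.\<close>

definition L2 :: "'a::euclidean_space set \<Rightarrow> ('a \<Rightarrow> complex) set" where
  "L2 S = {f \<in> borel_measurable (lebesgue_on S). integrable (lebesgue_on S) (\<lambda>x. (norm (f x))\<^sup>2)}"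

definition L2_dist :: "'a::euclidean_space set \<Rightarrow> ('a \<Rightarrow> complex) \<Rightarrow> ('a \<Rightarrow> complex) \<Rightarrow> real" where
  "L2_dist S f g = sqrt (\<integral>x. (norm (f x - g x))\<^sup>2 \<partial>lebesgue_on S)"

definition is_weak_partial ::
  "(real \<times> real) set \<Rightarrow> real \<times> real \<Rightarrow> (real \<times> real \<Rightarrow> complex) \<Rightarrow> (real \<times> real \<Rightarrow> complex) \<Rightarrow> bool" where
  "is_weak_partial S b u g \<longleftrightarrow> g \<in> L2 S \<and>
     (\<forall>\<phi>\<in>test_functions S.
        (\<integral>x. u x * partial b \<phi> x \<partial>lebesgue_on S) = - (\<integral>x. g x * \<phi> x \<partial>lebesgue_on S))"

definition H1 :: "(real \<times> real) set \<Rightarrow> (real \<times> real \<Rightarrow> complex) set" where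
  "H1 S = {u \<in> L2 S. (\<exists>g. is_weak_partial S (1, 0) u g) \<and> (\<exists>g. is_weak_partial S (0, 1) u g)}"

text \<open>A representative of the weak partial derivative, which is unique almost everywhere on open
  sets. It is meaningful only where such a derivative exists, in particular for \<open>u \<in> H1 S\<close>.\<close>

definition weak_partial ::
  "(real \<times> real) set \<Rightarrow> real \<times> real \<Rightarrow> (real \<times> real \<Rightarrow> complex) \<Rightarrow> real \<times> real \<Rightarrow> complex" where
  "weak_partial S b u = (SOME g. is_weak_partial S b u g)"

definition H1_dist ::
  "(real \<times> real) set \<Rightarrow> (real \<times> real \<Rightarrow> complex) \<Rightarrow> (real \<times> real \<Rightarrow> complex) \<Rightarrow> real" where
  "H1_dist S u v = sqrt ((L2_dist S u v)\<^sup>2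
     + (L2_dist S (weak_partial S (1, 0) u) (weak_partial S (1, 0) v))\<^sup>2
     + (L2_dist S (weak_partial S (0, 1) u) (weak_partial S (0, 1) v))\<^sup>2)"

definition Omega :: "real \<Rightarrow> real \<Rightarrow> (real \<times> real) set" where
  "Omega Lx H = {0<..<Lx} \<times> {-H<..<H}"

definition alpha :: "real \<Rightarrow> real \<Rightarrow> real \<Rightarrow> real \<Rightarrow> int \<Rightarrow> real" where
  "alpha Lx \<kappa> \<epsilon>p \<theta> n = \<kappa> * sqrt \<epsilon>p * sin \<theta> + 2 * pi * of_int n / Lx"

text \<open>From here on, the argument \<open>a\<close> stands for the sequence of the \<open>\<alpha>\<^sub>n\<close>, i.e. for
  \<open>alpha Lx \<kappa> \<epsilon>p \<theta>\<close>; the quasi-periodicity phase uses \<open>a 0 = \<alpha>\<^sub>0\<close>.\<close>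

definition quasi_periodic :: "real \<Rightarrow> (int \<Rightarrow> real) \<Rightarrow> (real \<times> real \<Rightarrow> complex) \<Rightarrow> bool" where
  "quasi_periodic Lx a w \<longleftrightarrow> (\<forall>x1 x2. w (x1 + Lx, x2) = exp (\<i> * of_real (a 0 * Lx)) * w (x1, x2))"

definition H1qp :: "real \<Rightarrow> real \<Rightarrow> (int \<Rightarrow> real) \<Rightarrow> (real \<times> real \<Rightarrow> complex) set" where
  "H1qp Lx H a = {u \<in> H1 (Omega Lx H). \<exists>w :: nat \<Rightarrow> real \<times> real \<Rightarrow> complex.
     (\<forall>j. C_infinity (w j) \<and> quasi_periodic Lx a (w j)) \<and>
     (\<lambda>j. H1_dist (Omega Lx H) (w j) u) \<longlonglongrightarrow> 0}"

text \<open>The trace on \<open>(0, Lx) \<times> {h}\<close>, \<open>h = \<plusminus>H\<close>, is a function of the first coordinate; it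
  is the continuous extension to \<open>H1\<close> of the restriction of smooth functions on the closed cell.\<close>

definition is_trace ::
  "real \<Rightarrow> real \<Rightarrow> real \<Rightarrow> (real \<times> real \<Rightarrow> complex) \<Rightarrow> (real \<Rightarrow> complex) \<Rightarrow> bool" where
  "is_trace Lx H h u g \<longleftrightarrow> u \<in> H1 (Omega Lx H) \<and> g \<in> L2 {0<..<Lx} \<and>
     (\<exists>w :: nat \<Rightarrow> real \<times> real \<Rightarrow> complex. (\<forall>j. C_infinity (w j)) \<and>
        (\<lambda>j. H1_dist (Omega Lx H) (w j) u) \<longlonglongrightarrow> 0 \<and>
        (\<lambda>j. L2_dist {0<..<Lx} (\<lambda>t. w j (t, h)) g) \<longlonglongrightarrow> 0)"

definition bd_trace :: "real \<Rightarrow> real \<Rightarrow> real \<Rightarrow> (real \<times> real \<Rightarrow> complex) \<Rightarrow> real \<Rightarrow> complex" where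
  "bd_trace Lx H h u = (SOME g. is_trace Lx H h u g)"

text \<open>Arguments: wave number, permittivity, and \<open>\<alpha>\<^sub>n\<close>.\<close>

definition beta :: "real \<Rightarrow> real \<Rightarrow> real \<Rightarrow> complex" where
  "beta \<kappa> e s = (if s\<^sup>2 < \<kappa>\<^sup>2 * e then of_real (sqrt (\<kappa>\<^sup>2 * e - s\<^sup>2))
                 else \<i> * of_real (sqrt (s\<^sup>2 - \<kappa>\<^sup>2 * e)))"

text \<open>The coefficients \<open>\<phi>\<^sub>n\<close> in \<open>\<phi>(t) = \<Sum>\<^sub>n \<phi>\<^sub>n exp(\<i> \<alpha>\<^sub>n t)\<close>.\<close>

definition fourier_coeff :: "real \<Rightarrow> (int \<Rightarrow> real) \<Rightarrow> (real \<Rightarrow> complex) \<Rightarrow> int \<Rightarrow> complex" where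
  "fourier_coeff Lx a \<phi> n =
     (\<integral>t. \<phi> t * exp (- \<i> * of_real (a n * t)) \<partial>lebesgue_on {0<..<Lx}) / of_real Lx"

text \<open>An element \<open>\<Sum>\<^sub>n g\<^sub>n exp(\<i> \<alpha>\<^sub>n t)\<close> of \<open>H\<^sup>-\<^sup>1\<^sup>/\<^sup>2\<close>, such as the image of a trace under \<open>DtN\<close>, is
  represented by its coefficient sequence \<open>g\<close>. The duality with \<open>\<psi>\<close> extending \<open>\<integral> g (cnj \<psi>)\<close> over the
  boundary segment is then given by Parseval's formula.\<close>

definition DtN :: "real \<Rightarrow> (int \<Rightarrow> real) \<Rightarrow> real \<Rightarrow> real \<Rightarrow> (real \<Rightarrow> complex) \<Rightarrow> int \<Rightarrow> complex" where
  "DtN Lx a \<kappa> e \<phi> n = \<i> / of_real e * beta \<kappa> e (a n) * fourier_coeff Lx a \<phi> n"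

definition duality :: "real \<Rightarrow> (int \<Rightarrow> real) \<Rightarrow> (int \<Rightarrow> complex) \<Rightarrow> (real \<Rightarrow> complex) \<Rightarrow> complex" where
  "duality Lx a g \<psi> = of_real Lx * (\<Sum>\<^sub>\<infinity>n. g n * cnj (fourier_coeff Lx a \<psi> n))"

definition B_form ::
  "real \<Rightarrow> real \<Rightarrow> (int \<Rightarrow> real) \<Rightarrow> real \<Rightarrow> real \<Rightarrow> real \<Rightarrow> (real \<times> real \<Rightarrow> real)
    \<Rightarrow> (real \<times> real \<Rightarrow> complex) \<Rightarrow> (real \<times> real \<Rightarrow> complex) \<Rightarrow> complex" where
  "B_form Lx H a \<kappa> \<epsilon>p \<epsilon>m \<epsilon> w v =
     (\<integral>x. of_real (1 / \<epsilon> x) *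
            (weak_partial (Omega Lx H) (1, 0) w x * cnj (weak_partial (Omega Lx H) (1, 0) v x)
             + weak_partial (Omega Lx H) (0, 1) w x * cnj (weak_partial (Omega Lx H) (0, 1) v x))
          - of_real (\<kappa>\<^sup>2) * w x * cnj (v x) \<partial>lebesgue_on (Omega Lx H))
     - duality Lx a (DtN Lx a \<kappa> \<epsilon>m (bd_trace Lx H (- H) w)) (bd_trace Lx H (- H) v)
     - duality Lx a (DtN Lx a \<kappa> \<epsilon>p (bd_trace Lx H H w)) (bd_trace Lx H H v)"

end

theory Submission
  imports Defs "HOL-Computational_Algebra.Polynomial"
begin

text \<open>
  Pairing the equation with \<open>(x\<^sub>2 + H) \<partial>\<^sub>2 u\<close> and integrating by parts yields the identity once
  \<open>\<partial>\<^sub>1 u\<close> and \<open>\<partial>\<^sub>2 u\<close> are known to be \<open>H\<^sup>1\<close> limits of smooth quasi-periodic functions; the remaining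
  terms are the weak equation tested with \<open>u\<close> itself.

  Tangential regularity: the operators \<open>T\<^sup>\<plusminus>\<close> commute with translations in \<open>x\<^sub>1\<close> and \<open>- Re T\<^sup>\<plusminus> \<ge> 0\<close>, so testing
  with second difference quotients bounds the difference quotients of \<open>u\<close> in \<open>H\<^sup>1\<close>. A weak limit
  point, found as the limit of elements of least norm of nested closed convex sets, is \<open>\<partial>\<^sub>1 u\<close>.
  Normal regularity: the equation expresses \<open>\<partial>\<^sub>2 \<partial>\<^sub>2 u\<close> by known \<open>L\<^sup>2\<close> functions. That \<open>\<partial>\<^sub>2 u\<close> is then
  an \<open>H\<^sup>1\<close> limit of smooth quasi-periodic functions follows by projecting its jet orthogonally onto
  the closure of their jets: integrating by parts against \<open>exp(\<i> \<alpha>\<^sub>n x\<^sub>1) cos(\<mu>\<^sub>m (x\<^sub>2 + H))\<close> shows that the residual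
  is orthogonal to this complete system.
\<close>

subsection \<open>The Hilbert space of square integrable functions\<close>

text \<open>For this reason functions are replaced by their classes in one Hilbert space, and H1
  functions by triples of a value and two derivatives: \<open>H1qp\<close> becomes a closed subspace
  of a product, and every identity that is continuous in the triples passes from smooth functions to
  the closure. The operators T have order one, and nothing is estimated about their size: only the
  sign of their real part is used. Cosines are chosen in x2 because their derivatives are multiples
  of sines that vanish on both edges, so that integrating by parts against these sines produces no
  boundary terms. The weight x2 + H vanishes on the bottom edge and equals 2H on the top one; this
  is why only the top edge contributes terms with derivatives, and where the factor 2H comes
  from.\<close>

definition sqint :: "('a::euclidean_space \<Rightarrow> complex) \<Rightarrow> bool" where
  "sqint f \<longleftrightarrow> f \<in> borel_measurable lebesgue \<and> integrable lebesgue (\<lambda>x. (norm (f x))\<^sup>2)"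

lemma borel_measurable_cnj [measurable (raw)]:
  "f \<in> borel_measurable M \<Longrightarrow> (\<lambda>x. cnj (f x)) \<in> borel_measurable M"
  by (rule measurable_compose[where g = cnj, OF _ borel_measurable_continuous_onI])
    (auto intro: continuous_intros)

lemma mult_cnj_eq_norm_power: "z * cnj z = complex_of_real ((norm z)\<^sup>2)"
  by (simp only: complex_norm_square)

lemma sqint_mult_cnj:
  assumes "sqint f" "sqint g"
  shows "integrable lebesgue (\<lambda>x. f x * cnj (g x))"
proof (rule Bochner_Integration.integrable_bound)
  show "integrable lebesgue (\<lambda>x. (norm (f x))\<^sup>2 + (norm (g x))\<^sup>2)"
    using assms by (auto simp: sqint_def)
  show "(\<lambda>x. f x * cnj (g x)) \<in> borel_measurable lebesgue"
    using assms by (auto simp: sqint_def)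
  have "norm (f x * cnj (g x)) \<le> (norm (f x))\<^sup>2 + (norm (g x))\<^sup>2" for x
  proof -
    have "2 * (norm (f x) * norm (g x)) \<le> (norm (f x))\<^sup>2 + (norm (g x))\<^sup>2"
      using sum_squares_bound[of "norm (f x)" "norm (g x)"] by simp
    moreover have "0 \<le> norm (f x) * norm (g x)" by simp
    ultimately have "norm (f x) * norm (g x) \<le> (norm (f x))\<^sup>2 + (norm (g x))\<^sup>2" by linarith
    then show ?thesis by (simp add: norm_mult)
  qed
  then show "AE x in lebesgue. norm (f x * cnj (g x)) \<le> norm ((norm (f x))\<^sup>2 + (norm (g x))\<^sup>2)"
    by (intro AE_I2) simp
qed

lemma sqint_mult:
  assumes "sqint f" "c \<in> borel_measurable lebesgue" "\<And>x. norm (c x) \<le> B"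
  shows "sqint (\<lambda>x. c x * f x)"
  unfolding sqint_def
proof
  show m: "(\<lambda>x. c x * f x) \<in> borel_measurable lebesgue"
    using assms by (auto simp: sqint_def)
  show "integrable lebesgue (\<lambda>x. (norm (c x * f x))\<^sup>2)"
  proof (rule Bochner_Integration.integrable_bound)
    show "integrable lebesgue (\<lambda>x. B\<^sup>2 * (norm (f x))\<^sup>2)"
      using assms by (auto simp: sqint_def)
    show "(\<lambda>x. (norm (c x * f x))\<^sup>2) \<in> borel_measurable lebesgue"
      using m by measurable
    have "(norm (c x))\<^sup>2 \<le> B\<^sup>2" for x
      using assms(3) by (intro power_mono) auto
    then show "AE x in lebesgue. norm ((norm (c x * f x))\<^sup>2) \<le> norm (B\<^sup>2 * (norm (f x))\<^sup>2)"
      by (intro AE_I2) (simp add: norm_mult power_mult_distrib mult_right_mono)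
  qed
qed

lemma sqint_add:
  assumes "sqint f" "sqint g"
  shows "sqint (\<lambda>x. f x + g x)"
  unfolding sqint_def
proof
  show m: "(\<lambda>x. f x + g x) \<in> borel_measurable lebesgue"
    using assms by (auto simp: sqint_def)
  show "integrable lebesgue (\<lambda>x. (norm (f x + g x))\<^sup>2)"
  proof (rule Bochner_Integration.integrable_bound)
    show "integrable lebesgue (\<lambda>x. 2 * (norm (f x))\<^sup>2 + 2 * (norm (g x))\<^sup>2)"
      using assms by (auto simp: sqint_def)
    show "(\<lambda>x. (norm (f x + g x))\<^sup>2) \<in> borel_measurable lebesgue"
      using m by measurable
    have "(norm (f x + g x))\<^sup>2 \<le> 2 * (norm (f x))\<^sup>2 + 2 * (norm (g x))\<^sup>2" for x
    proof -
      have "(norm (f x + g x))\<^sup>2 \<le> (norm (f x) + norm (g x))\<^sup>2"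
        by (intro power_mono norm_triangle_ineq) auto
      also have "\<dots> \<le> 2 * (norm (f x))\<^sup>2 + 2 * (norm (g x))\<^sup>2"
        using sum_squares_bound[of "norm (f x)" "norm (g x)"] by (simp add: power2_sum)
      finally show ?thesis .
    qed
    then show "AE x in lebesgue. norm ((norm (f x + g x))\<^sup>2) \<le> norm (2 * (norm (f x))\<^sup>2 + 2 * (norm (g x))\<^sup>2)"
      by (intro AE_I2) simp
  qed
qed

lemma sqint_zero: "sqint (\<lambda>x. 0)"
  by (simp add: sqint_def)

lemma sqint_scaleR: "sqint f \<Longrightarrow> sqint (\<lambda>x. r *\<^sub>R f x)"
  using sqint_mult[of f "\<lambda>_. of_real r" "\<bar>r\<bar>"] by (simp add: scaleR_conv_of_real)

lemma sqint_uminus: "sqint f \<Longrightarrow> sqint (\<lambda>x. - f x)"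
  using sqint_scaleR[of f "-1"] by simp

lemma sqint_diff: "sqint f \<Longrightarrow> sqint g \<Longrightarrow> sqint (\<lambda>x. f x - g x)"
  using sqint_add[of f "\<lambda>x. - g x"] sqint_uminus[of g] by simp

text \<open>The bound holds at every point, which avoids essential suprema; the multipliers of
  interest are continuous functions cut off outside a bounded set.\<close>

definition bmeas :: "('a::euclidean_space \<Rightarrow> complex) \<Rightarrow> bool" where
  "bmeas c \<longleftrightarrow> c \<in> borel_measurable lebesgue \<and> (\<exists>B. \<forall>x. norm (c x) \<le> B)"

lemma sqint_bmeas: "bmeas c \<Longrightarrow> sqint f \<Longrightarrow> sqint (\<lambda>x. c x * f x)"
  by (auto simp: bmeas_def intro: sqint_mult)

\<comment> \<open>As a type, L2 can be an instance of the classes of Hilbert spaces, and products of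
  such types inherit inner product and completeness; triples of functions are treated in this way
  below.\<close>
quotient_type (overloaded) 'a lsq = "'a::euclidean_space \<Rightarrow> complex" /
    partial: "\<lambda>f g. sqint f \<and> sqint g \<and> (AE x in lebesgue. f x = g x)"
proof (rule part_equivpI)
  show "\<exists>x::'a \<Rightarrow> complex. sqint x \<and> sqint x \<and> (AE xa in lebesgue. x xa = x xa)"
    using sqint_zero by (intro exI[of _ "\<lambda>_. 0"]) auto
  show "symp (\<lambda>f g::'a \<Rightarrow> complex. sqint f \<and> sqint g \<and> (AE x in lebesgue. f x = g x))"
    by (auto simp: symp_def elim: eventually_mono)
  show "transp (\<lambda>f g::'a \<Rightarrow> complex. sqint f \<and> sqint g \<and> (AE x in lebesgue. f x = g x))"
    by (auto simp: transp_def intro: AE_mp)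
qed

text \<open>Complex linear on the left, conjugate linear on the right. The class
  \<open>real_inner\<close> retains only the real part; the imaginary part is recovered by
  multiplying one argument by \<open>\<i>\<close>.\<close>

lift_definition cin :: "'a::euclidean_space lsq \<Rightarrow> 'a lsq \<Rightarrow> complex" is
  "\<lambda>f g. (\<integral>x. f x * cnj (g x) \<partial>lebesgue)"
proof -
  fix f f' g g' :: "'a \<Rightarrow> complex"
  assume a: "sqint f \<and> sqint f' \<and> (AE x in lebesgue. f x = f' x)"
    "sqint g \<and> sqint g' \<and> (AE x in lebesgue. g x = g' x)"
  then have [measurable]: "f \<in> borel_measurable lebesgue" "f' \<in> borel_measurable lebesgue"
    "g \<in> borel_measurable lebesgue" "g' \<in> borel_measurable lebesgue"
    by (auto simp: sqint_def)
  from a show "(\<integral>x. f x * cnj (g x) \<partial>lebesgue) = (\<integral>x. f' x * cnj (g' x) \<partial>lebesgue)"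
    by (intro integral_cong_AE) auto
qed

text \<open>Multiplication by \<open>c\<close>; the junk value \<open>0\<close> is returned unless \<open>c\<close> is bounded and measurable.\<close>

lift_definition mulc :: "('a::euclidean_space \<Rightarrow> complex) \<Rightarrow> 'a lsq \<Rightarrow> 'a lsq" is
  "\<lambda>c f. if bmeas c then (\<lambda>x. c x * f x) else (\<lambda>x. 0)"
  by (auto simp: sqint_zero sqint_bmeas)

instantiation lsq :: (euclidean_space) real_vector
begin

lift_definition zero_lsq :: "'a lsq" is "\<lambda>x. 0" by (simp add: sqint_zero)
lift_definition plus_lsq :: "'a lsq \<Rightarrow> 'a lsq \<Rightarrow> 'a lsq" is "\<lambda>f g x. f x + g x"
  by (auto simp: sqint_add)
lift_definition minus_lsq :: "'a lsq \<Rightarrow> 'a lsq \<Rightarrow> 'a lsq" is "\<lambda>f g x. f x - g x"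
  by (auto simp: sqint_diff)
lift_definition uminus_lsq :: "'a lsq \<Rightarrow> 'a lsq" is "\<lambda>f x. - f x"
  by (auto simp: sqint_uminus)
lift_definition scaleR_lsq :: "real \<Rightarrow> 'a lsq \<Rightarrow> 'a lsq" is "\<lambda>r f x. r *\<^sub>R f x"
  by (auto simp: sqint_scaleR)

instance
proof
  fix x y z :: "'a lsq" and r s :: real
  show "x + y + z = x + (y + z)" by transfer (auto simp: sqint_add add.assoc)
  show "x + y = y + x" by transfer (auto simp: sqint_add add.commute)
  show "0 + x = x" by transfer auto
  show "- x + x = 0" by transfer (auto simp: sqint_zero)
  show "x - y = x + - y" by transfer (auto simp: sqint_diff)
  show "r *\<^sub>R (x + y) = r *\<^sub>R x + r *\<^sub>R y"
    by transfer (auto simp: sqint_scaleR sqint_add scaleR_add_right intro!: sqint_scaleR[of "\<lambda>x. _ x + _ x"])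
  show "(r + s) *\<^sub>R x = r *\<^sub>R x + s *\<^sub>R x"
    using sqint_scaleR[where ?'a = 'a] by transfer (auto simp: scaleR_add_left intro!: sqint_add)
  show "r *\<^sub>R s *\<^sub>R x = (r * s) *\<^sub>R x"
    using sqint_scaleR[where ?'a = 'a] by transfer auto
  show "1 *\<^sub>R x = x" by transfer auto
qed

end

instantiation lsq :: (euclidean_space) real_inner
begin

definition inner_lsq :: "'a lsq \<Rightarrow> 'a lsq \<Rightarrow> real" where "inner_lsq f g = Re (cin f g)"
definition norm_lsq :: "'a lsq \<Rightarrow> real" where "norm_lsq f = sqrt (inner f f)"
definition sgn_lsq :: "'a lsq \<Rightarrow> 'a lsq" where "sgn_lsq f = f /\<^sub>R norm f"
definition dist_lsq :: "'a lsq \<Rightarrow> 'a lsq \<Rightarrow> real" where "dist_lsq f g = norm (f - g)"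
definition uniformity_lsq :: "('a lsq \<times> 'a lsq) filter" where
  "uniformity_lsq = (INF e\<in>{0<..}. principal {(x, y). dist x y < e})"
definition open_lsq :: "'a lsq set \<Rightarrow> bool" where
  "open_lsq U \<longleftrightarrow> (\<forall>x\<in>U. \<forall>\<^sub>F (x', y) in uniformity. x' = x \<longrightarrow> y \<in> U)"

instance
proof
  fix x y z :: "'a lsq" and r s :: real
  show "dist x y = norm (x - y)" by (rule dist_lsq_def)
  show "sgn x = x /\<^sub>R norm x" by (rule sgn_lsq_def)
  show "uniformity = (INF e\<in>{0<..}. principal {(x::'a lsq, y). dist x y < e})"
    by (rule uniformity_lsq_def)
  show "open U = (\<forall>x\<in>U. \<forall>\<^sub>F (x', y) in uniformity. x' = x \<longrightarrow> y \<in> U)" for U :: "'a lsq set"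
    by (rule open_lsq_def)
  show "norm x = sqrt (inner x x)" by (rule norm_lsq_def)
  have c: "cin x y = cnj (cin y x)"
    by transfer (subst Bochner_Integration.integral_cnj [symmetric], simp add: mult.commute)
  show "inner x y = inner y x" using c by (simp add: inner_lsq_def)
  have "cin (x + y) z = cin x z + cin y z"
    by transfer (simp add: distrib_right sqint_mult_cnj)
  then show "inner (x + y) z = inner x z + inner y z" by (simp add: inner_lsq_def)
  have "cin (r *\<^sub>R x) y = r *\<^sub>R cin x y"
    by transfer (simp add: sqint_mult_cnj)
  then show "inner (r *\<^sub>R x) y = r * inner x y" by (simp add: inner_lsq_def)
  have e: "cin x x = of_real (\<integral>t. (norm (rep_lsq x t))\<^sup>2 \<partial>lebesgue)"
    by (simp only: cin.rep_eq mult_cnj_eq_norm_power integral_complex_of_real)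
  then have e': "inner x x = (\<integral>t. (norm (rep_lsq x t))\<^sup>2 \<partial>lebesgue)"
    by (simp add: inner_lsq_def)
  show "0 \<le> inner x x" by (simp add: e')
  have s: "sqint (rep_lsq x)" using Quotient_rep_reflp[OF Quotient_lsq, of x] by blast
  show "inner x x = 0 \<longleftrightarrow> x = 0"
  proof
    assume "inner x x = 0"
    then have "AE t in lebesgue. (norm (rep_lsq x t))\<^sup>2 = 0"
      using s integral_nonneg_eq_0_iff_AE[of lebesgue "\<lambda>t. (norm (rep_lsq x t))\<^sup>2"]
      by (simp add: e' sqint_def)
    then have "AE t in lebesgue. rep_lsq x t = 0" by simp
    with s have "abs_lsq (rep_lsq x) = abs_lsq (\<lambda>_. 0)"
      by (intro Quotient_rel_abs[OF Quotient_lsq]) (simp add: sqint_zero)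
    then show "x = 0"
      by (simp add: Quotient_abs_rep[OF Quotient_lsq] zero_lsq_def)
  next
    assume "x = 0"
    then have "cin x x = cin (0::'a lsq) 0" by simp
    also have "\<dots> = 0" by transfer simp
    finally show "inner x x = 0" by (simp add: inner_lsq_def)
  qed
qed

end


lemma sqint_rep: "sqint (rep_lsq x)"
  using Quotient_rep_reflp[OF Quotient_lsq, of x] by blast

lemma borel_measurable_rep_lsq [measurable]: "rep_lsq x \<in> borel_measurable lebesgue"
  using sqint_rep by (auto simp: sqint_def)

lemma abs_rep_lsq [simp]: "abs_lsq (rep_lsq x) = x"
  by (rule Quotient_abs_rep[OF Quotient_lsq])

lemma abs_lsq_eq_iff:
  assumes "sqint f" "sqint g"
  shows "abs_lsq f = abs_lsq g \<longleftrightarrow> (AE x in lebesgue. f x = g x)"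
  using Quotient_rel[OF Quotient_lsq, of f g] assms by auto

lemma
  assumes "sqint f" "sqint g"
  shows abs_lsq_add: "abs_lsq f + abs_lsq g = abs_lsq (\<lambda>x. f x + g x)"
    and abs_lsq_diff: "abs_lsq f - abs_lsq g = abs_lsq (\<lambda>x. f x - g x)"
    and cin_abs_lsq: "cin (abs_lsq f) (abs_lsq g) = (\<integral>x. f x * cnj (g x) \<partial>lebesgue)"
  using assms by (auto simp: plus_lsq.abs_eq minus_lsq.abs_eq cin.abs_eq)

lemma norm_abs_lsq:
  assumes "sqint f"
  shows "(norm (abs_lsq f))\<^sup>2 = (\<integral>x. (norm (f x))\<^sup>2 \<partial>lebesgue)"
  using assms
  by (simp only: power2_norm_eq_inner inner_lsq_def cin_abs_lsq mult_cnj_eq_norm_power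
      integral_complex_of_real Re_complex_of_real)

text \<open>Riesz--Fischer. Along a subsequence whose consecutive distances are at most \<open>4\<^sup>-\<^sup>k\<close>, the series
  \<open>\<Sum>\<^sub>k 4\<^sup>k |g\<^sub>k\<^sub>+\<^sub>1 - g\<^sub>k|\<^sup>2\<close> has a finite integral, which forces pointwise convergence
  almost everywhere; Fatou's lemma identifies the pointwise limit as the limit in the mean.\<close>

instance lsq :: (euclidean_space) complete_space
proof
  fix X :: "nat \<Rightarrow> 'a lsq"
  assume C: "Cauchy X"
  have "\<exists>N. \<forall>m\<ge>N. \<forall>n\<ge>N. dist (X m) (X n) < (1/4) ^ k" for k :: nat
    using C unfolding Cauchy_def by (metis zero_less_power zero_less_divide_1_iff zero_less_numeral)
  then obtain N where N: "\<And>k m n. m \<ge> N k \<Longrightarrow> n \<ge> N k \<Longrightarrow> dist (X m) (X n) < (1/4) ^ k"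
    by metis
  \<comment> \<open>Summing all earlier thresholds makes \<open>r\<close> monotone and at the same
    time at least \<open>k\<close> and at least \<open>N k\<close>.\<close>
  define r where "r k = k + (\<Sum>i\<le>k. N i)" for k
  have rN: "r k \<ge> N k" for k
    using member_le_sum[of k "{..k}" N] by (auto simp: r_def intro: trans_le_add2)
  have rSuc: "r (Suc k) \<ge> r k" for k by (simp add: r_def)
  have rk: "r k \<ge> k" for k by (simp add: r_def)
  define g where "g k = rep_lsq (X (r k))" for k
  have g [measurable]: "g k \<in> borel_measurable lebesgue" for k
    by (simp add: g_def)
  have nn: "(\<integral>\<^sup>+x. ennreal ((norm (rep_lsq y x - rep_lsq z x))\<^sup>2) \<partial>lebesgue) = ennreal ((norm (y - z))\<^sup>2)"
    for y z :: "'a lsq"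
  proof -
    have s: "sqint (\<lambda>x. rep_lsq y x - rep_lsq z x)" by (intro sqint_diff sqint_rep)
    have "(norm (y - z))\<^sup>2 = (norm (abs_lsq (\<lambda>x. rep_lsq y x - rep_lsq z x)))\<^sup>2"
      by (simp flip: abs_lsq_diff add: sqint_rep)
    also have "\<dots> = (\<integral>x. (norm (rep_lsq y x - rep_lsq z x))\<^sup>2 \<partial>lebesgue)"
      by (rule norm_abs_lsq[OF s])
    finally show ?thesis
      using s by (simp add: nn_integral_eq_integral sqint_def)
  qed
  have "(\<integral>\<^sup>+x. (\<Sum>k. ennreal (4 ^ k * (norm (g (Suc k) x - g k x))\<^sup>2)) \<partial>lebesgue)
      = (\<Sum>k. \<integral>\<^sup>+x. ennreal (4 ^ k * (norm (g (Suc k) x - g k x))\<^sup>2) \<partial>lebesgue)"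
    by (rule nn_integral_suminf) measurable
  also have "\<dots> \<le> (\<Sum>k. ennreal ((1/4) ^ k))"
  proof (intro suminf_le summableI)
    fix k
    have "(\<integral>\<^sup>+x. ennreal (4 ^ k * (norm (g (Suc k) x - g k x))\<^sup>2) \<partial>lebesgue)
      = ennreal (4 ^ k) * ennreal ((norm (X (r (Suc k)) - X (r k)))\<^sup>2)"
      by (subst ennreal_mult) (simp_all add: nn_integral_cmult nn g_def)
    also have "\<dots> = ennreal (4 ^ k * (norm (X (r (Suc k)) - X (r k)))\<^sup>2)"
      by (simp add: ennreal_mult)
    also have "\<dots> \<le> ennreal (4 ^ k * ((1/4) ^ k)\<^sup>2)"
    proof (intro ennreal_leI mult_left_mono power_mono)
      show "norm (X (r (Suc k)) - X (r k)) \<le> (1/4) ^ k"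
        using N[of k "r (Suc k)" "r k"] rN[of k] rSuc[of k] by (simp add: dist_norm)
    qed auto
    also have "4 ^ k * ((1/4::real) ^ k)\<^sup>2 = (1/4) ^ k"
      by (simp add: power2_eq_square field_simps)
    finally show "(\<integral>\<^sup>+x. ennreal (4 ^ k * (norm (g (Suc k) x - g k x))\<^sup>2) \<partial>lebesgue) \<le> ennreal ((1/4) ^ k)" .
  qed
  also have "\<dots> < \<infinity>"
    by (subst suminf_ennreal2) auto
  finally have "(\<integral>\<^sup>+x. (\<Sum>k. ennreal (4 ^ k * (norm (g (Suc k) x - g k x))\<^sup>2)) \<partial>lebesgue) \<noteq> \<infinity>"
    by simp
  then have fin: "AE x in lebesgue. (\<Sum>k. ennreal (4 ^ k * (norm (g (Suc k) x - g k x))\<^sup>2)) \<noteq> \<infinity>"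
    by (rule nn_integral_PInf_AE[rotated]) measurable
  have conv: "AE x in lebesgue. convergent (\<lambda>k. g k x)"
    using fin
  proof eventually_elim
    case (elim x)
    define b where "b k = 4 ^ k * (norm (g (Suc k) x - g k x))\<^sup>2" for k
    have sb: "summable b"
      by (rule summable_suminf_not_top) (use elim in \<open>auto simp: b_def\<close>)
    then obtain M where M: "\<And>k. norm (b k) \<le> M"
      using convergent_imp_Bseq[OF convergentI[OF summable_LIMSEQ_zero[OF sb]]] by (metis BseqE)
    \<comment> \<open>A summable \<open>b\<close> is bounded by some \<open>M\<close>; dividing by
      the weight \<open>4 ^ k\<close> and taking roots leaves a geometric series.\<close>
    have "norm (g (Suc k) x - g k x) \<le> sqrt M * (1/2) ^ k" for k
    proof -
      have M0: "0 \<le> M" using order_trans[OF norm_ge_zero M] .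
      have q: "(1/4::real) ^ k = ((1/2) ^ k)\<^sup>2"
        unfolding power2_eq_square power_mult_distrib [symmetric] by simp
      have "(norm (g (Suc k) x - g k x))\<^sup>2 = b k * (1/4) ^ k"
        by (simp add: b_def power_one_over)
      also have "\<dots> \<le> M * (1/4) ^ k"
        using M[of k] by (intro mult_right_mono) auto
      also have "\<dots> = (sqrt M)\<^sup>2 * ((1/2) ^ k)\<^sup>2"
        using M0 by (simp only: q real_sqrt_pow2)
      also have "\<dots> = (sqrt M * (1/2) ^ k)\<^sup>2"
        by (rule power_mult_distrib [symmetric])
      finally show ?thesis
        by (rule power2_le_imp_le) (use M0 in simp)
    qed
    note est = this
    have summ: "summable (\<lambda>k. g (Suc k) x - g k x)"
    proof (rule summable_comparison_test')
      show "summable (\<lambda>k. sqrt M * (1/2) ^ k)"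
        by (intro summable_mult summable_geometric) auto
      show "\<And>k. k \<ge> 0 \<Longrightarrow> norm (g (Suc k) x - g k x) \<le> sqrt M * (1/2) ^ k"
        by (rule est)
    qed
    have tele: "(\<Sum>k<n. g (Suc k) x - g k x) = g n x - g 0 x" for n
      by (induct n) auto
    from summ have "convergent (\<lambda>n. \<Sum>k<n. g (Suc k) x - g k x)"
      by (simp add: summable_iff_convergent)
    then have "convergent (\<lambda>n. (g n x - g 0 x))"
      by (simp only: tele)
    then show ?case
      using convergent_add[OF _ convergent_const[of "g 0 x"], of "\<lambda>n. g n x - g 0 x"] by simp
  qed
  define f where "f x = lim (\<lambda>k. g k x)" for x
  have f [measurable]: "f \<in> borel_measurable lebesgue"
    unfolding f_def by (rule borel_measurable_lim_metric) measurable
  \<comment> \<open>Fatou's lemma with \<open>n\<close> fixed: \<open>g k\<close> represents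
    \<open>X (r k)\<close>, and \<open>r k \<ge> k\<close> places it beyond
    \<open>K\<close>.\<close>
  have est: "(\<integral>\<^sup>+x. ennreal ((norm (f x - rep_lsq (X n) x))\<^sup>2) \<partial>lebesgue) \<le> ennreal (e\<^sup>2)"
    if e: "e > 0" and K: "\<And>m. m \<ge> K \<Longrightarrow> dist (X m) (X n) \<le> e" for e K n
  proof -
    have "(\<integral>\<^sup>+x. ennreal ((norm (f x - rep_lsq (X n) x))\<^sup>2) \<partial>lebesgue)
      = (\<integral>\<^sup>+x. liminf (\<lambda>k. ennreal ((norm (g k x - rep_lsq (X n) x))\<^sup>2)) \<partial>lebesgue)"
    proof (rule nn_integral_cong_AE)
      show "AE x in lebesgue. ennreal ((norm (f x - rep_lsq (X n) x))\<^sup>2)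
          = liminf (\<lambda>k. ennreal ((norm (g k x - rep_lsq (X n) x))\<^sup>2))"
        using conv
      proof eventually_elim
        case (elim x)
        then have "(\<lambda>k. g k x) \<longlonglongrightarrow> f x"
          by (simp add: f_def convergent_LIMSEQ_iff)
        then have "(\<lambda>k. ennreal ((norm (g k x - rep_lsq (X n) x))\<^sup>2)) \<longlonglongrightarrow> ennreal ((norm (f x - rep_lsq (X n) x))\<^sup>2)"
          by (intro tendsto_intros tendsto_ennrealI)
        then show ?case
          by (intro lim_imp_Liminf[symmetric]) auto
      qed
    qed
    also have "\<dots> \<le> liminf (\<lambda>k. \<integral>\<^sup>+x. ennreal ((norm (g k x - rep_lsq (X n) x))\<^sup>2) \<partial>lebesgue)"
      by (rule nn_integral_liminf) measurable
    also have "\<dots> \<le> liminf (\<lambda>k. ennreal (e\<^sup>2))"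
    proof (rule Liminf_mono, rule eventually_sequentiallyI[of K])
      fix k assume "K \<le> k"
      then have "norm (X (r k) - X n) \<le> e"
        using K[of "r k"] rk[of k] by (simp add: dist_norm)
      then show "(\<integral>\<^sup>+x. ennreal ((norm (g k x - rep_lsq (X n) x))\<^sup>2) \<partial>lebesgue) \<le> ennreal (e\<^sup>2)"
        unfolding g_def nn by (intro ennreal_leI power_mono) auto
    qed
    also have "\<dots> = ennreal (e\<^sup>2)" by (simp add: Liminf_const)
    finally show ?thesis .
  qed
  have sq: "sqint (\<lambda>x. f x - rep_lsq (X n) x)"
    if e: "e > 0" and K: "\<And>m. m \<ge> K \<Longrightarrow> dist (X m) (X n) \<le> e" for e K n
  proof -
    have "(\<integral>\<^sup>+x. ennreal ((norm (f x - rep_lsq (X n) x))\<^sup>2) \<partial>lebesgue) < \<infinity>"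
      by (rule order_le_less_trans[OF est[OF e K]]) auto
    then show ?thesis
      by (auto simp: sqint_def intro!: integrableI_bounded)
  qed
  obtain N1 where N1: "\<And>m n. m \<ge> N1 \<Longrightarrow> n \<ge> N1 \<Longrightarrow> dist (X m) (X n) < 1"
    using C unfolding Cauchy_def by (metis zero_less_one)
  \<comment> \<open>Square integrability of the limit itself comes from one index with tolerance 1,
    by adding that member of the sequence back.\<close>
  have "sqint (\<lambda>x. (f x - rep_lsq (X N1) x) + rep_lsq (X N1) x)"
    by (intro sqint_add sqint_rep sq[of 1 N1]) (auto intro: less_imp_le N1)
  then have sf: "sqint f" by simp
  have "X \<longlonglongrightarrow> abs_lsq f"
  proof (rule metric_LIMSEQ_I)
    fix e :: real assume e: "e > 0"
    then obtain K where K: "\<And>m n. m \<ge> K \<Longrightarrow> n \<ge> K \<Longrightarrow> dist (X m) (X n) < e / 2"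
      using C unfolding Cauchy_def by (metis half_gt_zero)
    show "\<exists>no. \<forall>n\<ge>no. dist (X n) (abs_lsq f) < e"
    proof (intro exI allI impI)
      fix n assume n: "n \<ge> K"
      have b: "\<And>m. m \<ge> K \<Longrightarrow> dist (X m) (X n) \<le> e / 2"
        using K n by (simp add: less_imp_le)
      have s: "sqint (\<lambda>x. f x - rep_lsq (X n) x)" by (rule sq[OF _ b]) (use e in auto)
      have "abs_lsq f - X n = abs_lsq (\<lambda>x. f x - rep_lsq (X n) x)"
        using abs_lsq_diff[OF sf sqint_rep, of "X n"] by simp
      then have "ennreal ((norm (abs_lsq f - X n))\<^sup>2) \<le> ennreal ((e/2)\<^sup>2)"
        using est[OF _ b] e s by (simp add: norm_abs_lsq sqint_def nn_integral_eq_integral)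
      then have "norm (abs_lsq f - X n) \<le> e / 2"
        using e by (simp add: ennreal_le_iff power2_le_iff_abs_le)
      then show "dist (X n) (abs_lsq f) < e"
        using e by (simp add: dist_norm norm_minus_commute)
    qed
  qed
  then show "convergent X" by (rule convergentI)
qed

section \<open>The sesquilinear form and multiplication operators\<close>

lemma
  fixes x y z :: "'a::euclidean_space lsq"
  shows cin_add_left: "cin (x + y) z = cin x z + cin y z"
    and cin_add_right: "cin z (x + y) = cin z x + cin z y"
    and cin_scaleR_left: "cin (r *\<^sub>R x) z = r *\<^sub>R cin x z"
    and cin_scaleR_right: "cin z (r *\<^sub>R x) = r *\<^sub>R cin z x"
proof -
  show "cin (x + y) z = cin x z + cin y z"
    by transfer (simp add: distrib_right sqint_mult_cnj)
  show "cin z (x + y) = cin z x + cin z y"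
    by transfer (simp add: distrib_left sqint_mult_cnj)
  show "cin (r *\<^sub>R x) z = r *\<^sub>R cin x z"
    by transfer (simp add: sqint_mult_cnj)
  show "cin z (r *\<^sub>R x) = r *\<^sub>R cin z x"
    by transfer (simp add: sqint_mult_cnj)
qed

lemma cin_commute: "cin x y = cnj (cin y x)"
  by transfer (subst Bochner_Integration.integral_cnj [symmetric], simp add: mult.commute)

lemma cin_self: "cin x x = of_real ((norm x)\<^sup>2)"
  using cin_commute[of x x] by (simp add: complex_eq_iff power2_norm_eq_inner inner_lsq_def)

lemma bmeas_const [simp]: "bmeas (\<lambda>_. c)"
  unfolding bmeas_def by (intro conjI exI[of _ "norm c"]) simp_all

lemma bmeas_mult:
  assumes "bmeas b" "bmeas c"
  shows "bmeas (\<lambda>x. b x * c x)"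
proof -
  obtain B C where B: "\<And>x. norm (b x) \<le> B" and C: "\<And>x. norm (c x) \<le> C"
    using assms by (auto simp: bmeas_def)
  have "0 \<le> B" using order_trans[OF norm_ge_zero B] .
  then have "\<forall>x. norm (b x * c x) \<le> B * C"
    by (auto simp: norm_mult intro!: mult_mono B C)
  then show ?thesis using assms by (auto simp: bmeas_def)
qed

lemma bmeas_cnj: "bmeas c \<Longrightarrow> bmeas (\<lambda>x. cnj (c x))"
  by (auto simp: bmeas_def)

lemma cin_mulc_left: "bmeas c \<Longrightarrow> cin (mulc c x) y = cin x (mulc (\<lambda>t. cnj (c t)) y)"
  by transfer (simp add: bmeas_cnj ac_simps)

lemma mulc_mulc: "bmeas b \<Longrightarrow> bmeas c \<Longrightarrow> mulc b (mulc c x) = mulc (\<lambda>t. b t * c t) x"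
  by transfer (simp add: bmeas_mult sqint_bmeas mult.assoc)

lemma mulc_add: "bmeas b \<Longrightarrow> bmeas c \<Longrightarrow> bmeas (\<lambda>t. b t + c t) \<Longrightarrow> mulc (\<lambda>t. b t + c t) x = mulc b x + mulc c x"
  by transfer (simp add: sqint_bmeas sqint_add distrib_right)

lemma cin_mulc_const_left: "cin (mulc (\<lambda>_. c) x) y = c * cin x y"
  by transfer (simp add: mult.assoc)

lemma norm_mulc_le:
  assumes "bmeas c" "\<And>t. norm (c t) \<le> B"
  shows "norm (mulc c x) \<le> B * norm x"
proof -
  have B: "0 \<le> B" using order_trans[OF norm_ge_zero assms(2)] .
  have s: "sqint (rep_lsq x)" by (rule sqint_rep)
  have s': "sqint (\<lambda>t. c t * rep_lsq x t)" by (intro sqint_bmeas assms s)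
  have "mulc c x = abs_lsq (\<lambda>t. c t * rep_lsq x t)"
    using mulc.abs_eq[of "rep_lsq x" c] s assms by simp
  then have "(norm (mulc c x))\<^sup>2 = (\<integral>t. (norm (c t * rep_lsq x t))\<^sup>2 \<partial>lebesgue)"
    using s' by (simp add: norm_abs_lsq)
  also have "\<dots> \<le> (\<integral>t. B\<^sup>2 * (norm (rep_lsq x t))\<^sup>2 \<partial>lebesgue)"
  proof (rule integral_mono)
    show "integrable lebesgue (\<lambda>t. (norm (c t * rep_lsq x t))\<^sup>2)"
      using s' by (simp add: sqint_def)
    show "integrable lebesgue (\<lambda>t. B\<^sup>2 * (norm (rep_lsq x t))\<^sup>2)"
      using s by (simp add: sqint_def)
    show "(norm (c t * rep_lsq x t))\<^sup>2 \<le> B\<^sup>2 * (norm (rep_lsq x t))\<^sup>2" for t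
      unfolding norm_mult power_mult_distrib using assms(2)
      by (intro mult_right_mono power_mono) simp_all
  qed
  also have "\<dots> = (B * norm x)\<^sup>2"
    using norm_abs_lsq[OF s] by (simp add: power_mult_distrib)
  finally show ?thesis by (rule power2_le_imp_le) (simp add: B)
qed

lemma bounded_linear_mulc: "bounded_linear (mulc c)"
proof (cases "bmeas c")
  case True
  then obtain B where B: "\<And>t. norm (c t) \<le> B" by (auto simp: bmeas_def)
  show ?thesis
  proof (rule bounded_linear_intro)
    show "mulc c (x + y) = mulc c x + mulc c y" for x y
      using True by transfer (simp add: sqint_bmeas sqint_add distrib_left)
    show "mulc c (r *\<^sub>R x) = r *\<^sub>R mulc c x" for r x
      using True by transfer (simp add: sqint_bmeas sqint_scaleR)
    show "norm (mulc c x) \<le> norm x * B" for x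
      using norm_mulc_le[OF True B] by (simp add: mult.commute)
  qed
next
  case False
  then have "mulc c = (\<lambda>_. 0)" by (intro ext, transfer) (simp add: sqint_zero)
  then show ?thesis by (simp add: bounded_linear_zero)
qed

text \<open>Real and imaginary part are bounded separately by the real Cauchy-Schwarz inequality,
  the latter after multiplying by \<open>\<i>\<close>. The resulting factor 2 is not sharp and
  reappears in the trace and energy estimates.\<close>

lemma norm_cin_le: "norm (cin x y) \<le> 2 * (norm x * norm y)"
proof -
  have "Im (cin x y) = - inner (mulc (\<lambda>_. \<i>) x) y"
    by (simp add: inner_lsq_def cin_mulc_const_left)
  then have "\<bar>Im (cin x y)\<bar> \<le> norm (mulc (\<lambda>_. \<i>) x) * norm y"
    using Cauchy_Schwarz_ineq2[of "mulc (\<lambda>_. \<i>) x" y] by simp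
  also have "\<dots> \<le> norm x * norm y"
    using norm_mulc_le[of "\<lambda>_. \<i>" 1 x] by (intro mult_right_mono) auto
  finally have "\<bar>Im (cin x y)\<bar> \<le> norm x * norm y" .
  moreover have "\<bar>Re (cin x y)\<bar> \<le> norm x * norm y"
    using Cauchy_Schwarz_ineq2[of x y] by (simp add: inner_lsq_def)
  ultimately show ?thesis using cmod_le[of "cin x y"] by linarith
qed

interpretation cin: bounded_bilinear "cin :: 'a::euclidean_space lsq \<Rightarrow> 'a lsq \<Rightarrow> complex"
proof
  show "\<exists>K. \<forall>x y. norm (cin x y :: complex) \<le> norm (x :: 'a lsq) * norm y * K"
    by (intro exI[of _ 2] allI) (metis norm_cin_le mult.commute)
qed (simp_all add: cin_add_left cin_add_right cin_scaleR_left cin_scaleR_right)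

lemmas tendsto_mulc [tendsto_intros] = bounded_linear.tendsto[OF bounded_linear_mulc]
lemmas tendsto_cin [tendsto_intros] = cin.tendsto

subsection \<open>Square integrable functions on a set\<close>

text \<open>Extension by zero, so that the classes over all subsets \<open>S\<close> share one
  type.\<close>

definition toL :: "'a::euclidean_space set \<Rightarrow> ('a \<Rightarrow> complex) \<Rightarrow> 'a lsq" where
  "toL S f = abs_lsq (\<lambda>x. indicator S x *\<^sub>R f x)"

text \<open>A continuous coefficient may be unbounded on the whole space; cutting it off to a
  bounded \<open>S\<close> makes it an admissible multiplier and does not change its action on
  functions supported in \<open>S\<close>.\<close>

definition restr :: "'a::euclidean_space set \<Rightarrow> ('a \<Rightarrow> complex) \<Rightarrow> 'a \<Rightarrow> complex" where
  "restr S c x = indicator S x *\<^sub>R c x"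

lemma L2_iff_sqint:
  assumes S: "S \<in> sets lebesgue"
  shows "f \<in> L2 S \<longleftrightarrow> sqint (\<lambda>x. indicator S x *\<^sub>R f x)"
proof -
  have eq: "(\<lambda>x. (norm (indicat_real S x *\<^sub>R f x))\<^sup>2) = (\<lambda>x. indicat_real S x *\<^sub>R (norm (f x))\<^sup>2)"
    by (auto simp: indicator_def)
  show ?thesis
    unfolding L2_def sqint_def mem_Collect_eq eq
    using S by (subst borel_measurable_restrict_space_iff)
      (auto simp: integrable_restrict_space set_integrable_def)
qed

context
  fixes S :: "'a::euclidean_space set"
  assumes S: "S \<in> sets lebesgue"
begin

lemma toL_eq_iff:
  assumes "f \<in> L2 S" "g \<in> L2 S"
  shows "toL S f = toL S g \<longleftrightarrow> (AE x in lebesgue_on S. f x = g x)"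
proof -
  have "toL S f = toL S g \<longleftrightarrow> (AE x in lebesgue. indicat_real S x *\<^sub>R f x = indicat_real S x *\<^sub>R g x)"
    using assms S by (simp add: toL_def abs_lsq_eq_iff L2_iff_sqint)
  also have "\<dots> \<longleftrightarrow> (AE x in lebesgue. x \<in> S \<longrightarrow> f x = g x)"
    by (intro arg_cong2[where f = almost_everywhere] ext) (auto simp: indicator_def)
  also have "\<dots> \<longleftrightarrow> (AE x in lebesgue_on S. f x = g x)"
    using S by (subst AE_restrict_space_iff) auto
  finally show ?thesis .
qed

lemma
  assumes "f \<in> L2 S" "g \<in> L2 S"
  shows L2_add: "(\<lambda>x. f x + g x) \<in> L2 S"
    and L2_diff: "(\<lambda>x. f x - g x) \<in> L2 S"
    and toL_add: "toL S (\<lambda>x. f x + g x) = toL S f + toL S g"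
    and toL_diff: "toL S (\<lambda>x. f x - g x) = toL S f - toL S g"
    and integrable_mult_cnj: "integrable (lebesgue_on S) (\<lambda>x. f x * cnj (g x))"
    and cin_toL: "cin (toL S f) (toL S g) = (\<integral>x. f x * cnj (g x) \<partial>lebesgue_on S)"
proof -
  note f = assms(1)[unfolded L2_iff_sqint[OF S]] and g = assms(2)[unfolded L2_iff_sqint[OF S]]
  show "(\<lambda>x. f x + g x) \<in> L2 S" "(\<lambda>x. f x - g x) \<in> L2 S"
    using sqint_add[OF f g] sqint_diff[OF f g] S
    by (simp_all add: L2_iff_sqint scaleR_add_right scaleR_diff_right)
  show "toL S (\<lambda>x. f x + g x) = toL S f + toL S g" "toL S (\<lambda>x. f x - g x) = toL S f - toL S g"
    using f g by (simp_all add: toL_def abs_lsq_add abs_lsq_diff scaleR_add_right scaleR_diff_right)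
  have eq: "(\<lambda>x. (indicat_real S x *\<^sub>R f x) * cnj (indicat_real S x *\<^sub>R g x))
      = (\<lambda>x. indicat_real S x *\<^sub>R (f x * cnj (g x)))"
    by (auto simp: indicator_def)
  show "integrable (lebesgue_on S) (\<lambda>x. f x * cnj (g x))"
    using sqint_mult_cnj[OF f g] S unfolding eq by (simp add: integrable_restrict_space set_integrable_def)
  show "cin (toL S f) (toL S g) = (\<integral>x. f x * cnj (g x) \<partial>lebesgue_on S)"
    unfolding toL_def cin_abs_lsq [OF f g] eq using S
    by (simp add: integral_restrict_space set_lebesgue_integral_def)
qed

lemma L2_dist_eq:
  assumes "f \<in> L2 S" "g \<in> L2 S"
  shows "L2_dist S f g = norm (toL S f - toL S g)"
proof -
  have d: "(\<lambda>x. f x - g x) \<in> L2 S" using assms by (rule L2_diff)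
  have "of_real ((norm (toL S (\<lambda>x. f x - g x)))\<^sup>2) = complex_of_real (\<integral>x. (norm (f x - g x))\<^sup>2 \<partial>lebesgue_on S)"
    unfolding cin_self[symmetric] cin_toL[OF d d]
    by (simp only: mult_cnj_eq_norm_power integral_complex_of_real)
  then have "(norm (toL S (\<lambda>x. f x - g x)))\<^sup>2 = (\<integral>x. (norm (f x - g x))\<^sup>2 \<partial>lebesgue_on S)"
    by (simp only: of_real_eq_iff)
  then show ?thesis
    unfolding L2_dist_def toL_diff [OF assms, symmetric] by (metis norm_ge_zero real_sqrt_unique)
qed

lemma L2_mult:
  assumes "bmeas (restr S c)" "f \<in> L2 S"
  shows "(\<lambda>x. c x * f x) \<in> L2 S" "toL S (\<lambda>x. c x * f x) = mulc (restr S c) (toL S f)"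
proof -
  note f = assms(2)[unfolded L2_iff_sqint[OF S]]
  have eq: "(\<lambda>x. restr S c x * (indicat_real S x *\<^sub>R f x)) = (\<lambda>x. indicat_real S x *\<^sub>R (c x * f x))"
    by (auto simp: indicator_def restr_def)
  show "(\<lambda>x. c x * f x) \<in> L2 S"
    using sqint_bmeas[OF assms(1) f, unfolded eq] S by (simp add: L2_iff_sqint)
  show "toL S (\<lambda>x. c x * f x) = mulc (restr S c) (toL S f)"
    unfolding toL_def eq [symmetric]
    using f assms(1) mulc.abs_eq[of "\<lambda>x. indicat_real S x *\<^sub>R f x" "restr S c"] by simp
qed

lemma L2_const_mult: "f \<in> L2 S \<Longrightarrow> (\<lambda>x. c * f x) \<in> L2 S"
  and toL_const_mult: "f \<in> L2 S \<Longrightarrow> toL S (\<lambda>x. c * f x) = mulc (\<lambda>_. c) (toL S f)"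
proof -
  assume "f \<in> L2 S"
  note f = this[unfolded L2_iff_sqint[OF S]]
  have eq: "(\<lambda>x. c * (indicat_real S x *\<^sub>R f x)) = (\<lambda>x. indicat_real S x *\<^sub>R (c * f x))"
    by (auto simp: indicator_def)
  show "(\<lambda>x. c * f x) \<in> L2 S"
    using sqint_bmeas[OF bmeas_const f, of c, unfolded eq] S by (simp add: L2_iff_sqint)
  show "toL S (\<lambda>x. c * f x) = mulc (\<lambda>_. c) (toL S f)"
    using f mulc.abs_eq[of "\<lambda>x. indicat_real S x *\<^sub>R f x" "\<lambda>_. c"]
    by (simp add: toL_def eq)
qed

lemma L2_scaleR: "f \<in> L2 S \<Longrightarrow> (\<lambda>x. r *\<^sub>R f x) \<in> L2 S"
  using L2_const_mult[of f "of_real r"] by (simp add: scaleR_conv_of_real)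

lemma toL_scaleR: "f \<in> L2 S \<Longrightarrow> toL S (\<lambda>x. r *\<^sub>R f x) = r *\<^sub>R toL S f"
  using sqint_scaleR[of "\<lambda>x. indicat_real S x *\<^sub>R f x" r] S
  by (simp add: L2_iff_sqint toL_def scaleR_lsq.abs_eq mult.commute)

lemma L2_zero: "(\<lambda>x. 0) \<in> L2 S"
  using S by (simp add: L2_iff_sqint sqint_zero)

lemma toL_zero: "toL S (\<lambda>x. 0) = 0"
  by (simp add: toL_def zero_lsq_def)

end

lemma restr_bmeas_one: "S \<in> sets lebesgue \<Longrightarrow> bmeas (restr S (\<lambda>_. 1))"
  unfolding bmeas_def restr_def
  by (intro conjI exI[of _ 1] borel_measurable_scaleR borel_measurable_indicator) (auto simp: indicator_def)

text \<open>The range consists of the fixed points of the bounded operator of multiplication by the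
  indicator of \<open>S\<close>. Closedness lets a limit of classes be represented again by a
  function in \<open>L2 S\<close>.\<close>

lemma closed_range_toL:
  assumes S: "S \<in> sets lebesgue"
  shows "closed (toL S ` L2 S)"
proof -
  have "toL S ` L2 S = {x. mulc (restr S (\<lambda>_. 1)) x = x}"
  proof safe
    fix f assume "f \<in> L2 S"
    then show "mulc (restr S (\<lambda>_. 1)) (toL S f) = toL S f"
      by (rule L2_mult(2)[OF S restr_bmeas_one[OF S], unfolded mult_1_left, symmetric])
  next
    fix x assume x: "mulc (restr S (\<lambda>_. 1)) x = x"
    have s: "sqint (\<lambda>t. restr S (\<lambda>_. 1) t * rep_lsq x t)"
      by (intro sqint_bmeas restr_bmeas_one S sqint_rep)
    have eq: "(\<lambda>t. restr S (\<lambda>_. 1) t * rep_lsq x t) = (\<lambda>t. indicat_real S t *\<^sub>R rep_lsq x t)"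
      by (auto simp: indicator_def restr_def)
    have "x = abs_lsq (\<lambda>t. restr S (\<lambda>_. 1) t * rep_lsq x t)"
      using mulc.abs_eq[of "rep_lsq x" "restr S (\<lambda>_. 1)"] sqint_rep[of x] restr_bmeas_one[OF S]
      by (simp add: x)
    then have "x = toL S (rep_lsq x)" by (simp add: eq toL_def)
    moreover have "rep_lsq x \<in> L2 S" using s S by (simp add: L2_iff_sqint eq)
    ultimately show "x \<in> toL S ` L2 S" by blast
  qed
  moreover have "closed {x. mulc (restr S (\<lambda>_. 1)) x = x}"
    by (intro closed_Collect_eq continuous_on_id
        linear_continuous_on bounded_linear_mulc)
  ultimately show ?thesis by simp
qed

lemma norm_toL:
  assumes S: "S \<in> sets lebesgue" and g: "g \<in> L2 S"
  shows "(norm (toL S g))\<^sup>2 = (\<integral>x. (norm (g x))\<^sup>2 \<partial>lebesgue_on S)"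
proof -
  have "of_real ((norm (toL S g))\<^sup>2) = complex_of_real (\<integral>x. (norm (g x))\<^sup>2 \<partial>lebesgue_on S)"
    unfolding cin_self[symmetric] cin_toL[OF S g g]
    by (simp only: mult_cnj_eq_norm_power integral_complex_of_real)
  then show ?thesis by (simp only: of_real_eq_iff)
qed

subsection \<open>Convex sets in Hilbert spaces\<close>

text \<open>Parallelogram identity: if the midpoints are almost as long as the vectors, the
  differences are short. Upper bounds \<open>d\<close> and lower bounds \<open>e\<close> are kept
  apart because one application has a constant infimum for \<open>e\<close>, while the other uses
  the norms themselves for both.\<close>

lemma min_norm_sequence_Cauchy:
  fixes k :: "nat \<Rightarrow> 'a::real_inner"
  assumes d: "\<And>i. norm (k i) \<le> d i" "d \<longlonglongrightarrow> D"
    and mid: "\<And>i j. i \<le> j \<Longrightarrow> e i \<le> norm ((k i + k j) /\<^sub>R 2)" and e: "e \<longlonglongrightarrow> D" and D: "D \<ge> 0" and "\<And>i. 0 \<le> e i"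
  shows "Cauchy k"
proof -
  have par: "(norm (k i - k j))\<^sup>2 \<le> 2 * (d i)\<^sup>2 + 2 * (d j)\<^sup>2 - 4 * (e i)\<^sup>2" if "i \<le> j" for i j
  proof -
    have "(norm (k i - k j))\<^sup>2 = 2 * (norm (k i))\<^sup>2 + 2 * (norm (k j))\<^sup>2 - 4 * (norm ((k i + k j) /\<^sub>R 2))\<^sup>2"
    proof -
      have "(norm ((k i + k j) /\<^sub>R 2))\<^sup>2 = (norm (k i + k j))\<^sup>2 / 4"
        by (simp add: power_divide)
      then show ?thesis
        by (simp add: power2_norm_eq_inner inner_simps inner_commute)
    qed
    moreover have "(norm (k i))\<^sup>2 \<le> (d i)\<^sup>2" "(norm (k j))\<^sup>2 \<le> (d j)\<^sup>2"
      by (intro power_mono d norm_ge_zero)+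
    moreover have "(e i)\<^sup>2 \<le> (norm ((k i + k j) /\<^sub>R 2))\<^sup>2"
      by (intro power_mono mid that assms)
    ultimately show ?thesis by linarith
  qed
  show ?thesis
  proof (rule CauchyI')
    fix r :: real assume r: "r > 0"
    have D2: "(\<lambda>i. (d i)\<^sup>2) \<longlonglongrightarrow> D\<^sup>2" "(\<lambda>i. (e i)\<^sup>2) \<longlonglongrightarrow> D\<^sup>2"
      by (intro tendsto_intros d e)+
    have "eventually (\<lambda>i. \<bar>(d i)\<^sup>2 - D\<^sup>2\<bar> < r\<^sup>2 / 16 \<and> \<bar>(e i)\<^sup>2 - D\<^sup>2\<bar> < r\<^sup>2 / 16) sequentially"
      using tendstoD[OF D2(1), of "r\<^sup>2/16"] tendstoD[OF D2(2), of "r\<^sup>2/16"] r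
      by (auto simp: dist_real_def eventually_conj_iff)
    then obtain N where N: "\<And>i. i \<ge> N \<Longrightarrow> \<bar>(d i)\<^sup>2 - D\<^sup>2\<bar> < r\<^sup>2 / 16 \<and> \<bar>(e i)\<^sup>2 - D\<^sup>2\<bar> < r\<^sup>2 / 16"
      by (auto simp: eventually_sequentially)
    show "\<exists>M. \<forall>m\<ge>M. \<forall>n>m. dist (k m) (k n) < r"
    proof (intro exI allI impI)
      fix m n assume mn: "N \<le> m" "m < n"
      have "(norm (k m - k n))\<^sup>2 < r\<^sup>2"
        using par[of m n] N[of m] N[of n] mn by (auto simp: abs_if split: if_splits)
      then show "dist (k m) (k n) < r"
        unfolding dist_norm by (rule power2_less_imp_less) (use r in simp)
    qed
  qed
qed

lemma convex_midpoint: "convex C \<Longrightarrow> x \<in> C \<Longrightarrow> y \<in> C \<Longrightarrow> (x + y) /\<^sub>R 2 \<in> C"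
  using convexD[of C x y "1/2" "1/2"] by (simp add: scaleR_add_right)

lemma closest_to_zero_exists:
  fixes C :: "'a::{real_inner, complete_space} set"
  assumes C: "convex C" "closed C" "C \<noteq> {}"
  obtains x where "x \<in> C" "\<And>y. y \<in> C \<Longrightarrow> norm x \<le> norm y"
proof -
  define D where "D = Inf (norm ` C)"
  have bdd: "bdd_below (norm ` C)" by (rule bdd_belowI[of _ 0]) auto
  have D: "D \<le> norm y" if "y \<in> C" for y
    unfolding D_def by (intro cInf_lower bdd imageI that)
  have D0: "D \<ge> 0" unfolding D_def by (intro cInf_greatest) (use C in auto)
  have "\<exists>x\<in>C. norm x < D + inverse (real (Suc n))" for n
  proof -
    have "Inf (norm ` C) < D + inverse (real (Suc n))" unfolding D_def by simp
    then show ?thesis using C by (subst (asm) cInf_less_iff) (auto intro: bdd)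
  qed
  then obtain k where k: "\<And>n. k n \<in> C" "\<And>n. norm (k n) < D + inverse (real (Suc n))" by metis
  have lim: "(\<lambda>n. D + inverse (real (Suc n))) \<longlonglongrightarrow> D"
    using tendsto_add[OF tendsto_const LIMSEQ_inverse_real_of_nat] by simp
  have "Cauchy k"
    by (rule min_norm_sequence_Cauchy[OF less_imp_le[OF k(2)] lim D[OF convex_midpoint] tendsto_const])
      (intro k C D0)+
  then obtain x where x: "k \<longlonglongrightarrow> x" using Cauchy_convergent convergentD by blast
  have "norm x \<le> D"
    by (rule LIMSEQ_le[OF tendsto_norm[OF x] lim]) (intro exI allI impI less_imp_le k)
  moreover have "x \<in> C" using x k C by (auto simp: closed_sequential_limits)
  ultimately show ?thesis using that D by fastforce
qed

text \<open>A substitute for weak compactness: the elements of least norm of the sets converge.\<close>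

lemma nested_convex_inter_nonempty:
  fixes C :: "nat \<Rightarrow> 'a::{real_inner, complete_space} set"
  assumes C: "\<And>i. convex (C i)" "\<And>i. closed (C i)" and dec: "\<And>i j. i \<le> j \<Longrightarrow> C j \<subseteq> C i"
    and ne: "\<And>i. \<exists>x\<in>C i. norm x \<le> B"
  obtains x where "\<And>i. x \<in> C i"
proof -
  have "\<exists>x\<in>C i. \<forall>y\<in>C i. norm x \<le> norm y" for i
    using closest_to_zero_exists[OF C, of i] ne[of i] by (metis empty_iff)
  then obtain k where k: "\<And>i. k i \<in> C i" "\<And>i y. y \<in> C i \<Longrightarrow> norm (k i) \<le> norm y" by metis
  have mono: "norm (k i) \<le> norm (k j)" if "i \<le> j" for i j
    using k(1)[of j] dec[OF that] by (intro k) auto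
  have B: "norm (k i) \<le> B" for i using ne[of i] k(2)[of _ i] by fastforce
  have "incseq (\<lambda>i. norm (k i))" using mono by (auto simp: incseq_def)
  then obtain D where D: "(\<lambda>i. norm (k i)) \<longlonglongrightarrow> D"
    using incseq_convergent B by blast
  have "Cauchy k"
  proof (rule min_norm_sequence_Cauchy[OF _ D _ D])
    show "D \<ge> 0" by (rule LIMSEQ_le_const[OF D]) auto
    show "norm (k i) \<le> norm ((k i + k j) /\<^sub>R 2)" if "i \<le> j" for i j
      using dec[OF that] k(1) by (intro k convex_midpoint C) auto
  qed auto
  then obtain x where x: "k \<longlonglongrightarrow> x" using Cauchy_convergent convergentD by blast
  have "x \<in> C i" for i
  proof (rule Lim_in_closed_set[OF C(2) _ _ x])
    show "\<forall>\<^sub>F n in sequentially. k n \<in> C i"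
      using k(1) dec by (intro eventually_sequentiallyI[of i]) auto
  qed simp
  then show ?thesis by (rule that)
qed

text \<open>The point nearest to zero in the translate of \<open>V\<close> by \<open>x\<close>;
  minimality along the line in each direction \<open>v\<close> forces orthogonality. The minimiser
  has the form \<open>x + y\<close>, hence the projection is \<open>- y\<close>.\<close>

lemma orthogonal_projection_exists:
  fixes V :: "'a::{real_inner, complete_space} set"
  assumes V: "subspace V" "closed V"
  obtains y where "y \<in> V" "\<And>v. v \<in> V \<Longrightarrow> inner (x - y) v = 0"
proof -
  have cc: "convex ((+) x ` V)" "closed ((+) x ` V)" "(+) x ` V \<noteq> {}"
    using V by (auto simp: convex_translation subspace_imp_convex closed_translation dest: subspace_0)
  then obtain z where z: "z \<in> (+) x ` V" "\<And>w. w \<in> (+) x ` V \<Longrightarrow> norm z \<le> norm w"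
    using closest_to_zero_exists by blast
  then obtain y where y: "y \<in> V" "z = x + y" by auto
  have "inner z v = 0" if v: "v \<in> V" for v
  proof (rule ccontr)
    assume n: "inner z v \<noteq> 0"
    then have v0: "inner v v > 0" by (auto simp: inner_gt_zero_iff)
    \<comment> \<open>The minimiser of the quadratic polynomial that gives the squared length of
      \<open>z + t *\<^sub>R v\<close>.\<close>
    define t where "t = - inner z v / inner v v"
    have "z + t *\<^sub>R v = x + (y + t *\<^sub>R v)" by (simp add: y)
    then have "z + t *\<^sub>R v \<in> (+) x ` V"
      by (simp only:) (intro imageI subspace_add subspace_scale V y v)
    then have "norm z \<le> norm (z + t *\<^sub>R v)" by (rule z)
    then have "inner z z \<le> inner (z + t *\<^sub>R v) (z + t *\<^sub>R v)" by (simp add: norm_le)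
    also have "\<dots> = inner z z + 2 * t * inner z v + t * t * inner v v"
      by (simp add: inner_simps inner_commute algebra_simps)
    also have "\<dots> = inner z z - (inner z v)\<^sup>2 / inner v v"
      using v0 by (simp add: t_def field_simps power2_eq_square)
    finally have "(inner z v)\<^sup>2 / inner v v \<le> 0" by simp
    moreover have "(inner z v)\<^sup>2 / inner v v > 0" using n v0 by simp
    ultimately show False by simp
  qed
  with y V show ?thesis by (intro that[of "- y"]) (auto simp: subspace_neg)
qed

subsection \<open>Smooth functions\<close>

lemma Ck_continuous: "Ck k f \<Longrightarrow> continuous_on UNIV f"
proof (cases k)
  case (Suc n)
  assume "Ck k f"
  then have "\<forall>x. f differentiable (at x)" using Suc by (auto simp: differentiable_def)
  then show ?thesis
    by (simp add: continuous_at_imp_continuous_on differentiable_imp_continuous_within)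
qed simp

lemma Ck_SucD: "Ck (Suc k) f \<Longrightarrow> Ck k f"
proof (induction k arbitrary: f)
  case 0
  then show ?case using Ck_continuous by (metis Ck.simps(1))
next
  case (Suc k)
  from Suc.prems obtain f1 f2 where "Ck (Suc k) f1" "Ck (Suc k) f2"
    "\<forall>x. (f has_derivative (\<lambda>h. fst h *\<^sub>R f1 x + snd h *\<^sub>R f2 x)) (at x)"
    unfolding Ck.simps(2)[of "Suc k"] by blast
  with Suc.IH show ?case unfolding Ck.simps(2)[of k] by blast
qed

lemma Ck_add: "Ck k f \<Longrightarrow> Ck k g \<Longrightarrow> Ck k (\<lambda>x. f x + g x)"
proof (induction k arbitrary: f g)
  case 0
  then show ?case by (simp add: continuous_on_add)
next
  case (Suc k)
  obtain f1 f2 where f: "Ck k f1" "Ck k f2"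
    "\<And>x. (f has_derivative (\<lambda>h. fst h *\<^sub>R f1 x + snd h *\<^sub>R f2 x)) (at x)"
    using Suc.prems(1) by auto
  obtain g1 g2 where g: "Ck k g1" "Ck k g2"
    "\<And>x. (g has_derivative (\<lambda>h. fst h *\<^sub>R g1 x + snd h *\<^sub>R g2 x)) (at x)"
    using Suc.prems(2) by auto
  have "((\<lambda>x. f x + g x) has_derivative (\<lambda>h. fst h *\<^sub>R (f1 x + g1 x) + snd h *\<^sub>R (f2 x + g2 x))) (at x)" for x
    by (rule has_derivative_eq_rhs[OF has_derivative_add[OF f(3) g(3)]]) (simp add: scaleR_add_right fun_eq_iff add_ac)
  with Suc.IH[OF f(1) g(1)] Suc.IH[OF f(2) g(2)] show ?case by auto
qed

lemma Ck_linear: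
  assumes L: "bounded_linear L"
  shows "Ck k f \<Longrightarrow> Ck k (\<lambda>x. L (f x))"
proof (induction k arbitrary: f)
  case 0
  then show ?case using bounded_linear.continuous_on[OF L] by simp
next
  case (Suc k)
  obtain f1 f2 where f: "Ck k f1" "Ck k f2"
    "\<And>x. (f has_derivative (\<lambda>h. fst h *\<^sub>R f1 x + snd h *\<^sub>R f2 x)) (at x)"
    using Suc.prems by auto
  interpret L: bounded_linear L by (rule L)
  have "((\<lambda>x. L (f x)) has_derivative (\<lambda>h. fst h *\<^sub>R L (f1 x) + snd h *\<^sub>R L (f2 x))) (at x)" for x
    by (rule has_derivative_eq_rhs[OF L.has_derivative[OF f(3)]]) (simp add: L.add L.scaleR)
  with Suc.IH[OF f(1)] Suc.IH[OF f(2)] show ?case by auto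
qed

lemma Ck_bilinear:
  assumes B: "bounded_bilinear B"
  shows "Ck k f \<Longrightarrow> Ck k g \<Longrightarrow> Ck k (\<lambda>x. B (f x) (g x))"
proof (induction k arbitrary: f g)
  case 0
  then show ?case using bounded_bilinear.continuous_on[OF B] by simp
next
  case (Suc k)
  obtain f1 f2 where f: "Ck k f1" "Ck k f2"
    "\<And>x. (f has_derivative (\<lambda>h. fst h *\<^sub>R f1 x + snd h *\<^sub>R f2 x)) (at x)"
    using Suc.prems(1) by auto
  obtain g1 g2 where g: "Ck k g1" "Ck k g2"
    "\<And>x. (g has_derivative (\<lambda>h. fst h *\<^sub>R g1 x + snd h *\<^sub>R g2 x)) (at x)"
    using Suc.prems(2) by auto
  interpret B: bounded_bilinear B by (rule B)
  have "((\<lambda>x. B (f x) (g x)) has_derivative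
      (\<lambda>h. fst h *\<^sub>R (B (f x) (g1 x) + B (f1 x) (g x)) + snd h *\<^sub>R (B (f x) (g2 x) + B (f2 x) (g x)))) (at x)" for x
    by (rule has_derivative_eq_rhs[OF B.FDERIV[OF f(3) g(3)]])
      (simp add: scaleR_add_right B.add_left B.add_right B.scaleR_left B.scaleR_right add_ac)
  moreover have "Ck k (\<lambda>x. B (f x) (g1 x) + B (f1 x) (g x))" "Ck k (\<lambda>x. B (f x) (g2 x) + B (f2 x) (g x))"
    by (intro Ck_add Suc.IH f g Ck_SucD[OF Suc.prems(1)] Ck_SucD[OF Suc.prems(2)])+
  ultimately show ?case by auto
qed

lemma Ck_inverse:
  fixes g :: "real \<times> real \<Rightarrow> real"
  assumes nz: "\<And>x. g x \<noteq> 0"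
  shows "Ck k g \<Longrightarrow> Ck k (\<lambda>x. inverse (g x))"
proof (induction k)
  case 0
  then show ?case using nz by (auto intro!: continuous_intros)
next
  case (Suc k)
  obtain g1 g2 where g: "Ck k g1" "Ck k g2"
    "\<And>x. (g has_derivative (\<lambda>h. fst h *\<^sub>R g1 x + snd h *\<^sub>R g2 x)) (at x)"
    using Suc.prems by auto
  have i: "Ck k (\<lambda>x. inverse (g x))" by (intro Suc.IH Ck_SucD[OF Suc.prems])
  have "((\<lambda>x. inverse (g x)) has_derivative
      (\<lambda>h. fst h *\<^sub>R (- (inverse (g x) * (g1 x * inverse (g x))))
         + snd h *\<^sub>R (- (inverse (g x) * (g2 x * inverse (g x)))))) (at x)" for x
    by (rule has_derivative_eq_rhs[OF Deriv.has_derivative_inverse[OF nz g(3)]]) (simp add: algebra_simps)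
  moreover have "Ck k (\<lambda>x. - (inverse (g x) * (g1 x * inverse (g x))))"
    "Ck k (\<lambda>x. - (inverse (g x) * (g2 x * inverse (g x))))"
    by (intro Ck_linear[OF bounded_linear_minus[OF bounded_linear_ident]] Ck_bilinear[OF bounded_bilinear_mult] i g)+
  ultimately show ?case unfolding Ck.simps by blast
qed

lemma Ck_translate: "Ck k f \<Longrightarrow> Ck k (\<lambda>x. f (x + v))"
proof (induction k arbitrary: f)
  case 0
  then show ?case by (auto intro!: continuous_intros continuous_on_compose2[of UNIV f])
next
  case (Suc k)
  obtain f1 f2 where f: "Ck k f1" "Ck k f2"
    "\<And>x. (f has_derivative (\<lambda>h. fst h *\<^sub>R f1 x + snd h *\<^sub>R f2 x)) (at x)"
    using Suc.prems by auto
  have "((\<lambda>x. f (x + v)) has_derivative (\<lambda>h. fst h *\<^sub>R f1 (x + v) + snd h *\<^sub>R f2 (x + v))) (at x)" for x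
    by (rule has_derivative_compose[OF _ f(3), of "\<lambda>x. x + v" "\<lambda>h. h"]) (auto intro!: derivative_eq_intros)
  with Suc.IH[OF f(1)] Suc.IH[OF f(2)] show ?case by auto
qed

text \<open>Induction on \<open>k\<close> works for all members of \<open>S\<close> at once, so a
  family closed under both partial derivatives consists of smooth functions, and no iterated
  derivative has to be written down.\<close>

lemma C_infinity_coinduct:
  assumes "f \<in> S"
    and "\<And>f. f \<in> S \<Longrightarrow> \<exists>f1\<in>S. \<exists>f2\<in>S. \<forall>x. (f has_derivative (\<lambda>h. fst h *\<^sub>R f1 x + snd h *\<^sub>R f2 x)) (at x)"
  shows "C_infinity f"
proof -
  have "Ck k f" if "f \<in> S" for k f
    using that
  proof (induction k arbitrary: f)
    case 0
    then have "\<forall>x. f differentiable (at x)" using assms(2)[OF 0] by (auto simp: differentiable_def)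
    then show ?case
      by (simp add: continuous_at_imp_continuous_on differentiable_imp_continuous_within)
  next
    case (Suc k)
    then show ?case using assms(2)[OF Suc.prems] by auto
  qed
  then show ?thesis using assms(1) by (simp add: C_infinity_def)
qed

lemma partial_eq: "(f has_derivative D) (at x) \<Longrightarrow> partial b f x = D b"
  unfolding partial_def by (metis frechet_derivative_at)

text \<open>Each order \<open>k\<close> supplies its own witnesses for the derivatives; uniqueness
  of the derivative identifies them all with \<open>partial\<close>, which is thereby smooth of
  every order.\<close>

lemma
  assumes "C_infinity f"
  shows C_infinity_has_derivative:
      "(f has_derivative (\<lambda>h. fst h *\<^sub>R partial (1, 0) f x + snd h *\<^sub>R partial (0, 1) f x)) (at x)"
    and C_infinity_partial: "C_infinity (partial (1, 0) f)" "C_infinity (partial (0, 1) f)"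
proof -
  have ex: "\<exists>f1 f2. Ck k f1 \<and> Ck k f2 \<and>
     (\<forall>x. (f has_derivative (\<lambda>h. fst h *\<^sub>R f1 x + snd h *\<^sub>R f2 x)) (at x))" for k
    using assms unfolding C_infinity_def by (metis Ck.simps(2))
  have eq: "f1 = partial (1, 0) f \<and> f2 = partial (0, 1) f"
    if d: "\<forall>x. (f has_derivative (\<lambda>h. fst h *\<^sub>R f1 x + snd h *\<^sub>R f2 x)) (at x)" for f1 f2
  proof -
    have "f1 x = partial (1, 0) f x \<and> f2 x = partial (0, 1) f x" for x
      using partial_eq[OF d[THEN spec, of x], of "(1, 0)"] partial_eq[OF d[THEN spec, of x], of "(0, 1)"]
      by simp
    then show ?thesis by blast
  qed
  show "(f has_derivative (\<lambda>h. fst h *\<^sub>R partial (1, 0) f x + snd h *\<^sub>R partial (0, 1) f x)) (at x)"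
    using ex[of 0] eq by blast
  show "C_infinity (partial (1, 0) f)" "C_infinity (partial (0, 1) f)"
    unfolding C_infinity_def using ex eq by blast+
qed

lemma C_infinity_continuous: "C_infinity f \<Longrightarrow> continuous_on S f"
  using Ck_continuous continuous_on_subset unfolding C_infinity_def by blast

lemma C_infinity_add: "C_infinity f \<Longrightarrow> C_infinity g \<Longrightarrow> C_infinity (\<lambda>x. f x + g x)"
  by (simp add: C_infinity_def Ck_add)

lemma C_infinity_linear: "bounded_linear L \<Longrightarrow> C_infinity f \<Longrightarrow> C_infinity (\<lambda>x. L (f x))"
  by (simp add: C_infinity_def Ck_linear)

lemma C_infinity_bilinear:
  "bounded_bilinear B \<Longrightarrow> C_infinity f \<Longrightarrow> C_infinity g \<Longrightarrow> C_infinity (\<lambda>x. B (f x) (g x))"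
  by (simp add: C_infinity_def Ck_bilinear)

lemmas C_infinity_mult = C_infinity_bilinear[OF bounded_bilinear_mult]
lemmas C_infinity_scaleR = C_infinity_linear[OF bounded_linear_scaleR_right]
lemmas C_infinity_minus = C_infinity_linear[OF bounded_linear_minus[OF bounded_linear_ident]]
lemmas C_infinity_cnj = C_infinity_linear[OF bounded_linear_cnj]
lemmas C_infinity_of_real = C_infinity_linear[OF bounded_linear_of_real]

lemma C_infinity_diff: "C_infinity f \<Longrightarrow> C_infinity g \<Longrightarrow> C_infinity (\<lambda>x. f x - g x)"
  using C_infinity_add[OF _ C_infinity_minus, of f g] by simp

lemma C_infinity_inverse:
  fixes g :: "real \<times> real \<Rightarrow> real"
  shows "C_infinity g \<Longrightarrow> (\<And>x. g x \<noteq> 0) \<Longrightarrow> C_infinity (\<lambda>x. inverse (g x))"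
  by (simp add: C_infinity_def Ck_inverse)

lemma C_infinity_translate: "C_infinity f \<Longrightarrow> C_infinity (\<lambda>x. f (x + v))"
  by (simp add: C_infinity_def Ck_translate)

lemma C_infinity_const: "C_infinity (\<lambda>x. c)"
proof (rule C_infinity_coinduct[of _ "{\<lambda>x. c, \<lambda>x. 0}"])
  fix f assume "f \<in> {\<lambda>x::real \<times> real. c, \<lambda>x. 0}"
  then show "\<exists>f1\<in>{\<lambda>x. c, \<lambda>x. 0}. \<exists>f2\<in>{\<lambda>x. c, \<lambda>x. 0}. \<forall>x. (f has_derivative (\<lambda>h. fst h *\<^sub>R f1 x + snd h *\<^sub>R f2 x)) (at x)"
    by auto
qed simp

text \<open>The scalar multiples of the compositions with all \<open>s n\<close> form a family
  closed under partial differentiation, each derivative contributing a component of \<open>c\<close>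
  as a factor.\<close>

lemma C_infinity_affine_compose:
  fixes s :: "nat \<Rightarrow> real \<Rightarrow> 'a::real_normed_vector" and c :: "real \<times> real"
  assumes s: "\<And>n t. (s n has_vector_derivative s (Suc n) t) (at t)"
  shows "C_infinity (\<lambda>x. s 0 (inner c x + d))"
proof (rule C_infinity_coinduct[of _ "{\<lambda>x. r *\<^sub>R s n (inner c x + d) | r n. True}"])
  show "(\<lambda>x. s 0 (inner c x + d)) \<in> {\<lambda>x. r *\<^sub>R s n (inner c x + d) | r n. True}"
    by (rule CollectI, rule exI[of _ 1], rule exI[of _ 0]) simp
next
  fix f assume "f \<in> {\<lambda>x. r *\<^sub>R s n (inner c x + d) | r n. True}"
  then obtain r n where f: "f = (\<lambda>x. r *\<^sub>R s n (inner c x + d))" by auto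
  have "(f has_derivative (\<lambda>h. fst h *\<^sub>R (r * fst c) *\<^sub>R s (Suc n) (inner c x + d)
     + snd h *\<^sub>R (r * snd c) *\<^sub>R s (Suc n) (inner c x + d))) (at x)" for x
  proof -
    have 1: "((\<lambda>x. inner c x + d) has_derivative (\<lambda>h. inner c h)) (at x)"
      by (auto intro!: derivative_eq_intros)
    have 2: "(s n has_derivative (\<lambda>h. h *\<^sub>R s (Suc n) (inner c x + d))) (at (inner c x + d))"
      using s[of n "inner c x + d"] by (simp add: has_vector_derivative_def)
    show ?thesis unfolding f
      by (rule has_derivative_eq_rhs[OF has_derivative_scaleR_right[OF has_derivative_compose[OF 1 2]]])
        (simp add: inner_prod_def scaleR_add_right scaleR_add_left fun_eq_iff algebra_simps)
  qed
  then show "\<exists>f1\<in>{\<lambda>x. r *\<^sub>R s n (inner c x + d) | r n. True}. \<exists>f2\<in>{\<lambda>x. r *\<^sub>R s n (inner c x + d) | r n. True}.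
      \<forall>x. (f has_derivative (\<lambda>h. fst h *\<^sub>R f1 x + snd h *\<^sub>R f2 x)) (at x)"
    by (intro bexI[of _ "\<lambda>x. (r * fst c) *\<^sub>R s (Suc n) (inner c x + d)"]
      bexI[of _ "\<lambda>x. (r * snd c) *\<^sub>R s (Suc n) (inner c x + d)"]) blast+
qed

lemma C_infinity_snd_add: "C_infinity (\<lambda>x::real \<times> real. snd x + d)"
proof -
  define s :: "nat \<Rightarrow> real \<Rightarrow> real" where "s n t = (if n = 0 then t else if n = 1 then 1 else 0)" for n t
  have "(s n has_vector_derivative s (Suc n) t) (at t)" for n t
    unfolding s_def has_real_derivative_iff_has_vector_derivative[symmetric]
    by (auto intro!: derivative_eq_intros)
  from C_infinity_affine_compose[of s, OF this, of "(0,1)" d] show ?thesis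
    by (simp add: s_def inner_prod_def)
qed

lemma C_infinity_exp_fst: "C_infinity (\<lambda>x::real \<times> real. exp (\<i> * of_real (b * fst x)))"
proof -
  define s :: "nat \<Rightarrow> real \<Rightarrow> complex" where "s n t = (\<i> * b) ^ n * exp (\<i> * of_real (b * t))" for n t
  have "(s n has_vector_derivative s (Suc n) t) (at t)" for n t
  proof -
    have "((\<lambda>z. (\<i> * b) ^ n * exp (\<i> * (b * z))) has_field_derivative s (Suc n) t) (at (of_real t))"
      unfolding s_def by (auto intro!: derivative_eq_intros simp: algebra_simps)
    from has_vector_derivative_real_field[OF this, of UNIV] show ?thesis by (simp add: s_def [abs_def])
  qed
  from C_infinity_affine_compose[of s, OF this, of "(1,0)" 0] show ?thesis
    by (simp add: s_def inner_prod_def)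
qed

lemma C_infinity_cos_snd: "C_infinity (\<lambda>x::real \<times> real. cos (m * snd x + d))"
proof -
  \<comment> \<open>The n-th derivative of the cosine is the cosine shifted by n quarter
    periods.\<close>
  define s :: "nat \<Rightarrow> real \<Rightarrow> real" where "s n t = m ^ n * cos (m * t + d + of_nat n * pi / 2)" for n t
  have sh: "cos (y + (1 + real n) * pi / 2) = - sin (y + real n * pi / 2)" for y n
  proof -
    have "y + (1 + real n) * pi / 2 = (y + real n * pi / 2) + pi / 2" by (simp add: field_simps)
    then show ?thesis by (simp only: cos_add) simp
  qed
  have "(s n has_vector_derivative s (Suc n) t) (at t)" for n t
    unfolding s_def has_real_derivative_iff_has_vector_derivative[symmetric]
    by (auto intro!: derivative_eq_intros simp: sh)
  from C_infinity_affine_compose[of s, OF this, of "(0,1)" 0] show ?thesis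
    by (simp add: s_def inner_prod_def)
qed

lemma C_infinity_sin_snd: "C_infinity (\<lambda>x::real \<times> real. sin (m * snd x + d))"
  using C_infinity_cos_snd[of m "d - pi/2"] by (simp add: cos_diff add_diff_eq)

subsection \<open>Bump functions\<close>

text \<open>All derivatives of exp (-1/t), continued by zero, have this shape with a polynomial in
  1/t; hence the polynomial as a parameter.\<close>

definition flat_exp :: "real poly \<Rightarrow> real \<Rightarrow> real" where
  "flat_exp p t = (if t > 0 then poly p (1 / t) * exp (- (1 / t)) else 0)"

lemma tendsto_poly_exp_minus: "((\<lambda>y. y ^ k * poly p y * exp (- y)) \<longlongrightarrow> (0::real)) at_top"
proof (induction p arbitrary: k)
  case (pCons a p)
  have "((\<lambda>y. a * (y ^ k / exp y) + y ^ Suc k * poly p y * exp (- y)) \<longlongrightarrow> a * 0 + 0) at_top"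
    by (intro tendsto_intros tendsto_power_div_exp_0 pCons.IH)
  then show ?case by (simp add: algebra_simps exp_minus divide_inverse)
qed simp

text \<open>Differentiating \<open>poly p (1 / t)\<close> and the exponential each produces a factor
  1/t squared, with opposite signs, which accounts for X^2 (p - p'). At zero the difference quotient
  is again a polynomial in 1/t times the exponential and tends to zero.\<close>

lemma flat_exp_deriv:
  "(flat_exp p has_real_derivative flat_exp ([:0, 0, 1:] * (p - pderiv p)) t) (at t)"
proof (cases t "0::real" rule: linorder_cases)
  case greater
  have "((\<lambda>t. poly p (1 / t) * exp (- (1 / t))) has_real_derivative
      flat_exp ([:0, 0, 1:] * (p - pderiv p)) t) (at t)"
    using greater
    by (auto intro!: derivative_eq_intros DERIV_chain2[OF poly_DERIV]
        simp: flat_exp_def field_simps power2_eq_square)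
  then show ?thesis
    by (rule has_field_derivative_transform_within_open[of _ _ _ "{0<..}"])
      (use greater in \<open>auto simp: flat_exp_def\<close>)
next
  case less
  have "((\<lambda>t. 0) has_real_derivative flat_exp ([:0, 0, 1:] * (p - pderiv p)) t) (at t)"
    using less by (simp add: flat_exp_def)
  then show ?thesis
    by (rule has_field_derivative_transform_within_open[of _ _ _ "{..<0}"])
      (use less in \<open>auto simp: flat_exp_def\<close>)
next
  case equal
  have r: "((\<lambda>h. flat_exp p h / h) \<longlongrightarrow> 0) (at_right 0)"
  proof -
    have "((\<lambda>h. inverse h ^ 1 * poly p (inverse h) * exp (- inverse h)) \<longlongrightarrow> 0) (at_right (0::real))"
      by (rule filterlim_compose[OF tendsto_poly_exp_minus filterlim_inverse_at_top_right])
    then show ?thesis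
      by (rule Lim_transform_eventually)
        (auto simp: eventually_at_right_less flat_exp_def divide_inverse intro!: eventually_mono[OF eventually_at_right_less])
  qed
  have l: "((\<lambda>h. flat_exp p h / h) \<longlongrightarrow> 0) (at_left 0)"
    by (rule Lim_transform_eventually[OF tendsto_const])
      (auto simp: flat_exp_def eventually_at_filter)
  have "((\<lambda>h. flat_exp p h / h) \<longlongrightarrow> 0) (at 0)"
    using l r by (simp add: filterlim_split_at)
  then show ?thesis using equal by (simp add: has_field_derivative_iff flat_exp_def)
qed

definition smooth_step :: "real \<Rightarrow> real" where
  "smooth_step t = (if t > 0 then exp (- (1 / t)) else 0)"

lemma C_infinity_smooth_step: "C_infinity (\<lambda>x. smooth_step (inner c x + d))"
proof -
  define s where "s n = flat_exp (((\<lambda>p. [:0, 0, 1:] * (p - pderiv p)) ^^ n) 1)" for n :: nat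
  have "(s n has_vector_derivative s (Suc n) t) (at t)" for n t
    unfolding s_def has_real_derivative_iff_has_vector_derivative[symmetric]
    using flat_exp_deriv by simp
  from C_infinity_affine_compose[of s, OF this, of c d] show ?thesis
    by (simp add: s_def flat_exp_def smooth_step_def cong: if_cong)
qed

lemma smooth_step_bounds: "0 \<le> smooth_step t" "smooth_step t \<le> 1"
  by (auto simp: smooth_step_def)

lemma smooth_step_tendsto_1:
  assumes "r > 0"
  shows "(\<lambda>k. smooth_step (real k * r - 1)) \<longlonglongrightarrow> 1"
proof -
  have "filterlim (\<lambda>k. real k * r - 1) at_top sequentially"
    using assms filterlim_tendsto_add_at_top[OF tendsto_const[of "-1"]
      filterlim_at_top_mult_tendsto_pos[OF tendsto_const assms filterlim_real_sequentially]]
    by (simp add: mult.commute)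
  then have f: "filterlim (\<lambda>k. inverse (real k * r - 1)) (nhds 0) sequentially"
    by (rule tendsto_inverse_0_at_top)
  have "(\<lambda>k. exp (- inverse (real k * r - 1))) \<longlonglongrightarrow> exp (- 0)"
    by (intro tendsto_intros f)
  moreover have "\<forall>\<^sub>F k in sequentially. exp (- inverse (real k * r - 1)) = smooth_step (real k * r - 1)"
    using \<open>filterlim (\<lambda>k. real k * r - 1) at_top sequentially\<close>
    by (auto simp: filterlim_at_top_dense smooth_step_def divide_inverse elim!: eventually_mono allE[of _ 0])
  ultimately show ?thesis by (auto intro: Lim_transform_eventually)
qed

subsection \<open>Functions with vanishing integrals\<close>

lemma sigma_finite_lebesgue: "sigma_finite_measure (lebesgue :: 'a::euclidean_space measure)"
proof -
  obtain A :: "'a set set" where A: "countable A" "A \<subseteq> sets lborel" "\<Union> A = space lborel"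
      "\<forall>a\<in>A. emeasure lborel a \<noteq> \<infinity>"
    using sigma_finite_lborel unfolding sigma_finite_measure_def by auto
  then show ?thesis
    unfolding sigma_finite_measure_def by (intro exI[of _ A]) (auto simp: subset_iff)
qed

text \<open>The sets over which the extension of \<open>g\<close> by zero has integral zero are
  closed under complements and countable disjoint unions. Boxes are stable under intersection and
  generate the Borel sets, so the assumption on boxes extends to all Borel sets.\<close>

lemma AE_zero_on_box:
  fixes g :: "'a::euclidean_space \<Rightarrow> complex"
  assumes int: "integrable (lebesgue_on (box a b)) g"
    and z: "\<And>c d. box c d \<subseteq> box a b \<Longrightarrow> (LINT x:box c d|lebesgue. g x) = 0"
  shows "AE x in lebesgue_on (box a b). g x = 0"
proof -
  define f where "f x = indicat_real (box a b) x *\<^sub>R g x" for x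
  have f: "integrable lebesgue f"
    using int unfolding f_def by (subst (asm) integrable_restrict_space) (auto simp: set_integrable_def)
  have si: "set_integrable lebesgue A f" if "A \<in> sets lebesgue" for A
    using integrable_mult_indicator[OF that f] by (simp add: set_integrable_def)
  have bx: "(LINT x:box c d|lebesgue. f x) = 0" for c d
  proof -
    have "(LINT x:box c d|lebesgue. f x) = (LINT x:box c d \<inter> box a b|lebesgue. g x)"
      unfolding set_lebesgue_integral_def f_def
      by (intro Bochner_Integration.integral_cong) (auto simp: indicator_def)
    also have "\<dots> = 0"
      using inf_le2[of "box c d" "box a b"] unfolding box_Int_box by (rule z)
    finally show ?thesis .
  qed
  \<comment> \<open>Complements are handled by subtraction from the whole space, over which the
    extension by zero has the same integral as over the box.\<close>
  have tot: "(LINT x:UNIV|lebesgue. f x) = 0"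
  proof -
    have "(LINT x:UNIV|lebesgue. f x) = (LINT x:box a b|lebesgue. f x)"
      unfolding set_lebesgue_integral_def f_def
      by (intro Bochner_Integration.integral_cong) (auto simp: indicator_def)
    then show ?thesis using bx by simp
  qed
  have bor: "(LINT x:A|lebesgue. f x) = 0" if "A \<in> sets borel" for A
  proof -
    have "Int_stable (range (\<lambda>(a, b). box a b :: 'a set))"
      by (auto simp: Int_stable_def box_Int_box)
    moreover have "range (\<lambda>(a, b). box a b) \<subseteq> Pow (UNIV :: 'a set)"
      by auto
    moreover have "A \<in> sigma_sets UNIV (range (\<lambda>(a, b). box a b))"
      using that unfolding borel_eq_box by simp
    ultimately show ?thesis
    proof (induction rule: sigma_sets_induct_disjoint)
      case (basic A)
      then show ?case using bx by auto
    next
      case empty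
      then show ?case by (simp add: set_lebesgue_integral_def)
    next
      case (compl A)
      then have A: "A \<in> sets borel" by (simp add: borel_eq_box)
      have "(LINT x:UNIV - A|lebesgue. f x) + (LINT x:A|lebesgue. f x) = (LINT x:(UNIV - A) \<union> A|lebesgue. f x)"
        using A by (intro set_integral_Un[symmetric] si) auto
      then show ?case using compl tot by simp
    next
      case (union A)
      have "range A \<subseteq> sets (borel :: 'a measure)"
        using union(2) unfolding borel_eq_box by simp
      then have A: "A i \<in> sets lebesgue" for i
        using sets_completionI_sets[of "A i" lborel] by (metis range_subsetD sets_lborel)
      have d: "A i \<inter> A j = {}" if "i \<noteq> j" for i j
        using union(1) that by (simp add: disjoint_family_on_def)
      have un: "set_integrable lebesgue (\<Union>i. A i) f"
        by (intro si sets.countable_UN) (use A in auto)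
      have "(LINT x:(\<Union>i. A i)|lebesgue. f x) = (\<Sum>i. (LINT x:A i|lebesgue. f x))"
        by (rule lebesgue_integral_countable_add[OF A d un])
      then show ?case using union by simp
    qed
  qed
  interpret sigma_finite_measure "lebesgue :: 'a measure" by (rule sigma_finite_lebesgue)
  have "AE x in lebesgue. f x = 0"
  proof (rule density_zero[OF f])
    fix A :: "'a set" assume "A \<in> sets lebesgue"
    \<comment> \<open>A Lebesgue measurable set agrees with a Borel set up to a null set.\<close>
    then obtain S N N' where S: "A = S \<union> N" "N \<subseteq> N'" "N' \<in> null_sets lborel" "S \<in> sets lborel"
      by (rule sets_completionE)
    have "AE x in lebesgue. x \<notin> N'"
      using S(3) by (intro AE_not_in null_sets_completionI)
    then have "AE x in lebesgue. x \<in> S \<longleftrightarrow> x \<in> A"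
      by eventually_elim (use S(1,2) in blast)
    moreover have "S \<in> sets lebesgue" using S(4) by simp
    ultimately have "(LINT x:A|lebesgue. f x) = (LINT x:S|lebesgue. f x)"
      using si[OF \<open>A \<in> sets lebesgue\<close>] si[of S]
      by (intro set_integral_cong_set) (auto simp: set_integrable_def set_borel_measurable_def)
    then show "(LINT x:A|lebesgue. f x) = 0" using bor S by simp
  qed
  then have "AE x in lebesgue. x \<in> box a b \<longrightarrow> g x = 0"
    by eventually_elim (auto simp add: f_def)
  then show ?thesis by (subst AE_restrict_space_iff) auto
qed

lemma restr_bmeas_continuous:
  assumes "bounded S" "S \<in> sets lebesgue" "continuous_on UNIV c"
  shows "bmeas (restr S c)"
proof -
  have "compact (closure S)" using assms by simp
  then have "bounded (c ` closure S)"
    by (intro compact_imp_bounded compact_continuous_image continuous_on_subset[OF assms(3)]) auto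
  then obtain B where "\<And>x. x \<in> closure S \<Longrightarrow> norm (c x) \<le> B" by (auto simp: bounded_iff)
  then have B: "norm (c x) \<le> B" if "x \<in> S" for x
    using that closure_subset by blast
  have m: "c \<in> borel_measurable lebesgue"
    using borel_measurable_continuous_onI[OF assms(3)] by (intro measurable_completion) simp
  have "norm (restr S c x) \<le> max B 0" for x
    by (cases "x \<in> S") (auto simp: restr_def intro: B max.coboundedI1)
  then show ?thesis
    using assms m unfolding bmeas_def restr_def [abs_def]
    by (intro conjI borel_measurable_scaleR borel_measurable_indicator) auto
qed

lemma continuous_L2:
  assumes "bounded S" "S \<in> sets lebesgue" "continuous_on UNIV f"
  shows "f \<in> L2 S"
proof -
  have "S \<in> lmeasurable" using assms bounded_set_imp_lmeasurable by blast
  then have "(\<lambda>x. 1::complex) \<in> L2 S"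
    by (simp add: L2_def finite_measure.integrable_const finite_measure_lebesgue_on)
  from L2_mult(1)[OF assms(2) restr_bmeas_continuous[OF assms] this] show ?thesis by simp
qed

lemma C_infinity_has_partial: "C_infinity f \<Longrightarrow> (f has_derivative (\<lambda>h. partial h f x)) (at x)"
  unfolding partial_def using differentiableI [OF C_infinity_has_derivative]
  by (simp add: frechet_derivative_works)

lemma C_infinity_partial': "C_infinity f \<Longrightarrow> b = (1, 0) \<or> b = (0, 1) \<Longrightarrow> C_infinity (partial b f)"
  using C_infinity_partial by blast

lemma partial_mult_cnj:
  assumes "C_infinity f" "C_infinity g"
  shows "partial b (\<lambda>x. f x * cnj (g x)) x = partial b f x * cnj (g x) + f x * cnj (partial b g x)"
  by (subst partial_eq[OF has_derivative_mult[OF C_infinity_has_partial[OF assms(1)]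
      has_derivative_cnj[OF C_infinity_has_partial[OF assms(2)]]]]) simp

lemma partial_mult:
  fixes f g :: "real \<times> real \<Rightarrow> 'a::real_normed_algebra"
  assumes "C_infinity f" "C_infinity g"
  shows "partial b (\<lambda>x. f x * g x) x = partial b f x * g x + f x * partial b g x"
  by (subst partial_eq[OF has_derivative_mult[OF C_infinity_has_partial[OF assms(1)]
      C_infinity_has_partial[OF assms(2)]]]) simp

lemma partial_linear:
  assumes "bounded_linear L" "C_infinity f"
  shows "partial b (\<lambda>x. L (f x)) x = L (partial b f x)"
  by (rule partial_eq[OF bounded_linear.has_derivative[OF assms(1) C_infinity_has_partial[OF assms(2)]]])

lemma partial_add:
  assumes "C_infinity f" "C_infinity g"
  shows "partial b (\<lambda>x. f x + g x) x = partial b f x + partial b g x"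
  by (rule partial_eq[OF has_derivative_add[OF C_infinity_has_partial[OF assms(1)] C_infinity_has_partial[OF assms(2)]]])

lemma partial_diff:
  assumes "C_infinity f" "C_infinity g"
  shows "partial b (\<lambda>x. f x - g x) x = partial b f x - partial b g x"
  by (rule partial_eq[OF has_derivative_diff[OF C_infinity_has_partial[OF assms(1)] C_infinity_has_partial[OF assms(2)]]])

lemma partial_translate:
  assumes "C_infinity f"
  shows "partial b (\<lambda>x. f (x + v)) x = partial b f (x + v)"
  by (rule partial_eq[OF has_derivative_compose[OF _ C_infinity_has_partial[OF assms], of "\<lambda>x. x + v" "\<lambda>h. h"]])
    (auto intro!: derivative_eq_intros)

lemma integral_lebesgue_on_box:
  fixes f :: "'a::euclidean_space \<Rightarrow> complex"
  assumes "continuous_on UNIV f"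
  shows "integrable (lebesgue_on (box a b)) f" "(\<integral>x. f x \<partial>lebesgue_on (box a b)) = integral (cbox a b) f"
proof -
  have f: "f \<in> L2 (box a b)" "(\<lambda>x. 1) \<in> L2 (box a b)"
    using assms by (auto intro!: continuous_L2)
  have "integrable (lebesgue_on (box a b)) (\<lambda>x. f x * cnj 1)"
    by (rule integrable_mult_cnj[OF _ f]) auto
  then show i: "integrable (lebesgue_on (box a b)) f" by simp
  then show "(\<integral>x. f x \<partial>lebesgue_on (box a b)) = integral (cbox a b) f"
    by (simp add: lebesgue_integral_eq_integral integral_open_interval)
qed

section \<open>Integration by parts on the cell\<close>

locale cell =
  fixes Lx H :: real
  assumes Lx: "Lx > 0" and H: "H > 0"
begin

abbreviation \<Omega> where "\<Omega> \<equiv> Omega Lx H"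
abbreviation \<Gamma> where "\<Gamma> \<equiv> {0<..<Lx}"

lemma Omega_box: "\<Omega> = box (0, -H) (Lx, H)"
  unfolding Omega_def by (auto simp: box_def Basis_prod_def)

lemma Omega_sets [simp]: "\<Omega> \<in> sets lebesgue" "bounded \<Omega>" "open \<Omega>"
  unfolding Omega_box by (auto simp: bounded_box)

lemma Gamma_sets [simp]: "\<Gamma> \<in> sets lebesgue" "bounded \<Gamma>"
  by auto

lemma continuous_L2_Omega [simp]: "continuous_on UNIV f \<Longrightarrow> f \<in> L2 \<Omega>"
  and continuous_L2_Gamma [simp]: "continuous_on UNIV f' \<Longrightarrow> f' \<in> L2 \<Gamma>"
  by (auto intro!: continuous_L2)

lemma integral_Omega_iterated:
  fixes f :: "real \<times> real \<Rightarrow> complex"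
  assumes f: "continuous_on UNIV f"
  shows "(\<integral>x. f x \<partial>lebesgue_on \<Omega>) = integral {0..Lx} (\<lambda>t. integral {-H..H} (\<lambda>s. f (t, s)))"
    "(\<integral>x. f x \<partial>lebesgue_on \<Omega>) = integral {-H..H} (\<lambda>s. integral {0..Lx} (\<lambda>t. f (t, s)))"
proof -
  have c: "continuous_on (cbox (0, -H) (Lx, H)) f" using f continuous_on_subset by blast
  show *: "(\<integral>x. f x \<partial>lebesgue_on \<Omega>) = integral {0..Lx} (\<lambda>t. integral {-H..H} (\<lambda>s. f (t, s)))"
    using integral_prod_continuous[OF c] by (simp add: Omega_box integral_lebesgue_on_box[OF f])
  have "continuous_on (cbox (0, -H) (Lx, H)) (\<lambda>(x, y). f (x, y))" using c by simp
  from integral_swap_continuous[OF this]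
  show "(\<integral>x. f x \<partial>lebesgue_on \<Omega>) = integral {-H..H} (\<lambda>s. integral {0..Lx} (\<lambda>t. f (t, s)))"
    by (simp add: *)
qed

lemma integral_Gamma:
  fixes f :: "real \<Rightarrow> complex"
  assumes f: "continuous_on UNIV f"
  shows "(\<integral>t. f t \<partial>lebesgue_on \<Gamma>) = integral {0..Lx} f"
  using integral_lebesgue_on_box(2)[OF f, of 0 Lx] by simp

lemma integral_partial2:
  fixes G :: "real \<times> real \<Rightarrow> complex"
  assumes G: "C_infinity G"
  shows "(\<integral>x. partial (0, 1) G x \<partial>lebesgue_on \<Omega>)
    = (\<integral>t. G (t, H) \<partial>lebesgue_on \<Gamma>) - (\<integral>t. G (t, -H) \<partial>lebesgue_on \<Gamma>)"
proof -
  have c: "continuous_on UNIV (\<lambda>t. G (t, s))" for s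
    by (rule continuous_on_compose2[OF C_infinity_continuous[OF G, of UNIV]]) (auto intro!: continuous_intros)
  have "integral {-H..H} (\<lambda>s. partial (0, 1) G (t, s)) = G (t, H) - G (t, -H)" for t
  proof (rule integral_unique, rule fundamental_theorem_of_calculus)
    fix s
    have "((\<lambda>s. G (t, s)) has_derivative (\<lambda>h. partial (0, h) G (t, s))) (at s)"
      by (rule has_derivative_compose[OF _ C_infinity_has_partial[OF G], of "\<lambda>s. (t, s)" "\<lambda>h. (0, h)"])
        (auto intro!: derivative_eq_intros)
    moreover have "(\<lambda>h. partial (0, h) G (t, s)) = (\<lambda>h. h *\<^sub>R partial (0, 1) G (t, s))"
      by (rule ext, subst partial_eq[OF C_infinity_has_derivative[OF G], of "(0, h)"]) simp
    ultimately show "((\<lambda>s. G (t, s)) has_vector_derivative partial (0, 1) G (t, s)) (at s within {-H..H})"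
      by (simp add: has_vector_derivative_def has_derivative_at_withinI)
  qed (use H in simp)
  then show ?thesis
    using G c by (simp add: integral_Omega_iterated(1) C_infinity_continuous C_infinity_partial integral_Gamma)
      (rule Henstock_Kurzweil_Integration.integral_diff; intro integrable_continuous_real continuous_on_subset[OF c]; simp)
qed

lemma integral_partial1:
  fixes G :: "real \<times> real \<Rightarrow> complex"
  assumes G: "C_infinity G" and per: "\<And>s. G (Lx, s) = G (0, s)"
  shows "(\<integral>x. partial (1, 0) G x \<partial>lebesgue_on \<Omega>) = 0"
proof -
  have "integral {0..Lx} (\<lambda>t. partial (1, 0) G (t, s)) = G (Lx, s) - G (0, s)" for s
  proof (rule integral_unique, rule fundamental_theorem_of_calculus)
    fix t
    have "((\<lambda>t. G (t, s)) has_derivative (\<lambda>h. partial (h, 0) G (t, s))) (at t)"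
      by (rule has_derivative_compose[OF _ C_infinity_has_partial[OF G], of "\<lambda>t. (t, s)" "\<lambda>h. (h, 0)"])
        (auto intro!: derivative_eq_intros)
    moreover have "(\<lambda>h. partial (h, 0) G (t, s)) = (\<lambda>h. h *\<^sub>R partial (1, 0) G (t, s))"
      by (rule ext, subst partial_eq[OF C_infinity_has_derivative[OF G], of "(h, 0)"]) simp
    ultimately show "((\<lambda>t. G (t, s)) has_vector_derivative partial (1, 0) G (t, s)) (at t within {0..Lx})"
      by (simp add: has_vector_derivative_def has_derivative_at_withinI)
  qed (use Lx in simp)
  then show ?thesis
    using G per by (simp add: integral_Omega_iterated(2) C_infinity_continuous C_infinity_partial)
qed

abbreviation M where "M c \<equiv> mulc (restr \<Omega> c)"
abbreviation N where "N c \<equiv> mulc (restr \<Gamma> c)"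
abbreviation E where "E \<equiv> toL \<Omega>"
abbreviation EG where "EG \<equiv> toL \<Gamma>"

lemma E_mult: "continuous_on UNIV c \<Longrightarrow> f \<in> L2 \<Omega> \<Longrightarrow> E (\<lambda>x. c x * f x) = M c (E f)"
  by (intro L2_mult(2) restr_bmeas_continuous) auto

lemma EG_mult: "continuous_on UNIV c \<Longrightarrow> f \<in> L2 \<Gamma> \<Longrightarrow> EG (\<lambda>x. c x * f x) = N c (EG f)"
  by (intro L2_mult(2) restr_bmeas_continuous) auto

lemma continuous_trace: "C_infinity f \<Longrightarrow> continuous_on UNIV (\<lambda>t. f (t, h))"
  by (rule continuous_on_compose2[OF C_infinity_continuous[of f UNIV]]) (auto intro!: continuous_intros)

text \<open>Integration of the normal derivative of the product of \<open>c\<close>,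
  \<open>f\<close> and the conjugate of \<open>g\<close>. Written with classes and multiplication
  operators, it remains meaningful for limits of smooth functions.\<close>

lemma smooth_green2:
  assumes c: "C_infinity c" and f: "C_infinity f" and g: "C_infinity g"
  shows "cin (M (partial (0, 1) c) (E f)) (E g) + cin (M c (E (partial (0, 1) f))) (E g)
      + cin (M c (E f)) (E (partial (0, 1) g))
    = cin (N (\<lambda>t. c (t, H)) (EG (\<lambda>t. f (t, H)))) (EG (\<lambda>t. g (t, H)))
      - cin (N (\<lambda>t. c (t, -H)) (EG (\<lambda>t. f (t, -H)))) (EG (\<lambda>t. g (t, -H)))"
proof -
  note C = C_infinity_continuous C_infinity_partial C_infinity_mult c f g continuous_trace
  have eq: "partial (0, 1) (\<lambda>x. c x * f x * cnj (g x))
    = (\<lambda>x. (partial (0, 1) c x * f x + c x * partial (0, 1) f x) * cnj (g x) + c x * f x * cnj (partial (0, 1) g x))"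
    by (rule ext) (simp add: partial_mult_cnj C partial_mult)
  have "(\<integral>x. partial (0, 1) (\<lambda>x. c x * f x * cnj (g x)) x \<partial>lebesgue_on \<Omega>)
    = cin (E (\<lambda>x. partial (0, 1) c x * f x + c x * partial (0, 1) f x)) (E g)
      + cin (E (\<lambda>x. c x * f x)) (E (partial (0, 1) g))"
    unfolding eq by (simp add: cin_toL integrable_mult_cnj C_infinity_add C)
  moreover have "E (\<lambda>x. partial (0, 1) c x * f x + c x * partial (0, 1) f x)
     = M (partial (0, 1) c) (E f) + M c (E (partial (0, 1) f))"
    by (simp add: toL_add E_mult C)
  moreover have "E (\<lambda>x. c x * f x) = M c (E f)" by (simp add: E_mult C)
  moreover have "(\<integral>t. c (t, h) * f (t, h) * cnj (g (t, h)) \<partial>lebesgue_on \<Gamma>)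
      = cin (N (\<lambda>t. c (t, h)) (EG (\<lambda>t. f (t, h)))) (EG (\<lambda>t. g (t, h)))" for h
    by (subst EG_mult[symmetric]) (simp_all add: C cin_toL continuous_on_mult)
  moreover have "C_infinity (\<lambda>x. c x * f x * cnj (g x))"
    by (intro C_infinity_mult C_infinity_cnj c f g)
  note integral_partial2[OF this]
  ultimately show ?thesis by (simp add: cin.add_left)
qed

text \<open>Periodicity is required of the product only: for quasi-periodic \<open>f\<close> and
  \<open>g\<close> the phases cancel, so that a periodic \<open>c\<close> suffices.\<close>

lemma smooth_green1:
  assumes c: "C_infinity c" and f: "C_infinity f" and g: "C_infinity g"
    and per: "\<And>s. c (Lx, s) * f (Lx, s) * cnj (g (Lx, s)) = c (0, s) * f (0, s) * cnj (g (0, s))"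
  shows "cin (M (partial (1, 0) c) (E f)) (E g) + cin (M c (E (partial (1, 0) f))) (E g)
      + cin (M c (E f)) (E (partial (1, 0) g)) = 0"
proof -
  note C = C_infinity_continuous C_infinity_partial C_infinity_mult c f g
  have eq: "partial (1, 0) (\<lambda>x. c x * f x * cnj (g x))
    = (\<lambda>x. (partial (1, 0) c x * f x + c x * partial (1, 0) f x) * cnj (g x) + c x * f x * cnj (partial (1, 0) g x))"
    by (rule ext) (simp add: partial_mult_cnj C partial_mult)
  have e1: "(\<integral>x. partial (1, 0) (\<lambda>x. c x * f x * cnj (g x)) x \<partial>lebesgue_on \<Omega>)
    = cin (E (\<lambda>x. partial (1, 0) c x * f x + c x * partial (1, 0) f x)) (E g)
      + cin (E (\<lambda>x. c x * f x)) (E (partial (1, 0) g))"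
    unfolding eq by (simp add: cin_toL integrable_mult_cnj C_infinity_add C)
  have e2: "E (\<lambda>x. partial (1, 0) c x * f x + c x * partial (1, 0) f x)
     = M (partial (1, 0) c) (E f) + M c (E (partial (1, 0) f))"
    by (simp add: toL_add E_mult C)
  have e3: "E (\<lambda>x. c x * f x) = M c (E f)" by (simp add: E_mult C)
  have "C_infinity (\<lambda>x. c x * f x * cnj (g x))"
    by (intro C_infinity_mult C_infinity_cnj c f g)
  from integral_partial1[OF this per]
  show ?thesis unfolding e1 e2 e3 cin.add_left .
qed


end

subsection \<open>Test functions and weak derivatives\<close>

lemma mem_box_pair:
  fixes x :: "real \<times> real"
  shows "x \<in> box (a, c) (b, d) \<longleftrightarrow> a < fst x \<and> fst x < b \<and> c < snd x \<and> snd x < d"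
  by (cases x) (auto simp: box_def Basis_prod_def)

text \<open>Smooth approximation from inside of the indicator of an open box, vanishing within
  distance \<open>1 / k\<close> of its boundary.\<close>

definition bump :: "real \<Rightarrow> real \<Rightarrow> real \<Rightarrow> real \<Rightarrow> nat \<Rightarrow> real \<times> real \<Rightarrow> real" where
  "bump a b c d k x = smooth_step (real k * (fst x - a) - 1) * smooth_step (real k * (b - fst x) - 1)
     * smooth_step (real k * (snd x - c) - 1) * smooth_step (real k * (d - snd x) - 1)"

lemma C_infinity_bump: "C_infinity (bump a b c d k)"
proof -
  have 1: "C_infinity (\<lambda>x. smooth_step (real k * (fst x - a) - 1))"
    using C_infinity_smooth_step[of "(real k, 0)" "- real k * a - 1"] by (simp add: inner_prod_def algebra_simps)
  have 2: "C_infinity (\<lambda>x. smooth_step (real k * (b - fst x) - 1))"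
    using C_infinity_smooth_step[of "(- real k, 0)" "real k * b - 1"] by (simp add: inner_prod_def algebra_simps)
  have 3: "C_infinity (\<lambda>x. smooth_step (real k * (snd x - c) - 1))"
    using C_infinity_smooth_step[of "(0, real k)" "- real k * c - 1"] by (simp add: inner_prod_def algebra_simps)
  have 4: "C_infinity (\<lambda>x. smooth_step (real k * (d - snd x) - 1))"
    using C_infinity_smooth_step[of "(0, - real k)" "real k * d - 1"] by (simp add: inner_prod_def algebra_simps)
  show ?thesis unfolding bump_def [abs_def] by (intro C_infinity_mult 1 2 3 4)
qed

lemma bump_support:
  assumes "k > 0" "bump a b c d k x \<noteq> 0"
  shows "x \<in> {a + 1 / k .. b - 1 / k} \<times> {c + 1 / k .. d - 1 / k}"
proof -
  have *: "smooth_step t \<noteq> 0 \<Longrightarrow> t > 0" for t by (auto simp: smooth_step_def split: if_splits)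
  have "real k * (fst x - a) - 1 > 0" "real k * (b - fst x) - 1 > 0"
    "real k * (snd x - c) - 1 > 0" "real k * (d - snd x) - 1 > 0"
    using assms(2) by (intro *, simp add: bump_def)+
  then show ?thesis using assms(1) by (cases x) (auto simp: field_simps)
qed

lemma bump_box:
  assumes "k > 0"
  shows "{a + 1 / real k .. b - 1 / k} \<times> {c + 1 / k .. d - 1 / k} \<subseteq> box (a, c) (b, d)"
proof
  have p: "1 / real k > 0" using assms by simp
  fix x assume "x \<in> {a + 1 / real k .. b - 1 / k} \<times> {c + 1 / k .. d - 1 / k}"
  then have "a + 1 / k \<le> fst x" "fst x \<le> b - 1 / k" "c + 1 / k \<le> snd x" "snd x \<le> d - 1 / k" by auto
  then have "a < fst x" "fst x < b" "c < snd x" "snd x < d" using p by linarith+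
  then show "x \<in> box (a, c) (b, d)" by (simp add: mem_box_pair)
qed

lemma bump_bounds: "0 \<le> bump a b c d k x" "bump a b c d k x \<le> 1"
  unfolding bump_def by (auto intro!: mult_nonneg_nonneg mult_le_one smooth_step_bounds)

lemma bump_tendsto: "(\<lambda>k. bump a b c d k x) \<longlonglongrightarrow> indicator (box (a, c) (b, d)) x"
proof (cases "x \<in> box (a, c) (b, d)")
  case True
  then have "a < fst x" "fst x < b" "c < snd x" "snd x < d"
    by (auto simp: mem_box_pair)
  then have "(\<lambda>k. bump a b c d k x) \<longlonglongrightarrow> 1 * 1 * 1 * 1"
    unfolding bump_def by (intro tendsto_mult smooth_step_tendsto_1) auto
  then show ?thesis using True by simp
next
  case False
  have "bump a b c d k x = 0" if "k > 0" for k
    using bump_support[OF that, of a b c d x] bump_box[OF that, of a b c d] False by blast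
  then have "(\<lambda>k. bump a b c d k x) \<longlonglongrightarrow> 0"
    by (intro tendsto_eventually eventually_sequentiallyI[of 1]) auto
  then show ?thesis using False by simp
qed

lemma bump_test_function:
  assumes "k > 0" "box (a, c) (b, d) \<subseteq> S"
  shows "(\<lambda>x. complex_of_real (bump a b c d k x)) \<in> test_functions S"
proof -
  let ?K = "{a + 1 / k .. b - 1 / k} \<times> {c + 1 / k .. d - 1 / k}"
  have cl: "closure {x. complex_of_real (bump a b c d k x) \<noteq> 0} \<subseteq> ?K"
    using bump_support[OF assms(1)] by (intro closure_minimal closed_Times) auto
  have K: "compact ?K" by (intro compact_Times compact_Icc)
  have "?K \<subseteq> box (a, c) (b, d)" by (rule bump_box[OF assms(1)])
  then have "closure {x. complex_of_real (bump a b c d k x) \<noteq> 0} \<subseteq> S"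
    using cl assms(2) by blast
  moreover have "compact (closure {x. complex_of_real (bump a b c d k x) \<noteq> 0})"
    unfolding compact_eq_bounded_closed
    using bounded_subset[OF compact_imp_bounded[OF K] cl] by simp
  ultimately show ?thesis
    unfolding test_functions_def by (simp add: C_infinity_of_real[OF C_infinity_bump])
qed

context cell
begin

lemma test_function_continuous: "\<phi> \<in> test_functions S \<Longrightarrow> continuous_on T \<phi>"
  by (auto simp: test_functions_def C_infinity_continuous)

text \<open>Fundamental lemma of the calculus of variations: bump functions converge boundedly to
  indicators of boxes, so the integrals of \<open>g\<close> over all boxes in the cell
  vanish.\<close>

lemma zero_if_orthogonal_test:
  assumes g: "g \<in> L2 \<Omega>"
    and z: "\<And>\<phi>. \<phi> \<in> test_functions \<Omega> \<Longrightarrow> (\<integral>x. g x * \<phi> x \<partial>lebesgue_on \<Omega>) = 0"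
  shows "E g = 0"
proof -
  have gi: "integrable (lebesgue_on \<Omega>) g"
    using integrable_mult_cnj[OF _ g, of "\<lambda>x. 1"] by simp
  have "AE x in lebesgue_on \<Omega>. g x = 0"
    unfolding Omega_box
  proof (rule AE_zero_on_box)
    show "integrable (lebesgue_on (box (0, - H) (Lx, H))) g"
      using gi by (simp add: Omega_box)
    fix p q :: "real \<times> real" assume sub: "box p q \<subseteq> box (0, - H) (Lx, H)"
    obtain a c b d where pq: "p = (a, c)" "q = (b, d)" by fastforce
    have sub': "box (a, c) (b, d) \<subseteq> \<Omega>" using sub pq by (simp add: Omega_box)
    have gm: "g \<in> borel_measurable (lebesgue_on \<Omega>)" using gi by auto
    have bm: "(\<lambda>x. complex_of_real (bump a b c d k x)) \<in> borel_measurable (lebesgue_on \<Omega>)" for k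
      by (intro continuous_imp_measurable_on_sets_lebesgue C_infinity_continuous C_infinity_of_real
          C_infinity_bump Omega_sets)
    have "(\<lambda>k. \<integral>x. g x * complex_of_real (bump a b c d k x) \<partial>lebesgue_on \<Omega>)
      \<longlonglongrightarrow> (\<integral>x. g x * indicator (box (a, c) (b, d)) x \<partial>lebesgue_on \<Omega>)"
    proof (rule integral_dominated_convergence[where w = "\<lambda>x. norm (g x)"])
      show "(\<lambda>x. g x * indicator (box (a, c) (b, d)) x) \<in> borel_measurable (lebesgue_on \<Omega>)"
        using gm by (intro borel_measurable_times borel_measurable_indicator)
          (auto simp: sets_restrict_space_iff intro!: sub')
      show "(\<lambda>x. g x * complex_of_real (bump a b c d k x)) \<in> borel_measurable (lebesgue_on \<Omega>)" for k
        using gm bm by (intro borel_measurable_times)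
      show "integrable (lebesgue_on \<Omega>) (\<lambda>x. norm (g x))" using gi by simp
      have "(\<lambda>k. complex_of_real (bump a b c d k x)) \<longlonglongrightarrow> of_real (indicator (box (a, c) (b, d)) x)" for x
        by (intro tendsto_of_real bump_tendsto)
      then show "AE x in lebesgue_on \<Omega>. (\<lambda>k. g x * complex_of_real (bump a b c d k x)) \<longlonglongrightarrow> g x * indicator (box (a, c) (b, d)) x"
        by (intro AE_I2 tendsto_mult tendsto_const) (simp add: of_real_indicator)
      show "AE x in lebesgue_on \<Omega>. norm (g x * complex_of_real (bump a b c d k x)) \<le> norm (g x)" for k
        using bump_bounds by (intro AE_I2) (simp add: norm_mult mult_left_le)
    qed
    moreover have "\<forall>\<^sub>F k in sequentially. (\<integral>x. g x * complex_of_real (bump a b c d k x) \<partial>lebesgue_on \<Omega>) = 0"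
      using bump_test_function[OF _ sub'] z by (intro eventually_sequentiallyI[of 1]) auto
    ultimately have "(\<integral>x. g x * indicator (box (a, c) (b, d)) x \<partial>lebesgue_on \<Omega>) = 0"
      by (rule LIMSEQ_unique[OF _ tendsto_eventually])
    also have "(\<integral>x. g x * indicator (box (a, c) (b, d)) x \<partial>lebesgue_on \<Omega>) = (LINT x:box p q|lebesgue. g x)"
      unfolding pq set_lebesgue_integral_def
      by (subst integral_restrict_space) (use sub' in \<open>auto simp: set_lebesgue_integral_def indicator_def intro!: Bochner_Integration.integral_cong\<close>)
    finally show "(LINT x:box p q|lebesgue. g x) = 0" .
  qed
  then have "E g = E (\<lambda>x. 0)" using g by (subst toL_eq_iff) (auto simp: L2_zero)
  then show ?thesis by (simp add: toL_zero)
qed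

text \<open>The product with a test function vanishes outside the cell, so integrating its
  derivative leaves no boundary terms.\<close>

lemma weak_partial_smooth:
  assumes w: "C_infinity w" and b: "b = (1, 0) \<or> b = (0, 1)"
  shows "is_weak_partial \<Omega> b w (partial b w)"
  unfolding is_weak_partial_def
proof safe
  show "partial b w \<in> L2 \<Omega>"
    using C_infinity_partial'[OF w b] by (simp add: C_infinity_continuous)
  fix \<phi> assume "\<phi> \<in> test_functions \<Omega>"
  then have \<phi>: "C_infinity \<phi>" and supp: "closure {x. \<phi> x \<noteq> 0} \<subseteq> \<Omega>" by (auto simp: test_functions_def)
  have z: "\<phi> x = 0" if "x \<notin> \<Omega>" for x using that supp closure_subset[of "{x. \<phi> x \<noteq> 0}"] by blast
  have G: "C_infinity (\<lambda>x. w x * \<phi> x)" by (intro C_infinity_mult w \<phi>)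
  have "(\<integral>x. partial b (\<lambda>x. w x * \<phi> x) x \<partial>lebesgue_on \<Omega>) = 0"
    using b
  proof
    assume b: "b = (1, 0)"
    show ?thesis unfolding b by (rule integral_partial1[OF G]) (simp add: z Omega_def)
  next
    assume b: "b = (0, 1)"
    show ?thesis unfolding b integral_partial2[OF G] by (simp add: z Omega_def)
  qed
  moreover have eq: "partial b (\<lambda>x. w x * \<phi> x) = (\<lambda>x. w x * partial b \<phi> x + partial b w x * \<phi> x)"
    by (rule ext) (simp only: partial_mult[OF w \<phi>] add.commute)
  moreover have "C_infinity (\<lambda>x. w x * partial b \<phi> x)" "C_infinity (\<lambda>x. partial b w x * \<phi> x)"
    by (intro C_infinity_mult C_infinity_partial' w \<phi> b)+
  then have "integrable (lebesgue_on \<Omega>) (\<lambda>x. w x * partial b \<phi> x)"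
    "integrable (lebesgue_on \<Omega>) (\<lambda>x. partial b w x * \<phi> x)"
    unfolding Omega_box by (auto intro: integral_lebesgue_on_box(1) C_infinity_continuous)
  from Bochner_Integration.integral_add[OF this]
  have "(\<integral>x. w x * partial b \<phi> x + partial b w x * \<phi> x \<partial>lebesgue_on \<Omega>)
    = (\<integral>x. w x * partial b \<phi> x \<partial>lebesgue_on \<Omega>) + (\<integral>x. partial b w x * \<phi> x \<partial>lebesgue_on \<Omega>)" .
  ultimately have "(\<integral>x. w x * partial b \<phi> x \<partial>lebesgue_on \<Omega>) + (\<integral>x. partial b w x * \<phi> x \<partial>lebesgue_on \<Omega>) = 0"
    by (simp only: eq)
  then show "(\<integral>x. w x * partial b \<phi> x \<partial>lebesgue_on \<Omega>) = - (\<integral>x. partial b w x * \<phi> x \<partial>lebesgue_on \<Omega>)"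
    by (simp only: eq_neg_iff_add_eq_0)
qed

text \<open>In this form the defining identity is continuous in the classes of \<open>u\<close> and
  \<open>g\<close>, hence stable under L2 limits.\<close>

lemma is_weak_partial_iff_cin:
  assumes u: "u \<in> L2 \<Omega>" and g: "g \<in> L2 \<Omega>" and b: "b = (1, 0) \<or> b = (0, 1)"
  shows "is_weak_partial \<Omega> b u g \<longleftrightarrow>
    (\<forall>\<phi>\<in>test_functions \<Omega>. cin (E u) (E (\<lambda>x. cnj (partial b \<phi> x))) = - cin (E g) (E (\<lambda>x. cnj (\<phi> x))))"
proof -
  have "(\<integral>x. u x * partial b \<phi> x \<partial>lebesgue_on \<Omega>) = cin (E u) (E (\<lambda>x. cnj (partial b \<phi> x)))"
    "(\<integral>x. g x * \<phi> x \<partial>lebesgue_on \<Omega>) = cin (E g) (E (\<lambda>x. cnj (\<phi> x)))" if "\<phi> \<in> test_functions \<Omega>" for \<phi>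
  proof -
    have \<phi>: "C_infinity \<phi>" using that by (auto simp: test_functions_def)
    have "(\<lambda>x. cnj (partial b \<phi> x)) \<in> L2 \<Omega>" "(\<lambda>x. cnj (\<phi> x)) \<in> L2 \<Omega>"
      by (intro continuous_L2_Omega C_infinity_continuous C_infinity_cnj C_infinity_partial' \<phi> b)+
    then show "(\<integral>x. u x * partial b \<phi> x \<partial>lebesgue_on \<Omega>) = cin (E u) (E (\<lambda>x. cnj (partial b \<phi> x)))"
      "(\<integral>x. g x * \<phi> x \<partial>lebesgue_on \<Omega>) = cin (E g) (E (\<lambda>x. cnj (\<phi> x)))"
      using u g by (simp_all add: cin_toL)
  qed
  then show ?thesis using g by (auto simp: is_weak_partial_def)
qed

text \<open>\<open>weak_partial\<close> chooses an arbitrary representative; only its class is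
  determined, and the arguments below refer to the class.\<close>

lemma weak_partial_unique:
  assumes "u \<in> L2 \<Omega>" "is_weak_partial \<Omega> b u g" "is_weak_partial \<Omega> b u h" and b: "b = (1, 0) \<or> b = (0, 1)"
  shows "E g = E h"
proof -
  have g: "g \<in> L2 \<Omega>" "h \<in> L2 \<Omega>" using assms by (auto simp: is_weak_partial_def)
  have "E (\<lambda>x. g x - h x) = 0"
  proof (rule zero_if_orthogonal_test[OF L2_diff[OF _ g]])
    fix \<phi> assume \<phi>: "\<phi> \<in> test_functions \<Omega>"
    then have "(\<lambda>x. cnj (\<phi> x)) \<in> L2 \<Omega>"
      by (intro continuous_L2_Omega continuous_on_cnj test_function_continuous)
    then have "integrable (lebesgue_on \<Omega>) (\<lambda>x. g x * \<phi> x)" "integrable (lebesgue_on \<Omega>) (\<lambda>x. h x * \<phi> x)"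
      using integrable_mult_cnj[OF _ g(1), of "\<lambda>x. cnj (\<phi> x)"] integrable_mult_cnj[OF _ g(2), of "\<lambda>x. cnj (\<phi> x)"]
      by simp_all
    then show "(\<integral>x. (g x - h x) * \<phi> x \<partial>lebesgue_on \<Omega>) = 0"
      using assms \<phi> by (simp add: is_weak_partial_def left_diff_distrib)
  qed simp
  then show ?thesis using g by (simp add: toL_diff)
qed

end

subsection \<open>Completeness of the quasi-periodic cosine system\<close>

context cell
begin

text \<open>Maps the heights from \<open>-H\<close> to \<open>H\<close> affinely onto the interval
  from 0 to pi, where the cosines of integer multiples are complete in L2.\<close>

definition vert :: "real \<times> real \<Rightarrow> real" where
  "vert x = pi / (2 * H) * (snd x + H)"

definition hexp :: "real \<Rightarrow> real \<times> real \<Rightarrow> complex" where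
  "hexp b x = exp (\<i> * of_real (b * fst x))"

text \<open>Products of quasi-periodic exponentials and Neumann cosines; for \<open>b = a 0\<close>
  the frequencies in the first variable are the \<open>a n\<close>.\<close>

definition cbas :: "real \<Rightarrow> int \<Rightarrow> nat \<Rightarrow> real \<times> real \<Rightarrow> complex" where
  "cbas b n m x = hexp (b + 2 * pi * of_int n / Lx) x * of_real (cos (real m * vert x))"

lemma vert_affine: "real m * vert x = real m * pi / (2 * H) * snd x + real m * pi / 2"
  using H by (simp add: vert_def field_simps)

lemma vert_bounds:
  assumes "-H \<le> snd x" "snd x \<le> H"
  shows "0 \<le> vert x" "vert x \<le> pi"
proof -
  show "0 \<le> vert x" unfolding vert_def using assms H by (intro mult_nonneg_nonneg) auto
  have "vert x \<le> pi / (2 * H) * (2 * H)" unfolding vert_def using assms H by (intro mult_left_mono) auto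
  then show "vert x \<le> pi" using H by simp
qed

lemma C_infinity_hexp: "C_infinity (hexp b)"
  unfolding hexp_def [abs_def] by (rule C_infinity_exp_fst)

lemma C_infinity_cos_vert: "C_infinity (\<lambda>x. cos (real m * vert x))"
  and C_infinity_sin_vert: "C_infinity (\<lambda>x. sin (real m * vert x))"
  unfolding vert_affine by (rule C_infinity_cos_snd, rule C_infinity_sin_snd)

lemma C_infinity_cbas: "C_infinity (cbas b n m)"
  unfolding cbas_def [abs_def]
  by (intro C_infinity_mult C_infinity_hexp C_infinity_of_real C_infinity_cos_vert)

text \<open>Injective on \<open>\<Omega>\<close> and identifying the lateral sides of the closed cell. Polynomials in \<open>wrap x\<close> are
  trigonometric, which is what makes the Stone--Weierstrass theorem applicable.\<close>

definition wrap :: "real \<times> real \<Rightarrow> real \<times> real \<times> real" where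
  "wrap x = (cos (2 * pi / Lx * fst x), sin (2 * pi / Lx * fst x), cos (vert x))"

lemma continuous_vert: "continuous_on S vert"
  unfolding vert_def [abs_def] by (intro continuous_intros)

lemma continuous_wrap: "continuous_on S wrap"
  unfolding wrap_def [abs_def] by (intro continuous_intros continuous_vert)

lemma continuous_on_poly_wrap: "real_polynomial_function Q \<Longrightarrow> continuous_on S (\<lambda>x. Q (wrap x))"
  by (rule continuous_on_compose2[of UNIV Q, OF _ continuous_wrap])
    (auto simp: real_polynomial_function_eq intro: continuous_on_polymonial_function)

lemma hexp_shift:
  "hexp (b + 2 * pi * of_int (n + 1) / Lx) x = hexp (b + 2 * pi * of_int n / Lx) x * exp (\<i> * of_real (2 * pi / Lx * fst x))"
  "hexp (b + 2 * pi * of_int (n - 1) / Lx) x = hexp (b + 2 * pi * of_int n / Lx) x * exp (- (\<i> * of_real (2 * pi / Lx * fst x)))"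
proof -
  have "\<i> * of_real ((b + 2 * pi * of_int (n + 1) / Lx) * fst x)
      = \<i> * of_real ((b + 2 * pi * of_int n / Lx) * fst x) + \<i> * of_real (2 * pi / Lx * fst x)"
    "\<i> * of_real ((b + 2 * pi * of_int (n - 1) / Lx) * fst x)
      = \<i> * of_real ((b + 2 * pi * of_int n / Lx) * fst x) + - (\<i> * of_real (2 * pi / Lx * fst x))"
    unfolding distrib_left[symmetric] mult_minus_right[symmetric] of_real_add[symmetric] of_real_minus[symmetric]
    using Lx by (simp_all add: field_simps)
  then show
  "hexp (b + 2 * pi * of_int (n + 1) / Lx) x = hexp (b + 2 * pi * of_int n / Lx) x * exp (\<i> * of_real (2 * pi / Lx * fst x))"
  "hexp (b + 2 * pi * of_int (n - 1) / Lx) x = hexp (b + 2 * pi * of_int n / Lx) x * exp (- (\<i> * of_real (2 * pi / Lx * fst x)))"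
    unfolding hexp_def by (simp_all only: exp_add)
qed

text \<open>Multiplying by a coordinate of \<open>wrap\<close> only shifts indices, by the addition
  formulas; this keeps the span of the system stable.\<close>

lemma
  shows cbas_cos: "complex_of_real (cos (2 * pi / Lx * fst x)) * cbas b n m x
      = (1/2) * (cbas b (n + 1) m x + cbas b (n - 1) m x)"
    and cbas_sin: "complex_of_real (sin (2 * pi / Lx * fst x)) * cbas b n m x
      = (- (\<i> / 2)) * (cbas b (n + 1) m x - cbas b (n - 1) m x)"
  unfolding cbas_def hexp_shift cos_of_real[symmetric] sin_of_real[symmetric] cos_exp_eq sin_exp_eq
  by (simp_all add: field_simps)

text \<open>For \<open>m = 0\<close> there is no index below; the product is then the first cosine
  itself, which the average of two equal terms expresses in the common format.\<close>

lemma cbas_cos_vert: "complex_of_real (cos (vert x)) * cbas b n m x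
  = (1/2) * (cbas b n (m + 1) x + cbas b n (if m = 0 then 1 else m - 1) x)"
proof -
  have "cos (vert x) * cos (real m * vert x)
    = (cos (real (m + 1) * vert x) + cos (real (if m = 0 then 1 else m - 1) * vert x)) / 2"
  proof (cases m)
    case (Suc k)
    have "real (m + 1) * vert x = real m * vert x + vert x" "real k * vert x = real m * vert x - vert x"
      by (simp_all add: Suc algebra_simps)
    then have "cos (real (m + 1) * vert x) + cos (real k * vert x) = 2 * (cos (real m * vert x) * cos (vert x))"
      by (simp only: cos_add cos_diff)
    then show ?thesis using Suc by simp
  qed simp
  then have "complex_of_real (cos (vert x) * cos (real m * vert x))
    = of_real ((cos (real (m + 1) * vert x) + cos (real (if m = 0 then 1 else m - 1) * vert x)) / 2)"
    by (simp only:)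
  then have "complex_of_real (cos (vert x)) * of_real (cos (real m * vert x))
    = (of_real (cos (real (m + 1) * vert x)) + of_real (cos (real (if m = 0 then 1 else m - 1) * vert x))) / 2"
    by (simp only: of_real_add of_real_mult of_real_divide of_real_numeral)
  moreover have "p * (h * q) = (1/2) * (h * r + h * s)" if "p * q = (r + s) / 2" for p q r s h :: complex
  proof -
    have "p * (h * q) = h * (p * q)" by (simp only: mult.left_commute)
    then show ?thesis using that by (simp add: distrib_left add_divide_distrib)
  qed
  ultimately show ?thesis unfolding cbas_def by blast
qed

section \<open>The annihilator of the system under multiplication\<close>

lemma M_adjoint:
  assumes c: "continuous_on UNIV c"
  shows "cin (M (\<lambda>x. complex_of_real (c x)) X) Y = cin X (M (\<lambda>x. complex_of_real (c x)) Y)"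
proof -
  have "bmeas (restr \<Omega> (\<lambda>x. complex_of_real (c x)))"
    by (intro restr_bmeas_continuous continuous_intros c) auto
  moreover have "(\<lambda>t. cnj (restr \<Omega> (\<lambda>x. complex_of_real (c x)) t)) = restr \<Omega> (\<lambda>x. complex_of_real (c x))"
    by (rule ext) (simp add: restr_def)
  ultimately show ?thesis by (simp add: cin_mulc_left)
qed

lemma M_mult:
  assumes "continuous_on UNIV c" "continuous_on UNIV d"
  shows "M (\<lambda>x. c x * d x) X = M c (M d X)"
proof -
  have "M c (M d X) = mulc (\<lambda>x. restr \<Omega> c x * restr \<Omega> d x) X"
    by (rule mulc_mulc) (use assms in \<open>auto intro: restr_bmeas_continuous\<close>)
  also have "(\<lambda>x. restr \<Omega> c x * restr \<Omega> d x) = restr \<Omega> (\<lambda>x. c x * d x)"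
    by (rule ext) (simp add: restr_def indicator_def)
  finally show ?thesis by simp
qed

lemma M_add:
  assumes "continuous_on UNIV c" "continuous_on UNIV d"
  shows "M (\<lambda>x. c x + d x) X = M c X + M d X"
proof -
  have eq: "restr \<Omega> (\<lambda>x. c x + d x) = (\<lambda>x. restr \<Omega> c x + restr \<Omega> d x)"
    by (rule ext) (simp add: restr_def scaleR_add_right)
  show ?thesis
    unfolding eq
  proof (rule mulc_add[of "restr \<Omega> c" "restr \<Omega> d"])
    show "bmeas (\<lambda>x. restr \<Omega> c x + restr \<Omega> d x)"
      unfolding eq [symmetric] using assms by (intro restr_bmeas_continuous continuous_on_add) auto
  qed (use assms in \<open>auto intro: restr_bmeas_continuous\<close>)
qed

lemma M_const_mult:
  assumes "continuous_on UNIV c"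
  shows "M (\<lambda>x. k * c x) X = mulc (\<lambda>_. k) (M c X)"
proof -
  have "mulc (\<lambda>_. k) (M c X) = mulc (\<lambda>x. k * restr \<Omega> c x) X"
    by (rule mulc_mulc) (use assms in \<open>auto intro: restr_bmeas_continuous\<close>)
  also have "(\<lambda>x. k * restr \<Omega> c x) = restr \<Omega> (\<lambda>x. k * c x)"
    by (rule ext) (simp add: restr_def)
  finally show ?thesis by simp
qed

lemma cin_mulc_const_right: "cin x (mulc (\<lambda>_. c) y) = cnj c * cin x y"
proof -
  have "cin x (mulc (\<lambda>_. c) y) = cin (mulc (\<lambda>_. cnj c) x) y"
    using cin_mulc_left[of "\<lambda>_. cnj c" x y] by simp
  then show ?thesis by (simp add: cin_mulc_const_left)
qed

lemma M_E:
  assumes "continuous_on UNIV c" "continuous_on UNIV f"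
  shows "M c (E f) = E (\<lambda>x. c x * f x)"
  using assms by (simp add: E_mult)

definition cbas_null :: "real \<Rightarrow> (real \<times> real) lsq \<Rightarrow> bool" where
  "cbas_null b X \<longleftrightarrow> (\<forall>n m. cin X (E (cbas b n m)) = 0)"

text \<open>A real multiplier moves to the other side of the form. The shape with \<open>k\<close>
  and \<open>s\<close> is common to the product formulas for the horizontal cosine and sine and the
  vertical cosine.\<close>

lemma cbas_null_mult:
  assumes "cbas_null b X" and c: "continuous_on UNIV c"
    and eq: "\<And>n m. \<exists>k n1 m1 n2 m2 s. \<forall>x. complex_of_real (c x) * cbas b n m x = k * (cbas b n1 m1 x + s * cbas b n2 m2 x)"
  shows "cbas_null b (M (\<lambda>x. complex_of_real (c x)) X)"
  unfolding cbas_null_def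
proof (intro allI)
  fix n m
  obtain k n1 m1 n2 m2 s where e: "\<And>x. complex_of_real (c x) * cbas b n m x = k * (cbas b n1 m1 x + s * cbas b n2 m2 x)"
    using eq[of n m] by blast
  note C = C_infinity_continuous[OF C_infinity_cbas]
  have "cin (M (\<lambda>x. complex_of_real (c x)) X) (E (cbas b n m)) = cin X (E (\<lambda>x. complex_of_real (c x) * cbas b n m x))"
    unfolding M_adjoint[OF c] by (subst M_E) (auto intro!: continuous_intros c C)
  also have "\<dots> = cin X (mulc (\<lambda>_. k) (E (cbas b n1 m1) + mulc (\<lambda>_. s) (E (cbas b n2 m2))))"
    unfolding e by (simp add: toL_const_mult toL_add L2_add L2_const_mult C)
  also have "\<dots> = 0" using assms(1) by (simp add: cin_mulc_const_right cin.add_right cbas_null_def)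
  finally show "cin (M (\<lambda>x. complex_of_real (c x)) X) (E (cbas b n m)) = 0" .
qed

text \<open>The annihilator is stable under multiplication by the three coordinates of
  \<open>wrap\<close>, hence by all polynomials in them; the case of products needs the induction
  hypothesis for all annihilated \<open>X\<close>.\<close>

lemma cbas_null_poly:
  assumes "real_polynomial_function Q" "cbas_null b X"
  shows "cbas_null b (M (\<lambda>x. complex_of_real (Q (wrap x))) X)"
  using assms
proof (induction arbitrary: X)
  case (linear f)
  note X0 = linear(2)
  interpret bounded_linear f by (rule linear)
  have c1: "cbas_null b (M (\<lambda>x. complex_of_real (cos (2 * pi / Lx * fst x))) X)"
  proof (rule cbas_null_mult[OF X0])
    show "\<exists>k n1 m1 n2 m2 s. \<forall>x. complex_of_real (cos (2 * pi / Lx * fst x)) * cbas b n m x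
        = k * (cbas b n1 m1 x + s * cbas b n2 m2 x)" for n m
      by (rule exI[of _ "1/2"], rule exI[of _ "n + 1"], rule exI[of _ m], rule exI[of _ "n - 1"], rule exI[of _ m], rule exI[of _ 1])
        (simp only: cbas_cos mult_1 simp_thms)
  qed (intro continuous_intros)
  have c2: "cbas_null b (M (\<lambda>x. complex_of_real (sin (2 * pi / Lx * fst x))) X)"
  proof (rule cbas_null_mult[OF X0])
    show "\<exists>k n1 m1 n2 m2 s. \<forall>x. complex_of_real (sin (2 * pi / Lx * fst x)) * cbas b n m x
        = k * (cbas b n1 m1 x + s * cbas b n2 m2 x)" for n m
      by (rule exI[of _ "- (\<i>/2)"], rule exI[of _ "n + 1"], rule exI[of _ m], rule exI[of _ "n - 1"], rule exI[of _ m], rule exI[of _ "-1"])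
        (rule allI, subst cbas_sin, simp)
  qed (intro continuous_intros)
  have c3: "cbas_null b (M (\<lambda>x. complex_of_real (cos (vert x))) X)"
  proof (rule cbas_null_mult[OF X0])
    show "\<exists>k n1 m1 n2 m2 s. \<forall>x. complex_of_real (cos (vert x)) * cbas b n m x
        = k * (cbas b n1 m1 x + s * cbas b n2 m2 x)" for n m
      by (rule exI[of _ "1/2"], rule exI[of _ n], rule exI[of _ "m + 1"], rule exI[of _ n],
          rule exI[of _ "if m = 0 then 1 else m - 1"], rule exI[of _ 1])
        (simp only: cbas_cos_vert mult_1 simp_thms)
  qed (intro continuous_intros continuous_vert)
  have "f (wrap x) = f (1, 0, 0) * cos (2 * pi / Lx * fst x) + (f (0, 1, 0) * sin (2 * pi / Lx * fst x)
      + f (0, 0, 1) * cos (vert x))" for x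
  proof -
    have "wrap x = cos (2 * pi / Lx * fst x) *\<^sub>R (1, 0, 0) + (sin (2 * pi / Lx * fst x) *\<^sub>R (0, 1, 0)
        + cos (vert x) *\<^sub>R (0, 0, 1))"
      by (simp add: wrap_def)
    then show ?thesis by (simp only: add scaleR) (simp add: mult.commute)
  qed
  then have "M (\<lambda>x. complex_of_real (f (wrap x))) X
    = M (\<lambda>x. of_real (f (1, 0, 0)) * of_real (cos (2 * pi / Lx * fst x)) + (of_real (f (0, 1, 0)) * of_real (sin (2 * pi / Lx * fst x))
      + of_real (f (0, 0, 1)) * of_real (cos (vert x)))) X"
    by (simp only: of_real_add of_real_mult)
  also have "\<dots> = mulc (\<lambda>_. of_real (f (1, 0, 0))) (M (\<lambda>x. of_real (cos (2 * pi / Lx * fst x))) X)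
    + (mulc (\<lambda>_. of_real (f (0, 1, 0))) (M (\<lambda>x. of_real (sin (2 * pi / Lx * fst x))) X)
    + mulc (\<lambda>_. of_real (f (0, 0, 1))) (M (\<lambda>x. of_real (cos (vert x))) X))"
    by (subst M_add M_const_mult; (intro continuous_intros continuous_vert)?)+ (rule refl)
  finally show ?case
    using c1 c2 c3 by (simp add: cbas_null_def cin.add_left cin_mulc_const_left)
next
  case (const c)
  have "M (\<lambda>x. complex_of_real c) X = mulc (\<lambda>_. complex_of_real c) (M (\<lambda>x. 1) X)"
    using M_const_mult[of "\<lambda>x. 1" "of_real c" X] by simp
  moreover have "cin (M (\<lambda>x. 1) X) (E (cbas b n m)) = cin X (E (cbas b n m))" for n m
    using M_adjoint[of "\<lambda>_. 1" X "E (cbas b n m)"] M_E[of "\<lambda>_. 1" "cbas b n m"] C_infinity_continuous[OF C_infinity_cbas]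
    by simp
  ultimately show ?case using const by (simp add: cbas_null_def cin_mulc_const_left)
next
  case (add f g)
  have "M (\<lambda>x. complex_of_real (f (wrap x) + g (wrap x))) X
    = M (\<lambda>x. complex_of_real (f (wrap x))) X + M (\<lambda>x. complex_of_real (g (wrap x))) X"
    unfolding of_real_add by (rule M_add) (auto intro!: continuous_intros continuous_on_poly_wrap add)
  then show ?case using add by (simp add: cbas_null_def cin.add_left)
next
  case (mult f g)
  have "M (\<lambda>x. complex_of_real (f (wrap x) * g (wrap x))) X
    = M (\<lambda>x. complex_of_real (f (wrap x))) (M (\<lambda>x. complex_of_real (g (wrap x))) X)"
    unfolding of_real_mult by (rule M_mult) (auto intro!: continuous_intros continuous_on_poly_wrap mult)
  then show ?case using mult by simp
qed

lemma norm_M_le: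
  assumes "continuous_on UNIV c" "\<And>x. x \<in> \<Omega> \<Longrightarrow> norm (c x) \<le> B" "0 \<le> B"
  shows "norm (M c X) \<le> B * norm X"
  by (rule norm_mulc_le) (use assms in \<open>auto intro!: restr_bmeas_continuous simp: restr_def indicator_def\<close>)

text \<open>Stone-Weierstrass on the compact image of the closed cell under \<open>wrap\<close>: the
  error of a polynomial approximation enters only through its maximum there.\<close>

lemma cbas_null_continuous:
  assumes X: "cbas_null b X" and f: "continuous_on UNIV f"
  shows "cbas_null b (M (\<lambda>x. complex_of_real (f (wrap x))) X)"
  unfolding cbas_null_def
proof (intro allI)
  fix n m
  let ?b = "E (cbas b n m)"
  have cf: "continuous_on UNIV (\<lambda>x. complex_of_real (f (wrap x)))"
    by (intro continuous_intros continuous_on_compose2[OF f continuous_wrap]) auto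
  have K: "compact (wrap ` cbox (0, -H) (Lx, H))"
    by (intro compact_continuous_image continuous_wrap compact_cbox)
  have sub: "\<Omega> \<subseteq> cbox (0, -H) (Lx, H)" unfolding Omega_box by (rule box_subset_cbox)
  have bd: "norm (cin (M (\<lambda>x. complex_of_real (f (wrap x))) X) ?b) \<le> e * (2 * (norm X * norm ?b))" if e: "e > 0" for e
  proof -
    obtain Q where Q: "real_polynomial_function Q" "\<And>v. v \<in> wrap ` cbox (0, -H) (Lx, H) \<Longrightarrow> \<bar>f v - Q v\<bar> < e"
      using Stone_Weierstrass_real_polynomial_function[OF K continuous_on_subset[OF f] e] by auto
    have cq: "continuous_on UNIV (\<lambda>x. complex_of_real (Q (wrap x)))"
      by (rule continuous_on_of_real, rule continuous_on_poly_wrap, rule Q(1))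
    have "cin (M (\<lambda>x. complex_of_real (Q (wrap x))) X) ?b = 0"
      using cbas_null_poly[OF Q(1) X] by (simp add: cbas_null_def)
    moreover have "M (\<lambda>x. complex_of_real (f (wrap x))) X
      = M (\<lambda>x. complex_of_real (f (wrap x)) - complex_of_real (Q (wrap x))) X + M (\<lambda>x. complex_of_real (Q (wrap x))) X"
      by (subst M_add[symmetric, OF continuous_on_diff[OF cf cq] cq]) simp
    ultimately have "cin (M (\<lambda>x. complex_of_real (f (wrap x))) X) ?b
      = cin (M (\<lambda>x. complex_of_real (f (wrap x)) - complex_of_real (Q (wrap x))) X) ?b"
      by (simp only: cin.add_left add_0_right)
    also have "norm \<dots> \<le> 2 * (norm (M (\<lambda>x. complex_of_real (f (wrap x)) - complex_of_real (Q (wrap x))) X) * norm ?b)"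
      by (rule norm_cin_le)
    also have "\<dots> \<le> 2 * ((e * norm X) * norm ?b)"
    proof (intro mult_left_mono mult_right_mono norm_M_le)
      fix x assume "x \<in> \<Omega>"
      then have "\<bar>f (wrap x) - Q (wrap x)\<bar> < e" using sub by (intro Q) auto
      then show "norm (complex_of_real (f (wrap x)) - complex_of_real (Q (wrap x))) \<le> e"
        by (simp only: of_real_diff[symmetric] norm_of_real)
    qed (use e in \<open>simp_all add: continuous_on_diff[OF cf cq]\<close>)
    finally show ?thesis by (simp add: mult_ac)
  qed
  have "norm (cin (M (\<lambda>x. complex_of_real (f (wrap x))) X) ?b) \<le> 0"
  proof (rule field_le_epsilon)
    fix e :: real assume e: "e > 0"
    define B where "B = 2 * (norm X * norm ?b)"
    have B: "B \<ge> 0" by (simp add: B_def)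
    \<comment> \<open>The tolerance \<open>e / (B + 1)\<close> also covers
      \<open>B = 0\<close>.\<close>
    have "norm (cin (M (\<lambda>x. complex_of_real (f (wrap x))) X) ?b) \<le> e / (B + 1) * B"
      using bd[of "e / (B + 1)"] e B unfolding B_def[symmetric] by simp
    also have "\<dots> \<le> e" using e B by (simp add: field_simps)
    finally show "norm (cin (M (\<lambda>x. complex_of_real (f (wrap x))) X) ?b) \<le> 0 + e" by simp
  qed
  then show "cin (M (\<lambda>x. complex_of_real (f (wrap x))) X) ?b = 0" by simp
qed

text \<open>The lateral sides have the same image, so one of the points is taken in the open cell.
  Then the first coordinates differ by less than \<open>Lx\<close>, and equal angles force equality;
  vertically the cosine is injective from 0 to pi.\<close>

lemma wrap_inj:
  assumes x: "x \<in> \<Omega>" and y: "y \<in> cbox (0, -H) (Lx, H)" and eq: "wrap x = wrap y"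
  shows "x = y"
proof -
  have xb: "0 < fst x" "fst x < Lx" "-H < snd x" "snd x < H" using x by (auto simp: Omega_def)
  have yb: "0 \<le> fst y" "fst y \<le> Lx" "-H \<le> snd y" "snd y \<le> H"
    using y by (cases y; auto simp: cbox_Pair_eq)+
  obtain j :: int where e: "2 * pi / Lx * fst x = 2 * pi / Lx * fst y + 2 * pi * of_int j"
    using eq sin_cos_eq_iff[of "2 * pi / Lx * fst x" "2 * pi / Lx * fst y"] by (auto simp: wrap_def)
  have "fst x / Lx = (2 * pi / Lx * fst x) / (2 * pi)" by simp
  also have "\<dots> = fst y / Lx + of_int j" unfolding e by (simp add: add_divide_distrib)
  finally have j: "fst x / Lx = fst y / Lx + of_int j" .
  have "\<bar>fst x - fst y\<bar> < Lx" using xb yb by (simp add: abs_if)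
  then have "\<bar>fst x / Lx - fst y / Lx\<bar> < 1"
    using Lx by (simp add: abs_divide divide_less_eq flip: diff_divide_distrib)
  then have "\<bar>of_int j :: real\<bar> < 1" using j by simp
  then have "j = 0" by linarith
  then have 1: "fst x = fst y" using j Lx by simp
  have "vert x \<in> {0..pi}" "vert y \<in> {0..pi}"
    using vert_bounds[of x] vert_bounds[of y] xb yb by auto
  then have "vert x = vert y" using eq cos_inj_pi by (auto simp: wrap_def)
  then have "snd x = snd y" using H by (simp add: vert_def)
  with 1 show ?thesis by (simp add: prod_eq_iff)
qed

text \<open>Annihilation extends to products of \<open>g\<close> with continuous functions of
  \<open>wrap\<close>. Such functions converge to the indicator of any box in the cell, so
  \<open>g\<close> times a fixed exponential has integral zero over every box.\<close>

proposition cbas_complete: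
  assumes g: "g \<in> L2 \<Omega>" and z: "\<And>n m. cin (E g) (E (cbas b n m)) = 0"
  shows "E g = 0"
proof -
  let ?e = "\<lambda>x. cnj (cbas b 0 0 x)"
  note C = C_infinity_continuous[OF C_infinity_cbas]
  have gi: "integrable (lebesgue_on \<Omega>) (\<lambda>x. g x * ?e x)"
    by (rule integrable_mult_cnj[OF _ g]) (simp_all add: C)
  have "AE x in lebesgue_on (box (0, -H) (Lx, H)). g x * ?e x = 0"
  proof (rule AE_zero_on_box)
    show "integrable (lebesgue_on (box (0, - H) (Lx, H))) (\<lambda>x. g x * ?e x)"
      using gi by (simp add: Omega_box)
    fix p q :: "real \<times> real" assume sub: "box p q \<subseteq> box (0, - H) (Lx, H)"
    \<comment> \<open>For \<open>x\<close> in the cell the distance of \<open>wrap x\<close> from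
      \<open>K\<close> vanishes exactly outside the box; measuring it after wrapping makes the
      cut-offs \<open>f k\<close> below functions of \<open>wrap\<close>.\<close>
    define K where "K = wrap ` (cbox (0, -H) (Lx, H) - box p q)"
    have K: "compact K" unfolding K_def
      by (intro compact_continuous_image continuous_wrap compact_diff compact_cbox open_box)
    \<comment> \<open>A corner of the closed cell lies outside the open box, so that
      \<open>infdist\<close> is not the default value 0 of an empty set.\<close>
    have "(0, -H) \<in> cbox (0, -H) (Lx, H) - box p q"
      using sub Lx H by (auto simp: cbox_Pair_eq mem_box_pair subset_iff)
    then have Kne: "K \<noteq> {}" unfolding K_def by blast
    have inf0: "infdist (wrap x) K = 0 \<longleftrightarrow> x \<notin> box p q" if x: "x \<in> \<Omega>" for x
    proof -
      have "infdist (wrap x) K = 0 \<longleftrightarrow> wrap x \<in> K"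
        using in_closed_iff_infdist_zero[OF compact_imp_closed[OF K] Kne] by simp
      also have "\<dots> \<longleftrightarrow> x \<notin> box p q"
      proof
        assume "wrap x \<in> K"
        then obtain y where "y \<in> cbox (0, -H) (Lx, H) - box p q" "wrap x = wrap y"
          unfolding K_def by blast
        then show "x \<notin> box p q" using wrap_inj[OF x] by blast
      next
        assume "x \<notin> box p q"
        then show "wrap x \<in> K" unfolding K_def using x box_subset_cbox by (fastforce simp: Omega_box)
      qed
      finally show ?thesis .
    qed
    define f where "f k v = min 1 (real k * infdist v K)" for k :: nat and v
    have f: "continuous_on UNIV (f k)" for k
      unfolding f_def [abs_def] by (intro continuous_intros)
    have cf: "continuous_on UNIV (\<lambda>x. complex_of_real (f k (wrap x)))" for k
      by (intro continuous_intros continuous_on_compose2[OF f continuous_wrap]) auto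
    have null: "cbas_null b (E g)" using z by (simp add: cbas_null_def)
    have "(\<integral>x. (complex_of_real (f k (wrap x)) * g x) * ?e x \<partial>lebesgue_on \<Omega>) = 0" for k
    proof -
      have "cin (E (\<lambda>x. complex_of_real (f k (wrap x)) * g x)) (E (cbas b 0 0)) = 0"
        using cbas_null_continuous[OF null f] unfolding cbas_null_def by (subst E_mult[OF cf g]) blast
      moreover have "(\<lambda>x. complex_of_real (f k (wrap x)) * g x) \<in> L2 \<Omega>"
        by (intro L2_mult(1)[OF Omega_sets(1) restr_bmeas_continuous] cf g) auto
      ultimately show ?thesis using C by (simp add: cin_toL)
    qed
    moreover have "(\<lambda>k. \<integral>x. (complex_of_real (f k (wrap x)) * g x) * ?e x \<partial>lebesgue_on \<Omega>)
      \<longlonglongrightarrow> (\<integral>x. indicator (box p q) x * (g x * ?e x) \<partial>lebesgue_on \<Omega>)"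
    proof (rule integral_dominated_convergence[where w = "\<lambda>x. norm (g x * ?e x)"])
      show "integrable (lebesgue_on \<Omega>) (\<lambda>x. norm (g x * ?e x))" using gi by (rule integrable_norm)
      have gm: "(\<lambda>x. g x * ?e x) \<in> borel_measurable (lebesgue_on \<Omega>)" using gi by auto
      then show "(\<lambda>x. indicator (box p q) x * (g x * ?e x)) \<in> borel_measurable (lebesgue_on \<Omega>)"
        using sub by (intro borel_measurable_times[OF borel_measurable_indicator])
          (simp_all add: sets_restrict_space_iff Omega_box)
      have "(\<lambda>x. complex_of_real (f k (wrap x)) * (g x * ?e x)) \<in> borel_measurable (lebesgue_on \<Omega>)" for k
        by (intro borel_measurable_times gm continuous_imp_measurable_on_sets_lebesgue continuous_on_subset[OF cf]) auto
      then show "(\<lambda>x. (complex_of_real (f k (wrap x)) * g x) * ?e x) \<in> borel_measurable (lebesgue_on \<Omega>)" for k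
        by (simp only: mult.assoc)
      have b: "\<bar>f k v\<bar> \<le> 1" for k v by (auto simp: f_def infdist_nonneg)
      show "AE x in lebesgue_on \<Omega>. norm ((complex_of_real (f k (wrap x)) * g x) * ?e x) \<le> norm (g x * ?e x)" for k
        using b by (intro AE_I2) (simp add: norm_mult mult_left_le_one_le mult.assoc)
      show "AE x in lebesgue_on \<Omega>. (\<lambda>k. (complex_of_real (f k (wrap x)) * g x) * ?e x) \<longlonglongrightarrow> indicator (box p q) x * (g x * ?e x)"
      proof (rule AE_I2)
        fix x assume "x \<in> space (lebesgue_on \<Omega>)"
        then have x: "x \<in> \<Omega>" by simp
        have "(\<lambda>k. f k (wrap x)) \<longlonglongrightarrow> indicator (box p q) x"
        proof (cases "x \<in> box p q")
          case True
          then have d: "infdist (wrap x) K > 0" using inf0[OF x] infdist_nonneg[of "wrap x" K] by linarith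
          obtain k0 :: nat where k0: "real k0 * infdist (wrap x) K > 1" using reals_Archimedean3[OF d] by blast
          have "f k (wrap x) = 1" if "k \<ge> k0" for k
          proof -
            have "real k0 * infdist (wrap x) K \<le> real k * infdist (wrap x) K"
              using that d by (intro mult_right_mono) auto
            then show ?thesis using k0 by (simp add: f_def)
          qed
          then have "\<forall>\<^sub>F k in sequentially. f k (wrap x) = 1" by (rule eventually_sequentiallyI)
          then show ?thesis using True by (simp add: tendsto_eventually)
        next
          case False
          then show ?thesis using inf0[OF x] by (simp add: f_def)
        qed
        then have "(\<lambda>k. complex_of_real (f k (wrap x))) \<longlonglongrightarrow> complex_of_real (indicator (box p q) x)"
          by (rule tendsto_of_real)
        then have "(\<lambda>k. complex_of_real (f k (wrap x)) * (g x * ?e x)) \<longlonglongrightarrow> complex_of_real (indicator (box p q) x) * (g x * ?e x)"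
          by (intro tendsto_mult tendsto_const)
        then show "(\<lambda>k. (complex_of_real (f k (wrap x)) * g x) * ?e x) \<longlonglongrightarrow> indicator (box p q) x * (g x * ?e x)"
          by (simp only: of_real_indicator mult.assoc)
      qed
    qed
    ultimately have "(\<integral>x. indicator (box p q) x * (g x * ?e x) \<partial>lebesgue_on \<Omega>) = 0"
      by (simp add: LIMSEQ_const_iff)
    also have "(\<integral>x. indicator (box p q) x * (g x * ?e x) \<partial>lebesgue_on \<Omega>) = (LINT x:box p q|lebesgue. g x * ?e x)"
      unfolding set_lebesgue_integral_def
      by (subst integral_restrict_space)
        (use sub in \<open>auto simp: Omega_box set_lebesgue_integral_def indicator_def intro!: Bochner_Integration.integral_cong\<close>)
    finally show "(LINT x:box p q|lebesgue. g x * ?e x) = 0" .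
  qed
  \<comment> \<open>\<open>cbas b 0 0\<close> is an exponential of modulus one and cancels.\<close>
  then have "AE x in lebesgue_on \<Omega>. g x = 0"
    unfolding Omega_box by eventually_elim (simp add: cbas_def hexp_def)
  then have "E g = E (\<lambda>x. 0)" using g by (subst toL_eq_iff) (auto simp: L2_zero)
  then show ?thesis by (simp add: toL_zero)
qed

end

subsection \<open>Sobolev functions and their traces\<close>

lemma closure_image_eq:
  fixes f g :: "'a::topological_space \<Rightarrow> 'b::t2_space"
  assumes "continuous_on UNIV f" "continuous_on UNIV g" "\<And>x. x \<in> A \<Longrightarrow> f x = g x" "y \<in> closure A"
  shows "f y = g y"
proof -
  have "closure A \<subseteq> {x. f x = g x}"
    by (rule closure_minimal) (use assms in \<open>auto intro: closed_Collect_eq\<close>)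
  then show ?thesis using assms(4) by auto
qed

lemma closure_image_eq2:
  fixes f g :: "'a::topological_space \<Rightarrow> 'a \<Rightarrow> 'b::t2_space"
  assumes "continuous_on UNIV (\<lambda>z. f (fst z) (snd z))" "continuous_on UNIV (\<lambda>z. g (fst z) (snd z))"
    and "\<And>x y. x \<in> A \<Longrightarrow> y \<in> A \<Longrightarrow> f x y = g x y" "x \<in> closure A" "y \<in> closure A"
  shows "f x y = g x y"
proof -
  have "(x, y) \<in> closure (A \<times> A)" using assms(4,5) by (simp add: closure_Times)
  from closure_image_eq[OF assms(1,2) _ this] assms(3) show ?thesis by auto
qed

lemma continuous_on_cin [continuous_intros]:
  "continuous_on S f \<Longrightarrow> continuous_on S g \<Longrightarrow> continuous_on S (\<lambda>x. cin (f x) (g x))"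
  by (rule cin.continuous_on)

lemma continuous_on_mulc [continuous_intros]:
  "continuous_on S f \<Longrightarrow> continuous_on S (\<lambda>x. mulc c (f x))"
  by (rule bounded_linear.continuous_on[OF bounded_linear_mulc])

type_synonym jet = "(real \<times> real) lsq \<times> (real \<times> real) lsq \<times> (real \<times> real) lsq"

context cell
begin

text \<open>Its norm in the product space is the H1 norm, so H1 convergence of smooth functions is
  convergence of jets.\<close>

definition jet :: "(real \<times> real \<Rightarrow> complex) \<Rightarrow> jet" where
  "jet w = (E w, E (partial (1, 0) w), E (partial (0, 1) w))"

definition tr :: "(real \<times> real \<Rightarrow> complex) \<Rightarrow> real lsq \<times> real lsq" where
  "tr w = (EG (\<lambda>t. w (t, H)), EG (\<lambda>t. w (t, -H)))"

text \<open>A pair in the closure of these graphs consists of a limit jet and its traces; no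
  extended trace operator has to be constructed.\<close>

definition graph :: "(real \<times> real \<Rightarrow> complex) \<Rightarrow> jet \<times> (real lsq \<times> real lsq)" where
  "graph w = (jet w, tr w)"

definition wjet :: "(real \<times> real \<Rightarrow> complex) \<Rightarrow> jet" where
  "wjet v = (E v, E (weak_partial \<Omega> (1, 0) v), E (weak_partial \<Omega> (0, 1) v))"

lemma smooth_L2 [simp]:
  assumes "C_infinity w"
  shows "w \<in> L2 \<Omega>" "partial (1, 0) w \<in> L2 \<Omega>" "partial (0, 1) w \<in> L2 \<Omega>" "(\<lambda>t. w (t, h)) \<in> L2 \<Gamma>"
  using assms by (auto intro!: continuous_L2_Omega continuous_L2_Gamma C_infinity_continuous C_infinity_partial continuous_trace)

lemma
  assumes "C_infinity v" "C_infinity w"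
  shows graph_add: "graph (\<lambda>x. v x + w x) = graph v + graph w"
    and graph_diff: "graph (\<lambda>x. v x - w x) = graph v - graph w"
    and graph_scaleR: "graph (\<lambda>x. r *\<^sub>R v x) = r *\<^sub>R graph v"
proof -
  have "partial b (\<lambda>x. v x + w x) = (\<lambda>x. partial b v x + partial b w x)"
    "partial b (\<lambda>x. v x - w x) = (\<lambda>x. partial b v x - partial b w x)"
    "partial b (\<lambda>x. r *\<^sub>R v x) = (\<lambda>x. r *\<^sub>R partial b v x)" for b
    by (rule ext, simp only: partial_add partial_diff partial_linear[OF bounded_linear_scaleR_right] assms)+
  then show "graph (\<lambda>x. v x + w x) = graph v + graph w" "graph (\<lambda>x. v x - w x) = graph v - graph w"
    "graph (\<lambda>x. r *\<^sub>R v x) = r *\<^sub>R graph v"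
    using assms by (simp_all add: graph_def jet_def tr_def toL_add toL_diff toL_scaleR)
qed

lemma C_infinity_H1:
  assumes "C_infinity w"
  shows "w \<in> H1 \<Omega>" "wjet w = jet w"
proof -
  have w: "is_weak_partial \<Omega> (1, 0) w (partial (1, 0) w)" "is_weak_partial \<Omega> (0, 1) w (partial (0, 1) w)"
    using weak_partial_smooth[OF assms] by auto
  then show "w \<in> H1 \<Omega>" unfolding H1_def using assms by auto
  have "is_weak_partial \<Omega> (1, 0) w (weak_partial \<Omega> (1, 0) w)" "is_weak_partial \<Omega> (0, 1) w (weak_partial \<Omega> (0, 1) w)"
    unfolding weak_partial_def
    by (rule someI[of "is_weak_partial \<Omega> (1, 0) w"], rule w(1), rule someI[of "is_weak_partial \<Omega> (0, 1) w"], rule w(2))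
  then show "wjet w = jet w"
    unfolding wjet_def jet_def
    using weak_partial_unique[OF smooth_L2(1)[OF assms] _ w(1)] weak_partial_unique[OF smooth_L2(1)[OF assms] _ w(2)]
    by blast
qed

lemma H1_weak_partial:
  assumes "v \<in> H1 \<Omega>"
  shows "v \<in> L2 \<Omega>" "is_weak_partial \<Omega> (1, 0) v (weak_partial \<Omega> (1, 0) v)" "is_weak_partial \<Omega> (0, 1) v (weak_partial \<Omega> (0, 1) v)"
    "weak_partial \<Omega> (1, 0) v \<in> L2 \<Omega>" "weak_partial \<Omega> (0, 1) v \<in> L2 \<Omega>"
proof -
  obtain g h where g: "is_weak_partial \<Omega> (1, 0) v g" "is_weak_partial \<Omega> (0, 1) v h"
    using assms unfolding H1_def by blast
  show "v \<in> L2 \<Omega>" using assms by (simp add: H1_def)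
  show 1: "is_weak_partial \<Omega> (1, 0) v (weak_partial \<Omega> (1, 0) v)"
    unfolding weak_partial_def by (rule someI[of "is_weak_partial \<Omega> (1, 0) v"]) (rule g(1))
  show 2: "is_weak_partial \<Omega> (0, 1) v (weak_partial \<Omega> (0, 1) v)"
    unfolding weak_partial_def by (rule someI[of "is_weak_partial \<Omega> (0, 1) v"]) (rule g(2))
  show "weak_partial \<Omega> (1, 0) v \<in> L2 \<Omega>" "weak_partial \<Omega> (0, 1) v \<in> L2 \<Omega>"
    using 1 2 by (auto simp: is_weak_partial_def)
qed

lemma H1_dist_eq:
  assumes "v \<in> H1 \<Omega>" "w \<in> H1 \<Omega>"
  shows "H1_dist \<Omega> v w = norm (wjet v - wjet w)"
proof -
  note v = H1_weak_partial[OF assms(1)] and w = H1_weak_partial[OF assms(2)]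
  have "L2_dist \<Omega> v w = norm (E v - E w)"
    "L2_dist \<Omega> (weak_partial \<Omega> (1, 0) v) (weak_partial \<Omega> (1, 0) w) = norm (E (weak_partial \<Omega> (1, 0) v) - E (weak_partial \<Omega> (1, 0) w))"
    "L2_dist \<Omega> (weak_partial \<Omega> (0, 1) v) (weak_partial \<Omega> (0, 1) w) = norm (E (weak_partial \<Omega> (0, 1) v) - E (weak_partial \<Omega> (0, 1) w))"
    by (intro L2_dist_eq Omega_sets v w)+
  then show ?thesis unfolding H1_dist_def wjet_def by (simp add: norm_Pair add.assoc)
qed

lemma norm_jet_components:
  fixes X :: jet
  shows "norm (fst X) \<le> norm X" "norm (fst (snd X)) \<le> norm X" "norm (snd (snd X)) \<le> norm X"
proof -
  obtain x y z where X: "X = (x, y, z)" using prod_cases3 by blast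
  have "norm (y, z) \<le> norm X" unfolding X by (rule norm_snd_le)
  then show "norm (fst X) \<le> norm X" "norm (fst (snd X)) \<le> norm X" "norm (snd (snd X)) \<le> norm X"
    using norm_fst_le[of x "(y, z)"] norm_fst_le[of y z] norm_snd_le[of z y] unfolding X by simp_all
qed

text \<open>Green's formula in the normal direction with \<open>f = g = w\<close> and the affine
  weight that is 1 on the edge at height \<open>s * H\<close> and 0 on the other. Its slope is
  \<open>1 / (2 * H)\<close> in absolute value and it is bounded by 1 on the cell; with the factor 2
  of \<open>norm_cin_le\<close> this gives \<open>1 / H\<close> and 2 + 2.\<close>

lemma trace_bound_aux:
  assumes w: "C_infinity w" and s: "s = 1 \<or> s = -1"
  shows "norm (EG (\<lambda>t. w (t, s * H))) \<le> sqrt (1 / H + 4) * norm (jet w)"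
proof -
  define c where "c x = complex_of_real ((1 + s * (snd x / H)) / 2)" for x :: "real \<times> real"
  have cs: "C_infinity c"
  proof -
    have "c = (\<lambda>x. complex_of_real ((s / (2 * H)) *\<^sub>R (snd x + s * H)))"
      using H s by (auto simp: c_def field_simps intro!: ext)
    then show ?thesis by (simp only:) (intro C_infinity_of_real C_infinity_scaleR C_infinity_snd_add)
  qed
  have c2: "partial (0, 1) c x = complex_of_real (s / (2 * H))" for x
  proof -
    have "(c has_derivative (\<lambda>h. complex_of_real (s * (snd h / H) / 2))) (at x)"
      unfolding c_def using H by (auto intro!: derivative_eq_intros simp: mult.commute)
    from partial_eq[OF this] show ?thesis by simp
  qed
  note C = C_infinity_continuous C_infinity_partial cs w
  define e where "e = norm (jet w)"
  have n: "norm (E w) \<le> e" "norm (E (partial (0, 1) w)) \<le> e"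
    using norm_jet_components[of "jet w"] by (auto simp: jet_def e_def)
  have e0: "e \<ge> 0" by (simp add: e_def)
  have cb: "norm (c x) \<le> 1" if "x \<in> \<Omega>" for x
  proof -
    have "-1 \<le> snd x / H" "snd x / H \<le> 1" using that H by (auto simp: Omega_def field_simps)
    then have "\<bar>(1 + s * (snd x / H)) / 2\<bar> \<le> 1" using s by (auto simp: abs_le_iff)
    then show ?thesis unfolding c_def by (simp only: norm_of_real)
  qed
  let ?s1 = "cin (M (partial (0, 1) c) (E w)) (E w)"
  let ?s2 = "cin (M c (E (partial (0, 1) w))) (E w)"
  let ?s3 = "cin (M c (E w)) (E (partial (0, 1) w))"
  have M1: "norm (M (partial (0, 1) c) (E w)) \<le> 1 / (2 * H) * e"
  proof -
    have "norm (M (partial (0, 1) c) (E w)) \<le> 1 / (2 * H) * norm (E w)"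
      by (rule norm_M_le) (use C H s in \<open>auto simp: c2 norm_divide\<close>)
    also have "\<dots> \<le> 1 / (2 * H) * e" using n H by (intro mult_left_mono) auto
    finally show ?thesis .
  qed
  have M2: "norm (M c X) \<le> 1 * norm X" for X
    by (rule norm_M_le) (use C cb in auto)
  have b1: "norm ?s1 \<le> 2 * ((1 / (2 * H) * e) * e)"
    by (rule order_trans[OF norm_cin_le]) (intro mult_left_mono mult_mono M1 n; use e0 H in simp)
  have b2: "norm ?s2 \<le> 2 * (e * e)"
    by (rule order_trans[OF norm_cin_le]) (intro mult_left_mono mult_mono n order_trans[OF M2]; use e0 n in simp)
  have b3: "norm ?s3 \<le> 2 * (e * e)"
    by (rule order_trans[OF norm_cin_le]) (intro mult_left_mono mult_mono n order_trans[OF M2]; use e0 n in simp)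
  have "norm (?s1 + ?s2 + ?s3) \<le> 2 * ((1 / (2 * H) * e) * e) + 2 * (e * e) + 2 * (e * e)"
    by (intro order_trans[OF norm_triangle_ineq] add_mono b1 b2 b3)
  also have "\<dots> = (sqrt (1 / H + 4) * e)\<^sup>2"
    using H by (simp add: power_mult_distrib field_simps power2_eq_square)
  finally have b: "norm (?s1 + ?s2 + ?s3) \<le> (sqrt (1 / H + 4) * e)\<^sup>2" .
  have "norm (?s1 + ?s2 + ?s3) = (norm (EG (\<lambda>t. w (t, s * H))))\<^sup>2"
  proof -
    have k: "cin (N (\<lambda>t. c (t, h)) (EG (\<lambda>t. w (t, h)))) (EG (\<lambda>t. w (t, h))) = of_real ((1 + s * (h / H)) / 2 * (norm (EG (\<lambda>t. w (t, h))))\<^sup>2)" for h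
    proof -
      have "N (\<lambda>t. c (t, h)) (EG (\<lambda>t. w (t, h))) = mulc (\<lambda>_. of_real ((1 + s * (h / H)) / 2)) (EG (\<lambda>t. w (t, h)))"
        using w by (subst EG_mult[symmetric]) (auto simp: c_def toL_const_mult simp del: of_real_divide of_real_add)
      then show ?thesis by (simp add: cin_mulc_const_left cin_self)
    qed
    show ?thesis
      unfolding smooth_green2[OF cs w w] k using s H by (auto simp: norm_power simp del: of_real_power)
  qed
  then have "(norm (EG (\<lambda>t. w (t, s * H))))\<^sup>2 \<le> (sqrt (1 / H + 4) * e)\<^sup>2" using b by simp
  then show ?thesis unfolding e_def by (rule power2_le_imp_le) (use H in simp)
qed

lemma trace_bound:
  assumes w: "C_infinity w" and "h = H \<or> h = -H"
  shows "norm (EG (\<lambda>t. w (t, h))) \<le> sqrt (1 / H + 4) * norm (jet w)"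
  using trace_bound_aux[OF w, of 1] trace_bound_aux[OF w, of "-1"] assms(2) by auto

lemma jet_diff: "C_infinity v \<Longrightarrow> C_infinity w \<Longrightarrow> jet (\<lambda>x. v x - w x) = jet v - jet w"
  using graph_diff[of v w] by (simp add: graph_def)

text \<open>The identities that define weak derivatives hold for smooth functions and are preserved
  by limits of jets.\<close>

lemma H1_if_limit:
  assumes "v \<in> L2 \<Omega>" "g1 \<in> L2 \<Omega>" "g2 \<in> L2 \<Omega>"
    and "(E v, E g1, E g2) \<in> closure (jet ` {w. C_infinity w})"
  shows "v \<in> H1 \<Omega>" "wjet v = (E v, E g1, E g2)"
proof -
  have c: "cin (E v) (E (\<lambda>x. cnj (partial (1, 0) \<phi> x))) = - cin (E g1) (E (\<lambda>x. cnj (\<phi> x)))"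
    "cin (E v) (E (\<lambda>x. cnj (partial (0, 1) \<phi> x))) = - cin (E g2) (E (\<lambda>x. cnj (\<phi> x)))"
    if \<phi>: "\<phi> \<in> test_functions \<Omega>" for \<phi>
  proof -
    have 1: "cin (fst X) (E (\<lambda>x. cnj (partial (1, 0) \<phi> x))) = - cin (fst (snd X)) (E (\<lambda>x. cnj (\<phi> x)))"
      "cin (fst X) (E (\<lambda>x. cnj (partial (0, 1) \<phi> x))) = - cin (snd (snd X)) (E (\<lambda>x. cnj (\<phi> x)))"
      if X: "X \<in> jet ` {w. C_infinity w}" for X
    proof -
      obtain w where w: "C_infinity w" "X = jet w" using X by blast
      show "cin (fst X) (E (\<lambda>x. cnj (partial (1, 0) \<phi> x))) = - cin (fst (snd X)) (E (\<lambda>x. cnj (\<phi> x)))"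
        "cin (fst X) (E (\<lambda>x. cnj (partial (0, 1) \<phi> x))) = - cin (snd (snd X)) (E (\<lambda>x. cnj (\<phi> x)))"
        using weak_partial_smooth[OF w(1), of "(1,0)"] weak_partial_smooth[OF w(1), of "(0,1)"] \<phi> w
          is_weak_partial_iff_cin[of w "partial (1, 0) w" "(1, 0)"] is_weak_partial_iff_cin[of w "partial (0, 1) w" "(0, 1)"]
        by (auto simp: jet_def)
    qed
    have "cin (fst (E v, E g1, E g2)) (E (\<lambda>x. cnj (partial (1, 0) \<phi> x))) = - cin (fst (snd (E v, E g1, E g2))) (E (\<lambda>x. cnj (\<phi> x)))"
      by (rule closure_image_eq[OF _ _ 1(1) assms(4)]) (intro continuous_intros; assumption)+
    then show "cin (E v) (E (\<lambda>x. cnj (partial (1, 0) \<phi> x))) = - cin (E g1) (E (\<lambda>x. cnj (\<phi> x)))" by simp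
    have "cin (fst (E v, E g1, E g2)) (E (\<lambda>x. cnj (partial (0, 1) \<phi> x))) = - cin (snd (snd (E v, E g1, E g2))) (E (\<lambda>x. cnj (\<phi> x)))"
      by (rule closure_image_eq[OF _ _ 1(2) assms(4)]) (intro continuous_intros; assumption)+
    then show "cin (E v) (E (\<lambda>x. cnj (partial (0, 1) \<phi> x))) = - cin (E g2) (E (\<lambda>x. cnj (\<phi> x)))" by simp
  qed
  have w: "is_weak_partial \<Omega> (1, 0) v g1" "is_weak_partial \<Omega> (0, 1) v g2"
    using c is_weak_partial_iff_cin[OF assms(1,2), of "(1,0)"] is_weak_partial_iff_cin[OF assms(1,3), of "(0,1)"] by auto
  then show v: "v \<in> H1 \<Omega>" using assms(1) unfolding H1_def by auto
  show "wjet v = (E v, E g1, E g2)"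
    unfolding wjet_def
    using weak_partial_unique[OF assms(1) H1_weak_partial(2)[OF v] w(1)] weak_partial_unique[OF assms(1) H1_weak_partial(3)[OF v] w(2)]
    by simp
qed

text \<open>The trace estimate applied to the difference of the two sequences, whose jets tend to
  zero.\<close>

lemma trace_limit_unique:
  assumes v: "\<And>j. C_infinity (v j)" "(\<lambda>j. jet (v j)) \<longlonglongrightarrow> X" "(\<lambda>j. EG (\<lambda>t. v j (t, h))) \<longlonglongrightarrow> S"
    and w: "\<And>j. C_infinity (w j)" "(\<lambda>j. jet (w j)) \<longlonglongrightarrow> X" "(\<lambda>j. EG (\<lambda>t. w j (t, h))) \<longlonglongrightarrow> T"
    and h: "h = H \<or> h = -H"
  shows "S = T"
proof -
  have "(\<lambda>j. jet (v j) - jet (w j)) \<longlonglongrightarrow> X - X" by (intro tendsto_diff v w)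
  then have c: "(\<lambda>j. sqrt (1 / H + 4) * norm (jet (v j) - jet (w j))) \<longlonglongrightarrow> 0"
    by (intro tendsto_mult_right_zero tendsto_norm_zero) simp
  have b: "norm (EG (\<lambda>t. v j (t, h)) - EG (\<lambda>t. w j (t, h))) \<le> sqrt (1 / H + 4) * norm (jet (v j) - jet (w j))" for j
    using trace_bound[OF C_infinity_diff[OF v(1) w(1)] h, of j j] v(1) w(1) by (simp add: jet_diff toL_diff)
  have "(\<lambda>j. EG (\<lambda>t. v j (t, h)) - EG (\<lambda>t. w j (t, h))) \<longlonglongrightarrow> 0"
    by (rule Lim_null_comparison[OF always_eventually[OF allI[OF b]] c])
  moreover have "(\<lambda>j. EG (\<lambda>t. v j (t, h)) - EG (\<lambda>t. w j (t, h))) \<longlonglongrightarrow> S - T" by (intro tendsto_diff v w)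
  ultimately show "S = T" using LIMSEQ_unique[of _ 0 "S - T"] by fastforce
qed

text \<open>\<open>bd_trace\<close> chooses a trace along an unknown sequence of smooth functions.
  Since trace limits depend only on the limit of the jets, its class can be read off from any
  element of the closed graph over \<open>wjet u\<close>.\<close>

lemma bd_trace_eq:
  assumes u: "u \<in> H1 \<Omega>" and g: "(wjet u, T) \<in> closure (graph ` {w. C_infinity w})"
  shows "bd_trace Lx H H u \<in> L2 \<Gamma>" "EG (bd_trace Lx H H u) = fst T"
    "bd_trace Lx H (-H) u \<in> L2 \<Gamma>" "EG (bd_trace Lx H (-H) u) = snd T"
proof -
  obtain z where z: "\<And>n. z n \<in> graph ` {w. C_infinity w}" "z \<longlonglongrightarrow> (wjet u, T)"
    using g unfolding closure_sequential by blast
  from z(1) have "\<exists>w. C_infinity w \<and> z n = graph w" for n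
    using imageE[OF z(1)[of n]] by blast
  then obtain w where w: "\<And>n. C_infinity (w n)" "\<And>n. z n = graph (w n)"
    by metis
  have z': "(\<lambda>n. graph (w n)) \<longlonglongrightarrow> (wjet u, T)" using z(2) unfolding w(2) [abs_def, symmetric] by simp
  have lim: "(\<lambda>n. jet (w n)) \<longlonglongrightarrow> wjet u"
    "(\<lambda>n. EG (\<lambda>t. w n (t, H))) \<longlonglongrightarrow> fst T" "(\<lambda>n. EG (\<lambda>t. w n (t, -H))) \<longlonglongrightarrow> snd T"
    using tendsto_fst[OF z'] tendsto_fst[OF tendsto_snd[OF z']] tendsto_snd[OF tendsto_snd[OF z']]
    by (simp_all add: graph_def tr_def)
  have dist: "(\<lambda>j. H1_dist \<Omega> (v j) u) \<longlonglongrightarrow> 0 \<longleftrightarrow> (\<lambda>j. jet (v j)) \<longlonglongrightarrow> wjet u" if "\<And>j. C_infinity (v j)" for v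
    using that u by (simp add: H1_dist_eq C_infinity_H1 tendsto_norm_zero_iff LIM_zero_iff)
  have main: "bd_trace Lx H h u \<in> L2 \<Gamma> \<and> EG (bd_trace Lx H h u) = S"
    if h: "h = H \<or> h = -H" and S: "(\<lambda>n. EG (\<lambda>t. w n (t, h))) \<longlonglongrightarrow> S" for h S
  proof -
    have dt: "(\<lambda>j. L2_dist \<Gamma> (\<lambda>t. v j (t, h)) f) \<longlonglongrightarrow> 0 \<longleftrightarrow> (\<lambda>j. EG (\<lambda>t. v j (t, h))) \<longlonglongrightarrow> EG f"
      if "\<And>j. C_infinity (v j)" "f \<in> L2 \<Gamma>" for v f
      using that by (simp add: L2_dist_eq tendsto_norm_zero_iff LIM_zero_iff)
    \<comment> \<open>The limit class needs a function representing it before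
      \<open>is_trace\<close> is known to be inhabited and the choice meaningful.\<close>
    have "S \<in> EG ` L2 \<Gamma>"
      by (rule closed_sequentially[OF closed_range_toL _ S]) (use w in auto)
    then obtain f where f: "f \<in> L2 \<Gamma>" "S = EG f" by auto
    have "is_trace Lx H h u f"
      unfolding is_trace_def
      using u f S w lim dist[of w, OF w(1)] dt[of w, OF w(1) f(1)] by blast
    then have "is_trace Lx H h u (bd_trace Lx H h u)"
      unfolding bd_trace_def by (rule someI[of "is_trace Lx H h u"])
    then obtain v where g: "bd_trace Lx H h u \<in> L2 \<Gamma>" and v: "\<And>j. C_infinity (v j)"
      "(\<lambda>j. H1_dist \<Omega> (v j) u) \<longlonglongrightarrow> 0" "(\<lambda>j. L2_dist \<Gamma> (\<lambda>t. v j (t, h)) (bd_trace Lx H h u)) \<longlonglongrightarrow> 0"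
      unfolding is_trace_def by blast
    have "EG (bd_trace Lx H h u) = S"
    proof (rule trace_limit_unique)
      show "(\<lambda>j. jet (v j)) \<longlonglongrightarrow> wjet u" using dist[of v, OF v(1)] v(2) by blast
      show "(\<lambda>j. EG (\<lambda>t. v j (t, h))) \<longlonglongrightarrow> EG (bd_trace Lx H h u)" using dt[of v, OF v(1) g] v(3) by blast
    qed (use v w lim S h in auto)
    with g show ?thesis by blast
  qed
  show "bd_trace Lx H H u \<in> L2 \<Gamma>" "EG (bd_trace Lx H H u) = fst T"
    "bd_trace Lx H (-H) u \<in> L2 \<Gamma>" "EG (bd_trace Lx H (-H) u) = snd T"
    using main[of H, OF _ lim(2)] main[of "-H", OF _ lim(3)] by auto
qed

lemma green2_closure:
  assumes c: "C_infinity c" and P: "P \<in> closure (graph ` {w. C_infinity w})" and Q: "Q \<in> closure (graph ` {w. C_infinity w})"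
  shows "cin (M (partial (0, 1) c) (fst (fst P))) (fst (fst Q)) + cin (M c (snd (snd (fst P)))) (fst (fst Q))
      + cin (M c (fst (fst P))) (snd (snd (fst Q)))
    = cin (N (\<lambda>t. c (t, H)) (fst (snd P))) (fst (snd Q)) - cin (N (\<lambda>t. c (t, -H)) (snd (snd P))) (snd (snd Q))"
proof (rule closure_image_eq2[OF _ _ _ P Q])
  fix P Q assume "P \<in> graph ` {w. C_infinity w}" "Q \<in> graph ` {w. C_infinity w}"
  then obtain v w where "C_infinity v" "P = graph v" "C_infinity w" "Q = graph w" by blast
  then show "cin (M (partial (0, 1) c) (fst (fst P))) (fst (fst Q)) + cin (M c (snd (snd (fst P)))) (fst (fst Q))
      + cin (M c (fst (fst P))) (snd (snd (fst Q)))
    = cin (N (\<lambda>t. c (t, H)) (fst (snd P))) (fst (snd Q)) - cin (N (\<lambda>t. c (t, -H)) (snd (snd P))) (snd (snd Q))"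
    using smooth_green2[OF c, of v w] by (simp add: graph_def jet_def tr_def)
qed (intro continuous_intros)+

end

subsection \<open>Quasi-periodic functions\<close>

text \<open>Any point common to the closed convex hulls of all tails will do: if
  \<open>l (Z k)\<close> converges to \<open>L\<close>, the preimage of a small ball about
  \<open>L\<close> is closed and convex and contains a tail. Only functionals with a known limit
  along \<open>Z\<close> are considered, so no subsequence is taken.\<close>

lemma weak_limit_exists:
  fixes Z :: "nat \<Rightarrow> 'a::{real_inner, complete_space}"
  assumes Z: "\<And>k. Z k \<in> K" "\<And>k. norm (Z k) \<le> B" and K: "convex K" "closed K"
  obtains \<zeta> where "\<zeta> \<in> K"
    "\<And>(l :: 'a \<Rightarrow> complex) L. bounded_linear l \<Longrightarrow> (\<lambda>k. l (Z k)) \<longlonglongrightarrow> L \<Longrightarrow> l \<zeta> = L"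
proof -
  define C where "C i = closure (convex hull (Z ` {i..}))" for i
  have ZC: "Z k \<in> C i" if "i \<le> k" for i k
    unfolding C_def using that by (intro set_mp[OF closure_subset] hull_inc) auto
  obtain \<zeta> where \<zeta>: "\<And>i. \<zeta> \<in> C i"
  proof (rule nested_convex_inter_nonempty[of C B])
    show "convex (C i)" "closed (C i)" for i
      unfolding C_def by (auto intro: convex_closure convex_convex_hull)
    show "C j \<subseteq> C i" if "i \<le> j" for i j
      unfolding C_def using that by (intro closure_mono hull_mono image_mono) auto
    show "\<exists>x\<in>C i. norm x \<le> B" for i using ZC[of i i] Z(2) by blast
  qed blast
  have sub: "\<zeta> \<in> S" if S: "convex S" "closed S" and Zi: "\<And>k. k \<ge> i \<Longrightarrow> Z k \<in> S" for S i
  proof -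
    have "C i \<subseteq> S"
      unfolding C_def by (intro closure_minimal hull_minimal S) (use Zi in auto)
    then show ?thesis using \<zeta> by blast
  qed
  show ?thesis
  proof (rule that[of \<zeta>])
    show "\<zeta> \<in> K" by (rule sub[OF K, of 0]) (rule Z)
    fix l :: "'a \<Rightarrow> complex" and L assume l: "bounded_linear l" and lim: "(\<lambda>k. l (Z k)) \<longlonglongrightarrow> L"
    have "dist (l \<zeta>) L \<le> 0"
    proof (rule field_le_epsilon)
      fix e :: real assume "e > 0"
      then obtain i where i: "\<And>k. k \<ge> i \<Longrightarrow> dist (l (Z k)) L < e"
        using lim unfolding lim_sequentially by blast
      have "\<zeta> \<in> l -` cball L e"
      proof (rule sub)
        show "convex (l -` cball L e)"
          by (rule convex_linear_vimage[OF bounded_linear.linear[OF l]]) (rule convex_cball)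
        show "closed (l -` cball L e)"
          by (rule continuous_closed_vimage) (auto intro: linear_continuous_at l)
        show "\<And>k. k \<ge> i \<Longrightarrow> Z k \<in> l -` cball L e" using i by (auto simp: dist_commute intro: less_imp_le)
      qed
      then show "dist (l \<zeta>) L \<le> 0 + e" by (simp add: dist_commute)
    qed
    then show "l \<zeta> = L" by simp
  qed
qed

lemma integral_periodic_shift:
  fixes f :: "real \<Rightarrow> complex"
  assumes f: "continuous_on UNIV f" and per: "\<And>t. f (t + L) = f t" and L: "L > 0"
  shows "integral {0..L} (\<lambda>t. f (t + h)) = integral {0..L} f"
proof -
  have pos: "integral {0..L} (\<lambda>t. g (t + h)) = integral {0..L} g"
    if g: "continuous_on UNIV g" "\<And>t. g (t + L) = g t" and h: "h \<ge> 0" for g :: "real \<Rightarrow> complex" and h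
  proof -
    have i: "g integrable_on {c..d}" for c d
      by (intro integrable_continuous_real continuous_on_subset[OF g(1)]) auto
    have s: "integral {c..d} (\<lambda>t. g (t + k)) = integral {c + k..d + k} g" for c d k
      using integral_shift_Icc_real[of c d g k] by (simp add: o_def add.commute)
    \<comment> \<open>The interval from 0 to \<open>L + h\<close> is cut once at \<open>h\<close>
      and once at \<open>L\<close>; by periodicity the pieces of length \<open>h\<close> have equal
      integrals.\<close>
    have "integral {0..h} g + integral {h..L + h} g = integral {0..L + h} g"
      using h L by (intro Henstock_Kurzweil_Integration.integral_combine i) auto
    moreover have "integral {0..L} g + integral {L..L + h} g = integral {0..L + h} g"
      using h L by (intro Henstock_Kurzweil_Integration.integral_combine i) auto
    moreover have "integral {L..L + h} g = integral {0..h} g"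
      using s[of 0 h L] by (simp add: g(2) add.commute)
    ultimately have "integral {0..h} g + integral {h..L + h} g = integral {0..h} g + integral {0..L} g"
      by (simp only: add.commute)
    then have "integral {h..L + h} g = integral {0..L} g" by simp
    then show ?thesis using s[of 0 L h] by simp
  qed
  show ?thesis
  proof (cases "h \<ge> 0")
    case False
    have per2: "f (t + L + h) = f (t + h)" for t using per[of "t + h"] by (simp add: ac_simps)
    \<comment> \<open>A negative shift is undone by a positive one applied to the translated
      function.\<close>
    have "integral {0..L} (\<lambda>t. f (t + - h + h)) = integral {0..L} (\<lambda>t. f (t + h))"
      by (rule pos[of "\<lambda>t. f (t + h)" "- h"])
        (use False in \<open>auto intro!: continuous_intros continuous_on_compose2[OF f] simp: per2\<close>)
    then show ?thesis by simp
  qed (use pos[OF f per] in simp)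
qed

lemma subspace_closure:
  fixes S :: "'a::real_normed_vector set"
  assumes S: "subspace S"
  shows "subspace (closure S)"
proof (rule subspaceI)
  show "0 \<in> closure S" using subspace_0[OF S] closure_subset by blast
  show "x + y \<in> closure S" if xy: "x \<in> closure S" "y \<in> closure S" for x y
  proof -
    obtain f g where f: "\<And>n. f n \<in> S" "f \<longlonglongrightarrow> x" and g: "\<And>n. g n \<in> S" "g \<longlonglongrightarrow> y"
      using xy unfolding closure_sequential by blast
    have "\<forall>n. f n + g n \<in> S" using S f(1) g(1) by (simp add: subspace_add)
    then show ?thesis unfolding closure_sequential using tendsto_add[OF f(2) g(2)] by (intro exI[of _ "\<lambda>n. f n + g n"] conjI)
  qed
  show "r *\<^sub>R x \<in> closure S" if x: "x \<in> closure S" for r x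
  proof -
    obtain f where f: "\<And>n. f n \<in> S" "f \<longlonglongrightarrow> x" using x unfolding closure_sequential by blast
    have "\<forall>n. r *\<^sub>R f n \<in> S" using S f(1) by (simp add: subspace_scale)
    then show ?thesis unfolding closure_sequential using tendsto_scaleR[OF tendsto_const f(2)] by (intro exI[of _ "\<lambda>n. r *\<^sub>R f n"] conjI)
  qed
qed

text \<open>The spacing \<open>2 * pi / Lx\<close> gives all exponentials with frequencies
  \<open>a n\<close> the same phase over one period, so they are quasi-periodic together.\<close>

locale qpcell = cell +
  fixes a :: "int \<Rightarrow> real"
  assumes a: "\<And>n. a n = a 0 + 2 * pi * of_int n / Lx"
begin

definition QP where "QP = {w. C_infinity w \<and> quasi_periodic Lx a w}"

lemma QP_subset: "QP \<subseteq> {w. C_infinity w}"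
  by (auto simp: QP_def)

lemma QP_shift: "w \<in> QP \<Longrightarrow> w (t + Lx, s) = exp (\<i> * of_real (a 0 * Lx)) * w (t, s)"
  by (simp add: QP_def quasi_periodic_def)

lemma QP_I: "C_infinity w \<Longrightarrow> (\<And>t s. w (t + Lx, s) = exp (\<i> * of_real (a 0 * Lx)) * w (t, s)) \<Longrightarrow> w \<in> QP"
  by (simp add: QP_def quasi_periodic_def)

lemma QP_smooth [simp]: "w \<in> QP \<Longrightarrow> C_infinity w"
  by (simp add: QP_def)

lemma phase_norm: "exp (\<i> * of_real (a 0 * Lx)) * cnj (exp (\<i> * of_real (a 0 * Lx))) = 1"
  by (simp add: exp_cnj flip: exp_add)

text \<open>The phase has modulus one and cancels against its conjugate; this is what removes
  lateral boundary terms from sesquilinear identities.\<close>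

lemma QP_product_periodic:
  assumes "v \<in> QP" "w \<in> QP"
  shows "v (t + Lx, s) * cnj (w (t + Lx, s)) = v (t, s) * cnj (w (t, s))"
proof -
  have "v (t + Lx, s) * cnj (w (t + Lx, s))
    = (exp (\<i> * of_real (a 0 * Lx)) * cnj (exp (\<i> * of_real (a 0 * Lx)))) * (v (t, s) * cnj (w (t, s)))"
    unfolding QP_shift[OF assms(1)] QP_shift[OF assms(2)] complex_cnj_mult by (simp only: mult_ac)
  then show ?thesis by (simp only: phase_norm mult_1)
qed

lemma QP_add:
  assumes v: "v \<in> QP" and w: "w \<in> QP"
  shows "(\<lambda>x. v x + w x) \<in> QP"
  by (rule QP_I[OF C_infinity_add[OF QP_smooth[OF v] QP_smooth[OF w]]])
    (simp only: QP_shift[OF v] QP_shift[OF w] distrib_left)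

lemma QP_diff:
  assumes v: "v \<in> QP" and w: "w \<in> QP"
  shows "(\<lambda>x. v x - w x) \<in> QP"
  by (rule QP_I[OF C_infinity_diff[OF QP_smooth[OF v] QP_smooth[OF w]]])
    (simp only: QP_shift[OF v] QP_shift[OF w] right_diff_distrib)

lemma QP_scaleR:
  assumes w: "w \<in> QP"
  shows "(\<lambda>x. r *\<^sub>R w x) \<in> QP"
  by (rule QP_I[OF C_infinity_scaleR[OF QP_smooth[OF w]]])
    (simp only: QP_shift[OF w] mult_scaleR_right)

lemma QP_mult:
  assumes "w \<in> QP" "C_infinity c" "\<And>t s. c (t + Lx, s) = c (t, s)"
  shows "(\<lambda>x. c x * w x) \<in> QP"
  by (rule QP_I[OF C_infinity_mult[OF assms(2) QP_smooth[OF assms(1)]]])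
    (simp only: QP_shift[OF assms(1)] assms(3) mult.left_commute)

lemma QP_cmult: "w \<in> QP \<Longrightarrow> (\<lambda>x. k * w x) \<in> QP"
  by (rule QP_mult[OF _ C_infinity_const]) simp_all

lemma QP_translate: "w \<in> QP \<Longrightarrow> (\<lambda>x. w (x + (h, 0))) \<in> QP"
proof (rule QP_I)
  assume w: "w \<in> QP"
  then show "C_infinity (\<lambda>x. w (x + (h, 0)))" by (intro C_infinity_translate) simp
  show "w ((t + Lx, s) + (h, 0)) = exp (\<i> * of_real (a 0 * Lx)) * w ((t, s) + (h, 0))" for t s
    using QP_shift[OF w, of "t + h" s] by (simp add: ac_simps)
qed

lemma QP_partial:
  assumes w: "w \<in> QP" and b: "b = (1, 0) \<or> b = (0, 1)"
  shows "partial b w \<in> QP"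
proof (rule QP_I)
  show "C_infinity (partial b w)" using w b by (intro C_infinity_partial') auto
  fix t s
  have "partial b w ((t, s) + (Lx, 0)) = partial b (\<lambda>x. w (x + (Lx, 0))) (t, s)"
    using w by (simp only: partial_translate QP_smooth)
  also have "(\<lambda>x. w (x + (Lx, 0))) = (\<lambda>x. exp (\<i> * of_real (a 0 * Lx)) * w x)"
  proof
    fix x :: "real \<times> real"
    show "w (x + (Lx, 0)) = exp (\<i> * of_real (a 0 * Lx)) * w x"
      using QP_shift[OF w, of "fst x" "snd x"] by (cases x) simp
  qed
  also have "partial b \<dots> (t, s) = exp (\<i> * of_real (a 0 * Lx)) * partial b w (t, s)"
    using w by (intro partial_linear bounded_linear_mult_right) simp
  finally show "partial b w (t + Lx, s) = exp (\<i> * of_real (a 0 * Lx)) * partial b w (t, s)" by simp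
qed

lemma QP_hexp: "hexp (a n) (t + Lx, s) = exp (\<i> * of_real (a 0 * Lx)) * hexp (a n) (t, s)"
proof -
  have "\<i> * of_real (a n * (t + Lx)) = \<i> * of_real (a 0 * Lx) + \<i> * of_real (a n * t) + of_int n * (2 * of_real pi * \<i>)"
    unfolding a[of n] using Lx by (simp add: field_simps)
  then have "exp (\<i> * of_real (a n * (t + Lx)))
      = exp (\<i> * of_real (a 0 * Lx)) * exp (\<i> * of_real (a n * t)) * exp (of_int n * (2 * of_real pi * \<i>))"
    by (simp only: exp_add)
  moreover have "exp (of_int n * (2 * of_real pi * \<i>)) = (1::complex)"
    using exp_integer_2pi[of "of_int n"] by (simp add: mult_ac)
  ultimately show ?thesis by (simp add: hexp_def)
qed

lemma QP_cbas: "cbas (a 0) n m \<in> QP"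
proof (rule QP_I)
  show "cbas (a 0) n m (t + Lx, s) = exp (\<i> * of_real (a 0 * Lx)) * cbas (a 0) n m (t, s)" for t s
    unfolding cbas_def a[symmetric] QP_hexp by (simp add: vert_def)
qed (rule C_infinity_cbas)

lemma QP_trace_product:
  assumes w: "w \<in> QP"
  shows "integral {0..Lx} (\<lambda>t. w (t + h, s) * cnj (hexp (a n) (t + h, s))) = integral {0..Lx} (\<lambda>t. w (t, s) * cnj (hexp (a n) (t, s)))"
proof (rule integral_periodic_shift[where f = "\<lambda>t. w (t, s) * cnj (hexp (a n) (t, s))"])
  have hx: "hexp (a n) \<in> QP" by (rule QP_I[OF C_infinity_hexp QP_hexp])
  show "continuous_on UNIV (\<lambda>t. w (t, s) * cnj (hexp (a n) (t, s)))"
    by (intro continuous_on_mult continuous_on_cnj continuous_trace QP_smooth w hx)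
  show "w (t + Lx, s) * cnj (hexp (a n) (t + Lx, s)) = w (t, s) * cnj (hexp (a n) (t, s))" for t
    by (rule QP_product_periodic[OF w hx])
qed (rule Lx)

text \<open>On each horizontal line the integrand is periodic, so its integral over a period is
  invariant under shifts. The functions are translated on the whole plane before they are restricted
  to the cell.\<close>

lemma translate_isometry:
  assumes v: "v \<in> QP" and w: "w \<in> QP"
  shows "cin (E (\<lambda>x. v (x + (h, 0)))) (E (\<lambda>x. w (x + (h, 0)))) = cin (E v) (E w)"
proof -
  have c: "C_infinity (\<lambda>x. v x * cnj (w x))" using v w by (intro C_infinity_mult C_infinity_cnj) auto
  have c': "C_infinity (\<lambda>x. v (x + (h, 0)) * cnj (w (x + (h, 0))))" by (rule C_infinity_translate[OF c])
  have "cin (E (\<lambda>x. v (x + (h, 0)))) (E (\<lambda>x. w (x + (h, 0))))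
      = (\<integral>x. v (x + (h, 0)) * cnj (w (x + (h, 0))) \<partial>lebesgue_on \<Omega>)"
    using QP_translate[OF v] QP_translate[OF w] by (simp add: cin_toL)
  also have "\<dots> = integral {-H..H} (\<lambda>s. integral {0..Lx} (\<lambda>t. v (t + h, s) * cnj (w (t + h, s))))"
    by (subst integral_Omega_iterated(2)[OF C_infinity_continuous[OF c']]) simp
  also have "\<dots> = integral {-H..H} (\<lambda>s. integral {0..Lx} (\<lambda>t. v (t, s) * cnj (w (t, s))))"
  proof (rule arg_cong[where f = "integral {-H..H}"], rule ext)
    fix s
    show "integral {0..Lx} (\<lambda>t. v (t + h, s) * cnj (w (t + h, s))) = integral {0..Lx} (\<lambda>t. v (t, s) * cnj (w (t, s)))"
      by (rule integral_periodic_shift[where f = "\<lambda>t. v (t, s) * cnj (w (t, s))", OF continuous_trace[OF c] QP_product_periodic[OF v w] Lx])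
  qed
  also have "\<dots> = cin (E v) (E w)"
    using v w by (simp add: cin_toL integral_Omega_iterated(2)[OF C_infinity_continuous[OF c]])
  finally show ?thesis .
qed

section \<open>The closed space of quasi-periodic jets and its traces\<close>

lemma closure_jet_subset: "closure (jet ` QP) \<subseteq> closure (jet ` {w. C_infinity w})"
  and closure_graph_subset: "closure (graph ` QP) \<subseteq> closure (graph ` {w. C_infinity w})"
  using QP_subset by (auto intro!: closure_mono image_mono)

lemma subspace_jets: "subspace (closure (jet ` QP))"
proof (rule subspace_closure, rule subspaceI)
  have z: "(\<lambda>x. 0) \<in> QP" by (rule QP_I) (simp_all add: C_infinity_const)
  have "jet (\<lambda>x. 0) = jet (\<lambda>x. 0 *\<^sub>R 0)" by simp
  also have "\<dots> = 0 *\<^sub>R jet (\<lambda>x. 0)"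
    using graph_scaleR[of "\<lambda>x. 0" "\<lambda>x. 0" 0] by (simp add: C_infinity_const graph_def)
  finally show "0 \<in> jet ` QP" using z by (metis imageI scale_zero_left)
  show "X + Y \<in> jet ` QP" if XY: "X \<in> jet ` QP" "Y \<in> jet ` QP" for X Y
  proof -
    obtain v w where v: "v \<in> QP" "X = jet v" and w: "w \<in> QP" "Y = jet w" using XY by blast
    have "X + Y = jet (\<lambda>x. v x + w x)" using graph_add[of v w] v w by (simp add: graph_def)
    then show ?thesis using QP_add v w by blast
  qed
  show "r *\<^sub>R X \<in> jet ` QP" if X: "X \<in> jet ` QP" for r X
  proof -
    obtain v where v: "v \<in> QP" "X = jet v" using X by blast
    have "r *\<^sub>R X = jet (\<lambda>x. r *\<^sub>R v x)" using graph_scaleR[of v v r] v by (simp add: graph_def)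
    then show ?thesis using QP_scaleR v by blast
  qed
qed

text \<open>By the trace estimate, convergent jets make the traces on both edges Cauchy
  sequences.\<close>

lemma jet_trace_exists:
  assumes w: "\<And>j. w j \<in> QP" and X: "(\<lambda>j. jet (w j)) \<longlonglongrightarrow> X"
  obtains T where "(\<lambda>j. graph (w j)) \<longlonglongrightarrow> (X, T)" "(X, T) \<in> closure (graph ` QP)"
proof -
  have cau: "Cauchy (\<lambda>j. jet (w j))" by (rule LIMSEQ_imp_Cauchy[OF X])
  define K where "K = sqrt (1 / H + 4)"
  have K0: "K > 0" unfolding K_def using H by (intro real_sqrt_gt_zero add_pos_pos) auto
  have "Cauchy (\<lambda>j. EG (\<lambda>t. w j (t, h)))" if h: "h = H \<or> h = -H" for h
  proof (rule CauchyI)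
    fix e :: real assume e: "e > 0"
    then obtain M where M: "\<And>m n. m \<ge> M \<Longrightarrow> n \<ge> M \<Longrightarrow> norm (jet (w m) - jet (w n)) < e / K"
      using CauchyD[OF cau, of "e / K"] K0 by auto
    have "norm (EG (\<lambda>t. w m (t, h)) - EG (\<lambda>t. w n (t, h))) < e" if "m \<ge> M" "n \<ge> M" for m n
    proof -
      have "norm (EG (\<lambda>t. w m (t, h)) - EG (\<lambda>t. w n (t, h))) \<le> K * norm (jet (w m) - jet (w n))"
        using trace_bound[OF C_infinity_diff[of "w m" "w n"] h] w by (simp add: jet_diff toL_diff K_def)
      also have "\<dots> < K * (e / K)" using M[OF that] K0 by (intro mult_strict_left_mono)
      finally show ?thesis using K0 by simp
    qed
    then show "\<exists>M. \<forall>m\<ge>M. \<forall>n\<ge>M. norm (EG (\<lambda>t. w m (t, h)) - EG (\<lambda>t. w n (t, h))) < e" by blast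
  qed
  from this[of H] this[of "-H"] obtain S T where "(\<lambda>j. EG (\<lambda>t. w j (t, H))) \<longlonglongrightarrow> S" "(\<lambda>j. EG (\<lambda>t. w j (t, -H))) \<longlonglongrightarrow> T"
    by (auto dest!: Cauchy_convergent convergentD)
  then have lim: "(\<lambda>j. graph (w j)) \<longlonglongrightarrow> (X, (S, T))"
    unfolding graph_def tr_def by (intro tendsto_Pair X)
  moreover have "(X, (S, T)) \<in> closure (graph ` QP)"
    unfolding closure_sequential using lim w by (intro exI[of _ "\<lambda>j. graph (w j)"] conjI allI imageI)
  ultimately show ?thesis using that by blast
qed

lemma jets_sequence:
  assumes "X \<in> closure (jet ` QP)"
  obtains w where "\<And>j. w j \<in> QP" "(\<lambda>j. jet (w j)) \<longlonglongrightarrow> X"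
proof -
  obtain z where z: "\<And>n. z n \<in> jet ` QP" "z \<longlonglongrightarrow> X"
    using assms unfolding closure_sequential by blast
  have "\<exists>w. w \<in> QP \<and> z n = jet w" for n using imageE[OF z(1)[of n]] by blast
  then obtain w where w: "\<And>n. w n \<in> QP" "\<And>n. z n = jet (w n)" by metis
  have "z = (\<lambda>n. jet (w n))" using w(2) by (rule ext)
  then show ?thesis using that w z by blast
qed

text \<open>Turns approximation in the H1 distance into membership in a closed subspace of the
  product space.\<close>

lemma H1qp_iff: "u \<in> H1qp Lx H a \<longleftrightarrow> u \<in> H1 \<Omega> \<and> wjet u \<in> closure (jet ` QP)"
proof -
  have dist: "(\<lambda>j. H1_dist \<Omega> (v j) u) \<longlonglongrightarrow> 0 \<longleftrightarrow> (\<lambda>j. jet (v j)) \<longlonglongrightarrow> wjet u"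
    if "\<And>j. C_infinity (v j)" "u \<in> H1 \<Omega>" for v
    using that by (simp add: H1_dist_eq C_infinity_H1 tendsto_norm_zero_iff LIM_zero_iff)
  show ?thesis
  proof
    assume "u \<in> H1qp Lx H a"
    then obtain w where u: "u \<in> H1 \<Omega>" and w: "\<And>j. C_infinity (w j) \<and> quasi_periodic Lx a (w j)"
      "(\<lambda>j. H1_dist \<Omega> (w j) u) \<longlonglongrightarrow> 0"
      unfolding H1qp_def by blast
    have "(\<lambda>j. jet (w j)) \<longlonglongrightarrow> wjet u" using dist[OF _ u, of w] w by blast
    moreover have "w j \<in> QP" for j using w(1)[of j] by (simp add: QP_def del: QP_smooth)
    ultimately show "u \<in> H1 \<Omega> \<and> wjet u \<in> closure (jet ` QP)"
      using u unfolding closure_sequential by (intro conjI exI[of _ "\<lambda>j. jet (w j)"] allI imageI)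
  next
    assume u: "u \<in> H1 \<Omega> \<and> wjet u \<in> closure (jet ` QP)"
    obtain w where w: "\<And>j. w j \<in> QP" "(\<lambda>j. jet (w j)) \<longlonglongrightarrow> wjet u"
      using jets_sequence[of "wjet u"] u by blast
    then have "(\<lambda>j. H1_dist \<Omega> (w j) u) \<longlonglongrightarrow> 0" using dist[of w] u by (metis QP_smooth)
    then show "u \<in> H1qp Lx H a" unfolding H1qp_def using u w(1) unfolding QP_def by blast
  qed
qed

lemma closed_range_components:
  assumes "X \<in> closure (jet ` QP)"
  shows "fst X \<in> E ` L2 \<Omega>" "fst (snd X) \<in> E ` L2 \<Omega>" "snd (snd X) \<in> E ` L2 \<Omega>"
proof -
  obtain w where w: "\<And>j. w j \<in> QP" "(\<lambda>j. jet (w j)) \<longlonglongrightarrow> X" using jets_sequence[OF assms] by blast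
  note cl = closed_sequentially[OF closed_range_toL[OF Omega_sets(1)]]
  show "fst X \<in> E ` L2 \<Omega>" by (rule cl[OF _ tendsto_fst[OF w(2)]]) (use w(1) in \<open>auto simp: jet_def\<close>)
  show "fst (snd X) \<in> E ` L2 \<Omega>" by (rule cl[OF _ tendsto_fst[OF tendsto_snd[OF w(2)]]]) (use w(1) in \<open>auto simp: jet_def\<close>)
  show "snd (snd X) \<in> E ` L2 \<Omega>" by (rule cl[OF _ tendsto_snd[OF tendsto_snd[OF w(2)]]]) (use w(1) in \<open>auto simp: jet_def\<close>)
qed

text \<open>Provides test functions for the weak equation that arise only as limits of jets, such as
  second difference quotients of \<open>u\<close>.\<close>

lemma H1qp_exists:
  assumes X: "X \<in> closure (jet ` QP)"
  obtains v where "v \<in> H1qp Lx H a" "wjet v = X"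
proof -
  obtain v g1 g2 where v: "v \<in> L2 \<Omega>" "g1 \<in> L2 \<Omega>" "g2 \<in> L2 \<Omega>" "fst X = E v" "fst (snd X) = E g1" "snd (snd X) = E g2"
    using closed_range_components[OF X] by (auto elim!: imageE)
  then have X': "X = (E v, E g1, E g2)" by (simp add: prod_eq_iff)
  have "(E v, E g1, E g2) \<in> closure (jet ` {w. C_infinity w})" using X X' closure_jet_subset by blast
  from H1_if_limit[OF v(1-3) this] have "v \<in> H1 \<Omega>" "wjet v = X" using X' by auto
  then show ?thesis using that X by (simp add: H1qp_iff)
qed

lemma green1_closure:
  assumes c: "C_infinity c" "\<And>s. c (Lx, s) = c (0, s)" and P: "X \<in> closure (jet ` QP)" "Y \<in> closure (jet ` QP)"
  shows "cin (M (partial (1, 0) c) (fst X)) (fst Y) + cin (M c (fst (snd X))) (fst Y)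
      + cin (M c (fst X)) (fst (snd Y)) = 0"
proof (rule closure_image_eq2[where g = "\<lambda>_ _. 0", OF _ _ _ P])
  fix X Y assume "X \<in> jet ` QP" "Y \<in> jet ` QP"
  then obtain v w where v: "v \<in> QP" "X = jet v" "w \<in> QP" "Y = jet w" by blast
  have "c (Lx, s) * v (Lx, s) * cnj (w (Lx, s)) = c (0, s) * v (0, s) * cnj (w (0, s))" for s
    using QP_product_periodic[OF v(1,3), of 0 s] c(2) by (simp add: mult.assoc)
  then show "cin (M (partial (1, 0) c) (fst X)) (fst Y) + cin (M c (fst (snd X))) (fst Y)
      + cin (M c (fst X)) (fst (snd Y)) = 0"
    using smooth_green1[OF c(1), of v w] v by (simp add: jet_def)
qed (intro continuous_intros)+

text \<open>\<open>QP\<close> contains the complete system \<open>cbas (a 0)\<close>.\<close>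

lemma orthogonal_QP_zero:
  assumes "X \<in> E ` L2 \<Omega>" "\<And>\<psi>. \<psi> \<in> QP \<Longrightarrow> cin X (E \<psi>) = 0"
  shows "X = 0"
  using assms cbas_complete[of _ "a 0"] QP_cbas by auto

end

subsection \<open>Difference quotients\<close>

lemma add_zero_pair: "x + (0, 0) = (x :: real \<times> real)"
  by (cases x) simp

text \<open>The mean value inequality along a horizontal segment. The derivative is bounded on the
  cell widened by \<open>B\<close> on both sides, because the translated points leave the
  cell.\<close>

lemma smooth_difference_bound:
  fixes f :: "real \<times> real \<Rightarrow> 'a::real_normed_vector"
  assumes f: "C_infinity f" and K: "\<And>x. x \<in> cbox (-B, -H) (L + B, H) \<Longrightarrow> norm (partial (1, 0) f x) \<le> K"
    and x: "0 \<le> t" "t \<le> L" "-H \<le> s" "s \<le> H" and h: "\<bar>h\<bar> \<le> B"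
  shows "norm (f (t + h, s) - f (t, s)) \<le> K * \<bar>h\<bar>"
proof -
  have "(t, s) \<in> cbox (-B, -H) (L + B, H)" using x h by (auto simp: cbox_Pair_eq)
  then have K0: "0 \<le> K" using order_trans[OF norm_ge_zero K] by blast
  have "norm (f (t + h, s) - f (t, s)) \<le> K * norm ((t + h) - t)"
  proof (rule differentiable_bound[of "{-B..L + B}" "\<lambda>t. f (t, s)" "\<lambda>t h. h *\<^sub>R partial (1, 0) f (t, s)"])
    fix r assume r: "r \<in> {-B..L + B}"
    have "((\<lambda>t. f (t, s)) has_derivative (\<lambda>h. fst (h, 0::real) *\<^sub>R partial (1, 0) f (r, s) + snd (h, 0::real) *\<^sub>R partial (0, 1) f (r, s))) (at r)"
      by (rule has_derivative_compose[OF _ C_infinity_has_derivative[OF f], of "\<lambda>t. (t, s)" "\<lambda>h. (h, 0)"])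
        (rule has_derivative_Pair[OF has_derivative_ident has_derivative_const])
    then show "((\<lambda>t. f (t, s)) has_derivative (\<lambda>h. h *\<^sub>R partial (1, 0) f (r, s))) (at r within {-B..L + B})"
      unfolding fst_conv snd_conv scaleR_zero_left add_0_right by (rule has_derivative_at_withinI)
    have "norm (partial (1, 0) f (r, s)) \<le> K" using r x by (intro K) (auto simp: cbox_Pair_eq)
    then show "onorm (\<lambda>h. h *\<^sub>R partial (1, 0) f (r, s)) \<le> K"
      by (intro onorm_bound K0) (simp add: mult.commute[of K] mult_left_mono)
  qed (use x h in auto)
  then show ?thesis by simp
qed

lemma smooth_partial_bounded:
  fixes f :: "real \<times> real \<Rightarrow> 'a::real_normed_vector"
  assumes f: "C_infinity f"
  obtains K where "\<And>x. x \<in> cbox c d \<Longrightarrow> norm (partial (1, 0) f x) \<le> K" "K \<ge> 0"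
proof -
  have "bounded (partial (1, 0) f ` cbox c d)"
    by (intro compact_imp_bounded compact_continuous_image C_infinity_continuous C_infinity_partial f compact_cbox)
  then obtain K where "\<And>x. x \<in> cbox c d \<Longrightarrow> norm (partial (1, 0) f x) \<le> K" by (auto simp: bounded_iff)
  then show ?thesis using that[of "max K 0"] by (auto simp: le_max_iff_disj)
qed

definition dq :: "real \<Rightarrow> (real \<times> real \<Rightarrow> 'a::real_normed_vector) \<Rightarrow> real \<times> real \<Rightarrow> 'a" where
  "dq h w x = (1 / h) *\<^sub>R (w (x + (h, 0)) - w x)"

lemma C_infinity_dq: "C_infinity w \<Longrightarrow> C_infinity (dq h w)"
  unfolding dq_def [abs_def] by (intro C_infinity_scaleR C_infinity_diff C_infinity_translate)

lemma partial_dq: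
  assumes w: "C_infinity w"
  shows "partial b (dq h w) = dq h (partial b w)"
proof
  fix x
  have "partial b (dq h w) x = (1 / h) *\<^sub>R partial b (\<lambda>x. w (x + (h, 0)) - w x) x"
    unfolding dq_def [abs_def]
    by (rule partial_linear[OF bounded_linear_scaleR_right]) (intro C_infinity_diff C_infinity_translate w)
  also have "\<dots> = (1 / h) *\<^sub>R (partial b w (x + (h, 0)) - partial b w x)"
    by (subst partial_diff[OF C_infinity_translate[OF w] w]) (simp only: partial_translate[OF w])
  finally show "partial b (dq h w) x = dq h (partial b w) x" by (simp add: dq_def)
qed

text \<open>Discrete product rule; the coefficient appears translated where \<open>f\<close> is
  differenced.\<close>

lemma dq_mult:
  fixes c f :: "real \<times> real \<Rightarrow> 'a::real_normed_algebra"
  shows "dq h (\<lambda>x. c x * f x) x = c (x + (h, 0)) * dq h f x + dq h c x * f x"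
  by (simp add: dq_def algebra_simps flip: scaleR_add_right)

context cell
begin

text \<open>Differentiability gives pointwise convergence, and the mean value bound dominates the
  differences by the constant \<open>2 * K\<close> on the bounded cell.\<close>

lemma dq_tendsto:
  assumes f: "C_infinity f" and d: "\<delta> \<longlonglongrightarrow> 0" "\<And>k. \<delta> k \<noteq> 0" "\<And>k. \<bar>\<delta> k\<bar> \<le> B"
  shows "(\<lambda>k. E (dq (\<delta> k) f)) \<longlonglongrightarrow> E (partial (1, 0) f)"
proof -
  have B: "0 \<le> B" using order_trans[OF abs_ge_zero d(3)] .
  obtain K where K: "\<And>x. x \<in> cbox (-B, -H) (Lx + B, H) \<Longrightarrow> norm (partial (1, 0) f x) \<le> K" and K0: "K \<ge> 0"
    using smooth_partial_bounded[OF f] by blast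
  define g where "g k x = dq (\<delta> k) f x - partial (1, 0) f x" for k x
  have gs: "C_infinity (g k)" for k
    unfolding g_def [abs_def] by (intro C_infinity_diff C_infinity_dq C_infinity_partial f)
  have gb: "norm (g k x) \<le> 2 * K" if "x \<in> \<Omega>" for k x
  proof -
    have x: "0 < fst x" "fst x < Lx" "-H < snd x" "snd x < H" using that by (auto simp: Omega_def)
    have "norm (f (x + (\<delta> k, 0)) - f x) \<le> K * \<bar>\<delta> k\<bar>"
      using smooth_difference_bound[where B = B and H = H and L = Lx, OF f K, of "fst x" "snd x" "\<delta> k"] x d(3)[of k] by (cases x) auto
    then have "norm (dq (\<delta> k) f x) \<le> K" using d(2)[of k] by (simp add: dq_def divide_le_eq)
    moreover have "norm (partial (1, 0) f x) \<le> K"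
      using x B by (intro K) (cases x, auto simp: cbox_Pair_eq)
    ultimately show ?thesis unfolding g_def using norm_triangle_ineq4[of "dq (\<delta> k) f x" "partial (1, 0) f x"] by linarith
  qed
  have pt: "(\<lambda>k. g k x) \<longlonglongrightarrow> 0" for x
  proof -
    have "((\<lambda>t. x + (t, 0::real)) has_derivative (\<lambda>h. 0 + (h, 0))) (at 0)"
      by (intro has_derivative_add has_derivative_const has_derivative_Pair has_derivative_ident)
    then have "((\<lambda>t. f (x + (t, 0))) has_derivative (\<lambda>h. fst (h, 0::real) *\<^sub>R partial (1, 0) f (x + (0, 0)) + snd (h, 0::real) *\<^sub>R partial (0, 1) f (x + (0, 0)))) (at 0)"
      by (intro has_derivative_compose[OF _ C_infinity_has_derivative[OF f], of "\<lambda>t. x + (t, 0)" "\<lambda>h. (h, 0)"]) simp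
    then have "((\<lambda>t. f (x + (t, 0))) has_derivative (\<lambda>h. h *\<^sub>R partial (1, 0) f x)) (at 0)"
      by (simp only: add_zero_pair fst_conv snd_conv scaleR_zero_left add_0_right)
    then have "((\<lambda>t. norm (f (x + (0 + t, 0)) - f (x + (0, 0)) - t *\<^sub>R partial (1, 0) f x) / norm t) \<longlongrightarrow> 0) (at 0)"
      unfolding has_derivative_at by blast
    then have "((\<lambda>t. norm (f (x + (t, 0)) - f x - t *\<^sub>R partial (1, 0) f x) / norm t) \<longlongrightarrow> 0) (at 0)"
      by (simp only: add_zero_pair add_0_left)
    then have "(\<lambda>k. norm (f (x + (\<delta> k, 0)) - f x - \<delta> k *\<^sub>R partial (1, 0) f x) / norm (\<delta> k)) \<longlonglongrightarrow> 0"
      by (rule filterlim_compose) (use d in \<open>auto simp: filterlim_at\<close>)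
    moreover have "norm (f (x + (\<delta> k, 0)) - f x - \<delta> k *\<^sub>R partial (1, 0) f x) / norm (\<delta> k) = norm (g k x)" for k
    proof -
      have "g k x = (1 / \<delta> k) *\<^sub>R (f (x + (\<delta> k, 0)) - f x - \<delta> k *\<^sub>R partial (1, 0) f x)"
        using d(2)[of k] by (simp add: g_def dq_def scaleR_diff_right)
      then show ?thesis by simp
    qed
    ultimately show ?thesis by (simp add: tendsto_norm_zero_iff)
  qed
  have "(\<lambda>k. \<integral>x. (norm (g k x))\<^sup>2 \<partial>lebesgue_on \<Omega>) \<longlonglongrightarrow> (\<integral>x. 0 \<partial>lebesgue_on \<Omega>)"
  proof (rule integral_dominated_convergence[where w = "\<lambda>x. (2 * K)\<^sup>2"])
    show "(\<lambda>x. (norm (g k x))\<^sup>2) \<in> borel_measurable (lebesgue_on \<Omega>)" for k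
      by (intro continuous_imp_measurable_on_sets_lebesgue continuous_intros C_infinity_continuous gs Omega_sets)
    show "integrable (lebesgue_on \<Omega>) (\<lambda>x. (2 * K)\<^sup>2)"
      using finite_measure_lebesgue_on[of \<Omega>] bounded_set_imp_lmeasurable[of \<Omega>]
      by (intro finite_measure.integrable_const) auto
    show "AE x in lebesgue_on \<Omega>. (\<lambda>k. (norm (g k x))\<^sup>2) \<longlonglongrightarrow> 0"
    proof (rule AE_I2)
      fix x
      have "(\<lambda>k. (norm (g k x))\<^sup>2) \<longlonglongrightarrow> 0\<^sup>2" by (intro tendsto_power tendsto_norm_zero pt)
      then show "(\<lambda>k. (norm (g k x))\<^sup>2) \<longlonglongrightarrow> 0" by simp
    qed
    show "AE x in lebesgue_on \<Omega>. norm ((norm (g k x))\<^sup>2) \<le> (2 * K)\<^sup>2" for k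
    proof (rule AE_I2)
      fix x assume "x \<in> space (lebesgue_on \<Omega>)"
      then have "(norm (g k x))\<^sup>2 \<le> (2 * K)\<^sup>2" by (intro power_mono gb) auto
      then show "norm ((norm (g k x))\<^sup>2) \<le> (2 * K)\<^sup>2" by simp
    qed
  qed simp
  then have "(\<lambda>k. (norm (E (g k)))\<^sup>2) \<longlonglongrightarrow> 0" using gs by (simp add: norm_toL)
  then have "(\<lambda>k. sqrt ((norm (E (g k)))\<^sup>2)) \<longlonglongrightarrow> sqrt 0" by (rule tendsto_real_sqrt)
  then have "(\<lambda>k. E (g k)) \<longlonglongrightarrow> 0" by (simp add: tendsto_norm_zero_iff)
  moreover have "E (g k) = E (dq (\<delta> k) f) - E (partial (1, 0) f)" for k
    unfolding g_def [abs_def] using f C_infinity_dq[OF f] by (simp add: toL_diff)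
  ultimately show ?thesis by (simp add: LIM_zero_iff)
qed

end

section \<open>Difference quotients of quasi-periodic functions\<close>

context qpcell
begin

lemma QP_dq: "w \<in> QP \<Longrightarrow> dq h w \<in> QP"
  unfolding dq_def [abs_def] by (intro QP_scaleR QP_diff QP_translate)

lemma E_dq:
  assumes "w \<in> QP"
  shows "E (dq h w) = (1 / h) *\<^sub>R (E (\<lambda>x. w (x + (h, 0))) - E w)"
  unfolding dq_def [abs_def] using assms QP_translate[OF assms]
  by (simp add: toL_scaleR toL_diff L2_diff)

lemma translate_adjoint:
  assumes v: "v \<in> QP" and w: "w \<in> QP"
  shows "cin (E (\<lambda>x. v (x + (h, 0)))) (E w) = cin (E v) (E (\<lambda>x. w (x + (-h, 0))))"
proof -
  have "(\<lambda>x. w ((x + (h, 0)) + (-h, 0))) = w" by (rule ext) (simp add: add.assoc add_zero_pair)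
  then show ?thesis using translate_isometry[OF v QP_translate[OF w, of "-h"], of h] by simp
qed

text \<open>Discrete integration by parts: the adjoint of a translation is the opposite translation,
  so no boundary terms appear.\<close>

lemma dq_adjoint:
  assumes v: "v \<in> QP" and w: "w \<in> QP"
  shows "cin (E (dq h v)) (E w) = - cin (E v) (E (dq (-h) w))"
  unfolding E_dq[OF v] E_dq[OF w] cin.scaleR_left cin.scaleR_right cin.diff_left cin.diff_right
    translate_adjoint[OF v w] by simp

lemma norm_translate:
  assumes w: "w \<in> QP"
  shows "norm (E (\<lambda>x. w (x + (h, 0)))) = norm (E w)"
  using translate_isometry[OF w w, of h] by (simp add: cin_self flip: of_real_power)

text \<open>Not uniform in \<open>h\<close>, but enough to pass to limits of smooth functions for a
  fixed step.\<close>

lemma norm_dq_le: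
  assumes w: "w \<in> QP"
  shows "norm (E (dq h w)) \<le> 2 / \<bar>h\<bar> * norm (E w)"
proof -
  have "norm (E (\<lambda>x. w (x + (h, 0))) - E w) \<le> norm (E w) + norm (E w)"
    using norm_triangle_ineq4[of "E (\<lambda>x. w (x + (h, 0)))" "E w"] by (simp add: norm_translate[OF w])
  then show ?thesis unfolding E_dq[OF w] by (simp add: divide_right_mono)
qed

text \<open>Telescoping over \<open>n\<close> translations by \<open>h / n\<close> and using their isometry; then \<open>n \<longlonglongrightarrow> \<infinity>\<close>.\<close>

lemma norm_dq_le_partial:
  assumes w: "w \<in> QP" and h: "h > 0"
  shows "norm (E (dq h w)) \<le> norm (E (partial (1, 0) w))"
proof -
  define \<delta> where "\<delta> n = h / real (Suc n)" for n
  have \<delta>: "\<delta> n > 0" "\<delta> n \<le> h" "real (Suc n) * \<delta> n = h" for n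
    using h by (auto simp: \<delta>_def field_simps)
  have le: "norm (E (dq h w)) \<le> norm (E (dq (\<delta> n) w))" for n
  proof -
    let ?T = "\<lambda>r. E (\<lambda>x. w (x + (r, 0)))"
    have step: "norm (?T (real (Suc i) * \<delta> n) - ?T (real i * \<delta> n)) = norm (?T (\<delta> n) - E w)" for i
    proof -
      have d: "(\<lambda>x. w (x + (\<delta> n, 0)) - w x) \<in> QP" by (intro QP_diff QP_translate w)
      have "?T (real (Suc i) * \<delta> n) - ?T (real i * \<delta> n) = E (\<lambda>x. w (x + (real (Suc i) * \<delta> n, 0)) - w (x + (real i * \<delta> n, 0)))"
        using QP_translate[OF w] by (simp add: toL_diff)
      also have "(\<lambda>x. w (x + (real (Suc i) * \<delta> n, 0)) - w (x + (real i * \<delta> n, 0)))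
        = (\<lambda>x. w ((x + (real i * \<delta> n, 0)) + (\<delta> n, 0)) - w (x + (real i * \<delta> n, 0)))"
        by (rule ext) (simp add: add.assoc algebra_simps)
      also have "norm (E \<dots>) = norm (E (\<lambda>x. w (x + (\<delta> n, 0)) - w x))" by (rule norm_translate[OF d])
      also have "E (\<lambda>x. w (x + (\<delta> n, 0)) - w x) = ?T (\<delta> n) - E w"
        using w QP_translate[OF w] by (simp add: toL_diff)
      finally show ?thesis .
    qed
    have "(\<Sum>i<Suc n. ?T (real (Suc i) * \<delta> n) - ?T (real i * \<delta> n)) = ?T (real (Suc n) * \<delta> n) - ?T (real 0 * \<delta> n)"
      by (rule sum_lessThan_telescope)
    then have "?T h - E w = (\<Sum>i<Suc n. ?T (real (Suc i) * \<delta> n) - ?T (real i * \<delta> n))"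
      by (simp only: \<delta>(3)) (simp flip: zero_prod_def)
    then have "norm (?T h - E w) \<le> (\<Sum>i<Suc n. norm (?T (real (Suc i) * \<delta> n) - ?T (real i * \<delta> n)))"
      by (simp only: norm_sum)
    also have "\<dots> = real (Suc n) * norm (?T (\<delta> n) - E w)" by (simp only: step) simp
    finally have "norm (?T h - E w) / h \<le> real (Suc n) * norm (?T (\<delta> n) - E w) / h"
      using h by (intro divide_right_mono) auto
    also have "\<dots> = norm (?T (\<delta> n) - E w) / \<delta> n"
      using \<delta>(1,3)[of n] h by (simp add: \<delta>_def)
    finally show ?thesis unfolding E_dq[OF w] using h \<delta>(1)[of n] by simp
  qed
  have "(\<lambda>n. E (dq (\<delta> n) w)) \<longlonglongrightarrow> E (partial (1, 0) w)"
  proof (rule dq_tendsto[where B = h])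
    show "\<delta> \<longlonglongrightarrow> 0" unfolding \<delta>_def
      using tendsto_mult_right_zero[OF LIMSEQ_inverse_real_of_nat, of h] by (simp add: divide_inverse)
    show "\<delta> k \<noteq> 0" "\<bar>\<delta> k\<bar> \<le> h" for k using \<delta>(1,2)[of k] by auto
  qed (use w in simp)
  then show ?thesis by (intro LIMSEQ_le_const[OF tendsto_norm]) (use le in auto)
qed

text \<open>A backward quotient is the translate of a forward one, and translation preserves the
  norm.\<close>

lemma norm_dq_minus:
  assumes w: "w \<in> QP"
  shows "norm (E (dq (-h) w)) = norm (E (dq h w))"
proof -
  have "dq (-h) w = (\<lambda>x. dq h w (x + (-h, 0)))"
  proof
    fix x :: "real \<times> real"
    have e: "x + (-h, 0) + (h, 0) = x" by (cases x) simp
    show "dq (-h) w x = dq h w (x + (-h, 0))"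
      unfolding dq_def e by (simp add: scaleR_diff_right)
  qed
  then show ?thesis using norm_translate[OF QP_dq[OF w], of h "-h"] by simp
qed

lemma dq_convergent:
  assumes w: "\<And>j. w j \<in> QP" and lim: "(\<lambda>j. E (w j)) \<longlonglongrightarrow> X"
  obtains Z where "(\<lambda>j. E (dq h (w j))) \<longlonglongrightarrow> Z"
proof -
  have cau: "Cauchy (\<lambda>j. E (w j))" by (rule LIMSEQ_imp_Cauchy[OF lim])
  define K where "K = 2 / \<bar>h\<bar> + 1"
  have K0: "K > 0" unfolding K_def by (intro add_nonneg_pos) auto
  have "Cauchy (\<lambda>j. E (dq h (w j)))"
  proof (rule CauchyI)
    fix e :: real assume e: "e > 0"
    then obtain M where M: "\<And>m n. m \<ge> M \<Longrightarrow> n \<ge> M \<Longrightarrow> norm (E (w m) - E (w n)) < e / K"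
      using CauchyD[OF cau, of "e / K"] K0 by auto
    have "norm (E (dq h (w m)) - E (dq h (w n))) < e" if "m \<ge> M" "n \<ge> M" for m n
    proof -
      have d: "(\<lambda>x. w m x - w n x) \<in> QP" by (intro QP_diff w)
      have "E (dq h (w m)) - E (dq h (w n)) = E (dq h (\<lambda>x. w m x - w n x))"
        using QP_dq[OF w] by (subst toL_diff[symmetric]) (simp_all add: dq_def[abs_def] algebra_simps)
      also have "norm \<dots> \<le> 2 / \<bar>h\<bar> * norm (E (\<lambda>x. w m x - w n x))" by (rule norm_dq_le[OF d])
      also have "\<dots> \<le> K * norm (E (\<lambda>x. w m x - w n x))"
        unfolding K_def by (intro mult_right_mono) auto
      also have "E (\<lambda>x. w m x - w n x) = E (w m) - E (w n)" using w by (simp add: toL_diff)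
      also have "K * norm (E (w m) - E (w n)) < K * (e / K)" using M[OF that] K0 by (intro mult_strict_left_mono)
      finally show ?thesis using K0 by simp
    qed
    then show "\<exists>M. \<forall>m\<ge>M. \<forall>n\<ge>M. norm (E (dq h (w m)) - E (dq h (w n))) < e" by blast
  qed
  then show ?thesis using that Cauchy_convergent convergentD by blast
qed

text \<open>Differencing commutes with partial derivatives, so the three components converge
  separately.\<close>

lemma jet_dq_convergent:
  assumes w: "\<And>j. w j \<in> QP" and lim: "(\<lambda>j. jet (w j)) \<longlonglongrightarrow> X"
  obtains Z where "(\<lambda>j. jet (dq h (w j))) \<longlonglongrightarrow> Z"
proof -
  have l: "(\<lambda>j. E (w j)) \<longlonglongrightarrow> fst X" "(\<lambda>j. E (partial (1, 0) (w j))) \<longlonglongrightarrow> fst (snd X)"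
    "(\<lambda>j. E (partial (0, 1) (w j))) \<longlonglongrightarrow> snd (snd X)"
    using tendsto_fst[OF lim] tendsto_fst[OF tendsto_snd[OF lim]] tendsto_snd[OF tendsto_snd[OF lim]]
    by (simp_all add: jet_def)
  have p: "\<And>j. partial (1, 0) (w j) \<in> QP" "\<And>j. partial (0, 1) (w j) \<in> QP"
    using QP_partial w by auto
  obtain Z0 where Z0: "(\<lambda>j. E (dq h (w j))) \<longlonglongrightarrow> Z0" using dq_convergent[OF w l(1)] by blast
  obtain Z1 where Z1: "(\<lambda>j. E (dq h (partial (1, 0) (w j)))) \<longlonglongrightarrow> Z1" using dq_convergent[OF p(1) l(2)] by blast
  obtain Z2 where Z2: "(\<lambda>j. E (dq h (partial (0, 1) (w j)))) \<longlonglongrightarrow> Z2" using dq_convergent[OF p(2) l(3)] by blast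
  have "(\<lambda>j. jet (dq h (w j))) \<longlonglongrightarrow> (Z0, Z1, Z2)"
    unfolding jet_def using Z0 Z1 Z2 w by (intro tendsto_Pair) (simp_all add: partial_dq)
  then show ?thesis by (rule that)
qed

end

subsection \<open>The energy estimate for difference quotients\<close>

text \<open>Propagating modes make \<open>\<i> * beta \<kappa> e s\<close> imaginary, evanescent
  ones make it real and nonpositive.\<close>

lemma Re_i_beta_le_0: "Re (\<i> * beta \<kappa> e s) \<le> 0"
  by (auto simp: beta_def not_less mult.assoc[symmetric])

context qpcell
begin

abbreviation eb where "eb n \<equiv> EG (\<lambda>t. hexp (a n) (t, 0))"

lemma fourier_coeff_eq:
  assumes "\<phi> \<in> L2 \<Gamma>"
  shows "fourier_coeff Lx a \<phi> n = cin (EG \<phi>) (eb n) / of_real Lx"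
proof -
  have "cin (EG \<phi>) (eb n) = (\<integral>t. \<phi> t * cnj (hexp (a n) (t, 0)) \<partial>lebesgue_on \<Gamma>)"
    using assms continuous_trace[OF C_infinity_hexp] by (simp add: cin_toL)
  also have "(\<lambda>t. \<phi> t * cnj (hexp (a n) (t, 0))) = (\<lambda>t. \<phi> t * exp (- \<i> * of_real (a n * t)))"
    by (rule ext) (simp add: hexp_def exp_cnj)
  finally show ?thesis by (simp add: fourier_coeff_def)
qed

text \<open>The product with the conjugate exponential is periodic, so the shift can be moved onto
  the exponential, where it becomes a factor.\<close>

lemma coeff_translate:
  assumes w: "w \<in> QP"
  shows "cin (EG (\<lambda>t. w ((t, s) + (h, 0)))) (eb n) = exp (\<i> * of_real (a n * h)) * cin (EG (\<lambda>t. w (t, s))) (eb n)"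
proof -
  have ce: "continuous_on UNIV (\<lambda>t. hexp (a n) (t, 0))" by (rule continuous_trace[OF C_infinity_hexp])
  have cw: "continuous_on UNIV (\<lambda>t. w (t, s))" using w by (intro continuous_trace) simp
  have cw': "continuous_on UNIV (\<lambda>t. w ((t, s) + (h, 0)))"
    using continuous_trace[OF QP_smooth[OF QP_translate[OF w, of h]], of s] .
  have cp: "continuous_on UNIV (\<lambda>t. w (t, s) * cnj (hexp (a n) (t, 0)))"
    by (intro continuous_intros cw ce)
  have "cin (EG (\<lambda>t. w ((t, s) + (h, 0)))) (eb n) = integral {0..Lx} (\<lambda>t. w ((t, s) + (h, 0)) * cnj (hexp (a n) (t, 0)))"
    using ce cw' by (simp add: cin_toL integral_Gamma continuous_intros)
  also have "(\<lambda>t. w ((t, s) + (h, 0)) * cnj (hexp (a n) (t, 0)))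
    = (\<lambda>t. exp (\<i> * of_real (a n * h)) * (w (t + h, s) * cnj (hexp (a n) (t + h, s))))"
  proof
    fix t
    have "hexp (a n) (t + h, s) = exp (\<i> * of_real (a n * t)) * exp (\<i> * of_real (a n * h))"
      by (simp add: hexp_def distrib_left distrib_right flip: exp_add)
    moreover have "exp (\<i> * of_real (a n * h)) * cnj (exp (\<i> * of_real (a n * h))) = 1"
      by (simp add: exp_cnj flip: exp_add)
    ultimately show "w ((t, s) + (h, 0)) * cnj (hexp (a n) (t, 0))
      = exp (\<i> * of_real (a n * h)) * (w (t + h, s) * cnj (hexp (a n) (t + h, s)))"
      by (simp add: hexp_def)
  qed
  also have "integral {0..Lx} \<dots> = exp (\<i> * of_real (a n * h)) * integral {0..Lx} (\<lambda>t. w (t + h, s) * cnj (hexp (a n) (t + h, s)))"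
    by (rule integral_mult_right)
  also have "integral {0..Lx} (\<lambda>t. w (t + h, s) * cnj (hexp (a n) (t + h, s))) = integral {0..Lx} (\<lambda>t. w (t, s) * cnj (hexp (a n) (t, 0)))"
    unfolding QP_trace_product[OF w] by (simp add: hexp_def)
  also have "\<dots> = cin (EG (\<lambda>t. w (t, s))) (eb n)"
    using ce cw cp by (simp add: cin_toL integral_Gamma)
  finally show ?thesis .
qed

lemma coeff_dq:
  assumes w: "w \<in> QP"
  shows "cin (EG (\<lambda>t. dq h w (t, s))) (eb n) = of_real (1 / h) * (exp (\<i> * of_real (a n * h)) - 1) * cin (EG (\<lambda>t. w (t, s))) (eb n)"
proof -
  have c: "(\<lambda>t. w (t, s)) \<in> L2 \<Gamma>" "(\<lambda>t. w ((t, s) + (h, 0))) \<in> L2 \<Gamma>"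
    using continuous_trace[OF QP_smooth[OF QP_translate[OF w, of h]], of s] w by auto
  have "EG (\<lambda>t. dq h w (t, s)) = (1 / h) *\<^sub>R (EG (\<lambda>t. w ((t, s) + (h, 0))) - EG (\<lambda>t. w (t, s)))"
    unfolding dq_def using c by (simp only: toL_scaleR toL_diff L2_diff Gamma_sets)
  then show ?thesis
    using coeff_translate[OF w, of s h n]
    by (simp only: cin.scaleR_left cin.diff_left scaleR_conv_of_real) (simp only: left_diff_distrib mult_1 mult.assoc)
qed

text \<open>The Fourier multiplier of \<open>dq (-h) (dq h w)\<close>; its sign makes the boundary terms in the energy
  estimate nonnegative.\<close>

definition second_diff_mult :: "real \<Rightarrow> int \<Rightarrow> real" where
  "second_diff_mult h n = - (2 - 2 * cos (a n * h)) / h\<^sup>2"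

lemma second_diff_mult_le_0: "second_diff_mult h n \<le> 0"
  using cos_le_one[of "a n * h"] by (simp add: second_diff_mult_def divide_le_0_iff)

text \<open>The factors of the forward and backward quotients are conjugate to each other, so their
  product is the squared modulus of \<open>exp (\<i> * of_real (a n * h)) - 1\<close>; the minus
  sign comes from \<open>1 / - h\<close>.\<close>

lemma coeff_second_difference:
  assumes w: "w \<in> QP" and h: "h \<noteq> 0"
  shows "cin (EG (\<lambda>t. dq (-h) (dq h w) (t, s))) (eb n) = of_real (second_diff_mult h n) * cin (EG (\<lambda>t. w (t, s))) (eb n)"
proof -
  let ?e = "exp (\<i> * of_real (a n * h))"
  have e: "exp (\<i> * of_real (a n * - h)) = cnj ?e" by (simp add: exp_cnj)
  have 1: "?e * cnj ?e = 1" by (simp add: exp_cnj flip: exp_add)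
  have 2: "?e + cnj ?e = of_real (2 * cos (a n * h))"
    by (subst complex_add_cnj) (simp add: Re_exp)
  have "(cnj ?e - 1) * (?e - 1) = ?e * cnj ?e - (?e + cnj ?e) + 1" by (simp add: algebra_simps)
  also have "\<dots> = of_real (2 - 2 * cos (a n * h))" unfolding 1 2 by simp
  finally have 3: "(cnj ?e - 1) * (?e - 1) = of_real (2 - 2 * cos (a n * h))" .
  have "cin (EG (\<lambda>t. dq (-h) (dq h w) (t, s))) (eb n)
      = of_real (1 / - h) * of_real (1 / h) * ((cnj ?e - 1) * (?e - 1)) * cin (EG (\<lambda>t. w (t, s))) (eb n)"
    unfolding coeff_dq[OF QP_dq[OF w]] coeff_dq[OF w] e by (simp only: mult_ac)
  also have "of_real (1 / - h) * of_real (1 / h) * ((cnj ?e - 1) * (?e - 1)) = complex_of_real (second_diff_mult h n)"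
    unfolding 3 of_real_mult[symmetric] of_real_eq_iff using h by (simp add: second_diff_mult_def power2_eq_square field_simps)
  finally show ?thesis .
qed

text \<open>Each mode contributes the nonpositive multiplier \<open>r n\<close>, the nonpositive
  real part of \<open>\<i> * beta \<kappa> e (a n)\<close> and a squared modulus.\<close>

lemma dual_nonneg:
  assumes co: "\<And>n. fourier_coeff Lx a \<psi> n = of_real (r n) * fourier_coeff Lx a \<phi> n" and r: "\<And>n. r n \<le> 0"
    and e: "e > 0"
  shows "0 \<le> Re (duality Lx a (DtN Lx a \<kappa> e \<phi>) \<psi>)"
proof -
  let ?f = "\<lambda>n. DtN Lx a \<kappa> e \<phi> n * cnj (fourier_coeff Lx a \<psi> n)"
  have nn: "0 \<le> Re (?f n)" for n
  proof -
    let ?c = "fourier_coeff Lx a \<phi> n"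
    have "?f n = of_real (r n / e) * (\<i> * beta \<kappa> e (a n)) * (?c * cnj ?c)"
      by (simp add: DtN_def co mult_ac)
    also have "\<dots> = of_real (r n / e * (norm ?c)\<^sup>2) * (\<i> * beta \<kappa> e (a n))"
      unfolding mult_cnj_eq_norm_power by (simp add: mult_ac)
    finally have "Re (?f n) = (r n / e * (norm ?c)\<^sup>2) * Re (\<i> * beta \<kappa> e (a n))"
      by (simp only: Re_complex_of_real Re_divide_of_real times_complex.sel Im_complex_of_real mult_zero_left diff_zero)
    moreover have "r n / e * (norm ?c)\<^sup>2 \<le> 0"
      using r[of n] e by (intro mult_nonpos_nonneg divide_nonpos_pos) auto
    ultimately show ?thesis using Re_i_beta_le_0[of \<kappa> e "a n"] by (simp only: mult_nonpos_nonpos)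
  qed
  have "0 \<le> Re (\<Sum>\<^sub>\<infinity>n. ?f n)"
  proof (cases "?f summable_on UNIV")
    case True
    then have "Re (\<Sum>\<^sub>\<infinity>n. ?f n) = (\<Sum>\<^sub>\<infinity>n. Re (?f n))" by (rule infsum_Re[symmetric])
    then show ?thesis using nn by (simp only: infsum_nonneg)
  \<comment> \<open>Without summability the sum has the default value 0, so the sign holds without
    any decay of the coefficients.\<close>
  qed (simp add: infsum_not_exists)
  then show ?thesis unfolding duality_def using Lx by simp
qed

lemma Re_cin_lower:
  assumes f: "f \<in> L2 \<Omega>" and c: "continuous_on UNIV c" and m: "\<And>x. x \<in> \<Omega> \<Longrightarrow> m \<le> c x"
  shows "m * (norm (E f))\<^sup>2 \<le> Re (cin (M (\<lambda>x. complex_of_real (c x)) (E f)) (E f))"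
proof -
  have cc: "continuous_on UNIV (\<lambda>x. complex_of_real (c x))" by (intro continuous_intros c)
  have L: "(\<lambda>x. complex_of_real (c x) * f x) \<in> L2 \<Omega>"
    by (intro L2_mult(1) restr_bmeas_continuous cc f) auto
  have i1: "integrable (lebesgue_on \<Omega>) (\<lambda>x. c x * (norm (f x))\<^sup>2)"
  proof -
    have "integrable (lebesgue_on \<Omega>) (\<lambda>x. Re ((complex_of_real (c x) * f x) * cnj (f x)))"
      by (intro integrable_Re integrable_mult_cnj L f) auto
    also have "(\<lambda>x. Re ((complex_of_real (c x) * f x) * cnj (f x))) = (\<lambda>x. c x * (norm (f x))\<^sup>2)"
      by (rule ext) (simp only: mult.assoc mult_cnj_eq_norm_power of_real_mult[symmetric] Re_complex_of_real)
    finally show ?thesis .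
  qed
  have i2: "integrable (lebesgue_on \<Omega>) (\<lambda>x. (norm (f x))\<^sup>2)" using f by (simp add: L2_def)
  have "m * (norm (E f))\<^sup>2 = (\<integral>x. m * (norm (f x))\<^sup>2 \<partial>lebesgue_on \<Omega>)"
    using f by (simp add: norm_toL)
  also have "\<dots> \<le> (\<integral>x. c x * (norm (f x))\<^sup>2 \<partial>lebesgue_on \<Omega>)"
    by (intro integral_mono i1 integrable_mult_right i2 mult_right_mono m) auto
  also have "\<dots> = Re (complex_of_real \<dots>)" by simp
  also have "complex_of_real (\<integral>x. c x * (norm (f x))\<^sup>2 \<partial>lebesgue_on \<Omega>) = (\<integral>x. (complex_of_real (c x) * f x) * cnj (f x) \<partial>lebesgue_on \<Omega>)"
    by (simp only: mult.assoc mult_cnj_eq_norm_power of_real_mult[symmetric] integral_complex_of_real)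
  also have "\<dots> = cin (M (\<lambda>x. complex_of_real (c x)) (E f)) (E f)"
    by (subst E_mult[OF cc f, symmetric]) (simp add: cin_toL L f)
  finally show ?thesis .
qed

text \<open>Moving one difference over to \<open>p\<close> times \<open>f\<close> and applying the
  discrete product rule splits off the translate of \<open>p\<close> times the squared modulus of
  \<open>dq h f\<close>, which is coercive; the remaining term carries a difference of the
  coefficient and is of lower order.\<close>

lemma dq_coefficient_estimate:
  assumes f: "f \<in> QP" and p: "C_infinity p" and per: "\<And>t s. p (t + Lx, s) = p (t, s)"
    and m: "\<And>x. x \<in> \<Omega> \<Longrightarrow> m \<le> p (x + (h, 0))" and K: "\<And>x. x \<in> \<Omega> \<Longrightarrow> \<bar>dq h p x\<bar> \<le> K" "0 \<le> K"
  shows "Re (cin (M (\<lambda>x. complex_of_real (p x)) (E f)) (E (dq (-h) (dq h f))))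
    \<le> - m * (norm (E (dq h f)))\<^sup>2 + 2 * K * (norm (E f) * norm (E (dq h f)))"
proof -
  let ?P = "\<lambda>x. complex_of_real (p x)" and ?g = "dq h f"
  have P: "C_infinity ?P" by (rule C_infinity_of_real[OF p])
  have Pf: "(\<lambda>x. ?P x * f x) \<in> QP" by (rule QP_mult[OF f P]) (simp only: per)
  have g: "?g \<in> QP" by (rule QP_dq[OF f])
  have dP: "C_infinity (dq h p)" by (rule C_infinity_dq[OF p])
  have e1: "dq h (\<lambda>x. ?P x * f x) = (\<lambda>x. complex_of_real (p (x + (h, 0))) * ?g x + complex_of_real (dq h p x) * f x)"
    by (rule ext) (simp add: dq_mult, simp add: dq_def scaleR_conv_of_real)
  have c1: "C_infinity (\<lambda>x. p (x + (h, 0)))" by (rule C_infinity_translate[OF p])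
  have cc: "continuous_on UNIV (\<lambda>x. complex_of_real (p (x + (h, 0))))" "continuous_on UNIV (\<lambda>x. complex_of_real (dq h p x))"
    by (intro C_infinity_continuous C_infinity_of_real c1 dP)+
  have "cin (M ?P (E f)) (E (dq (-h) ?g)) = cin (E (\<lambda>x. ?P x * f x)) (E (dq (-h) ?g))"
    by (simp only: E_mult[OF C_infinity_continuous[OF P] smooth_L2(1)[OF QP_smooth[OF f]]])
  also have "\<dots> = - cin (E (dq h (\<lambda>x. ?P x * f x))) (E ?g)" by (simp add: dq_adjoint[OF Pf g])
  also have "E (dq h (\<lambda>x. ?P x * f x)) = M (\<lambda>x. complex_of_real (p (x + (h, 0)))) (E ?g) + M (\<lambda>x. complex_of_real (dq h p x)) (E f)"
    unfolding e1 E_mult[OF cc(1) smooth_L2(1)[OF QP_smooth[OF g]], symmetric] E_mult[OF cc(2) smooth_L2(1)[OF QP_smooth[OF f]], symmetric]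
    by (intro toL_add Omega_sets smooth_L2 C_infinity_mult C_infinity_of_real c1 dP QP_smooth f g)
  finally have eq: "cin (M ?P (E f)) (E (dq (-h) ?g))
    = - (cin (M (\<lambda>x. complex_of_real (p (x + (h, 0)))) (E ?g)) (E ?g) + cin (M (\<lambda>x. complex_of_real (dq h p x)) (E f)) (E ?g))"
    by (simp only: cin.add_left)
  have l: "m * (norm (E ?g))\<^sup>2 \<le> Re (cin (M (\<lambda>x. complex_of_real (p (x + (h, 0)))) (E ?g)) (E ?g))"
    by (rule Re_cin_lower) (use g C_infinity_continuous[OF c1] m in auto)
  have "norm (cin (M (\<lambda>x. complex_of_real (dq h p x)) (E f)) (E ?g)) \<le> 2 * (norm (M (\<lambda>x. complex_of_real (dq h p x)) (E f)) * norm (E ?g))"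
    by (rule norm_cin_le)
  also have "\<dots> \<le> 2 * ((K * norm (E f)) * norm (E ?g))"
    by (intro mult_left_mono mult_right_mono norm_M_le cc) (use K in auto)
  finally have u: "\<bar>Re (cin (M (\<lambda>x. complex_of_real (dq h p x)) (E f)) (E ?g))\<bar> \<le> 2 * K * (norm (E f) * norm (E ?g))"
    using abs_Re_le_cmod[of "cin (M (\<lambda>x. complex_of_real (dq h p x)) (E f)) (E ?g)"] by (simp add: mult_ac)
  show ?thesis unfolding eq using l u by (simp add: abs_le_iff)
qed

text \<open>The volume part of the form, tested with the second difference: the gradient terms are
  coercive in \<open>dq h w\<close> with reversed sign, and the zero-order term turns into
  \<open>\<kappa>\<^sup>2\<close> times the squared norm of \<open>dq h w\<close>.\<close>

lemma smooth_energy: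
  assumes w: "w \<in> QP" and p: "C_infinity p" and per: "\<And>t s. p (t + Lx, s) = p (t, s)"
    and m: "\<And>x. x \<in> \<Omega> \<Longrightarrow> m \<le> p (x + (h, 0))" and K: "\<And>x. x \<in> \<Omega> \<Longrightarrow> \<bar>dq h p x\<bar> \<le> K" "0 \<le> K"
  defines "Y \<equiv> jet (dq (-h) (dq h w))" and "Z \<equiv> jet (dq h w)" and "X \<equiv> jet w"
  shows "Re (cin (M (\<lambda>x. complex_of_real (p x)) (fst (snd X))) (fst (snd Y))
      + cin (M (\<lambda>x. complex_of_real (p x)) (snd (snd X))) (snd (snd Y)) - of_real (\<kappa>\<^sup>2) * cin (fst X) (fst Y))
    \<le> - m * ((norm (fst (snd Z)))\<^sup>2 + (norm (snd (snd Z)))\<^sup>2)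
      + 2 * K * (norm (fst (snd X)) * norm (fst (snd Z)) + norm (snd (snd X)) * norm (snd (snd Z)))
      + \<kappa>\<^sup>2 * (norm (fst Z))\<^sup>2"
proof -
  have c: "C_infinity w" "C_infinity (dq h w)" using w QP_dq[OF w] by auto
  have e: "partial b (dq (-h) (dq h w)) = dq (-h) (dq h (partial b w))" "partial b (dq h w) = dq h (partial b w)" for b
    using c by (simp_all add: partial_dq)
  have p1: "partial (1, 0) w \<in> QP" "partial (0, 1) w \<in> QP" using QP_partial[OF w] by auto
  have z: "cin (E w) (E (dq (-h) (dq h w))) = - of_real ((norm (E (dq h w)))\<^sup>2)"
    using dq_adjoint[OF w QP_dq[OF w, of h], of h] unfolding cin_self by (simp only: minus_minus)
  have 3: "Re (of_real (\<kappa>\<^sup>2) * cin (E w) (E (dq (-h) (dq h w)))) = - \<kappa>\<^sup>2 * (norm (E (dq h w)))\<^sup>2"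
    unfolding z mult_minus_right of_real_mult[symmetric] by (simp only: uminus_complex.sel Re_complex_of_real mult_minus_left)
  show ?thesis
    unfolding Y_def Z_def X_def jet_def fst_conv snd_conv e minus_complex.sel plus_complex.sel 3
    using dq_coefficient_estimate[OF p1(1) p per m K] dq_coefficient_estimate[OF p1(2) p per m K]
    by (simp add: distrib_left right_diff_distrib)
qed

end

subsection \<open>Regularity in the tangential direction\<close>

text \<open>If the sum \<open>S\<close> exceeds 1, then \<open>B \<le> B * S\<close>, and dividing
  by \<open>S\<close> leaves a linear bound. The factor 2 comes from
  \<open>(N1 + N2)\<^sup>2 \<le> 2 * (N1\<^sup>2 + N2\<^sup>2)\<close>.\<close>

lemma energy_bound_aux:
  fixes N1 N2 :: real
  assumes le: "m * (N1\<^sup>2 + N2\<^sup>2) \<le> A * (N1 + N2) + B" and m: "m > 0" and n: "N1 \<ge> 0" "N2 \<ge> 0" and AB: "A \<ge> 0" "B \<ge> 0"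
  shows "N1 + N2 \<le> max 1 (2 * (A + B) / m)"
proof (cases "N1 + N2 \<le> 1")
  case False
  define S where "S = N1 + N2"
  have S: "S > 1" using False by (simp add: S_def)
  have "S * S \<le> 2 * (N1\<^sup>2 + N2\<^sup>2)"
    using sum_squares_bound[of N1 N2] by (simp add: S_def power2_eq_square algebra_simps)
  then have "m / 2 * (S * S) \<le> m / 2 * (2 * (N1\<^sup>2 + N2\<^sup>2))" using m by (intro mult_left_mono) auto
  also have "m / 2 * (2 * (N1\<^sup>2 + N2\<^sup>2)) = m * (N1\<^sup>2 + N2\<^sup>2)" by (simp add: field_simps)
  also have "\<dots> \<le> A * S + B" using le by (simp add: S_def)
  also have "\<dots> \<le> A * S + B * S" using S AB mult_left_mono[of 1 S B] by simp
  finally have "(m / 2 * S) * S \<le> (A + B) * S" by (simp add: algebra_simps)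
  then have "m / 2 * S \<le> A + B" using S by (simp add: mult_le_cancel_right)
  then have "S \<le> 2 * (A + B) / m" using m by (simp add: field_simps)
  then show ?thesis by (simp add: S_def)
qed simp

context qpcell
begin

lemma M_one_E: "f \<in> L2 \<Omega> \<Longrightarrow> M (\<lambda>x. 1) (E f) = E f"
  by (subst E_mult[symmetric]) auto

lemma ibp1:
  assumes X: "X \<in> closure (jet ` QP)" and \<psi>: "\<psi> \<in> QP"
  shows "cin (fst (snd X)) (E \<psi>) = - cin (fst X) (E (partial (1, 0) \<psi>))"
proof (rule closure_image_eq[OF _ _ _ X])
  fix X assume "X \<in> jet ` QP"
  then obtain w where w: "w \<in> QP" "X = jet w" by blast
  have c1: "C_infinity (\<lambda>x::real \<times> real. 1::complex)" by (rule C_infinity_const)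
  have p: "partial (1, 0) (\<lambda>x::real \<times> real. 1::complex) = (\<lambda>x. 0)"
    by (rule ext) (simp add: partial_eq[OF has_derivative_const])
  have "w (Lx, s) * cnj (\<psi> (Lx, s)) = w (0, s) * cnj (\<psi> (0, s))" for s
    using QP_product_periodic[OF w(1) \<psi>, of 0 s] by simp
  then have "cin (M (\<lambda>x. 0) (E w)) (E \<psi>) + cin (M (\<lambda>x. 1) (E (partial (1, 0) w))) (E \<psi>)
      + cin (M (\<lambda>x. 1) (E w)) (E (partial (1, 0) \<psi>)) = 0"
    using smooth_green1[OF c1 QP_smooth[OF w(1)] QP_smooth[OF \<psi>]] unfolding p by simp
  moreover have "M (\<lambda>x. 0) (E w) = 0"
    using w by (subst E_mult[symmetric]) (auto simp: toL_zero)
  ultimately show "cin (fst (snd X)) (E \<psi>) = - cin (fst X) (E (partial (1, 0) \<psi>))"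
    using w by (simp add: jet_def M_one_E cin.zero_left eq_neg_iff_add_eq_0)
qed (intro continuous_intros)+

text \<open>Test functions that vanish on both edges make the boundary terms disappear, whatever the
  traces of \<open>X\<close> are.\<close>

lemma ibp2:
  assumes X: "X \<in> closure (jet ` QP)" and \<psi>: "\<psi> \<in> QP" "\<And>t. \<psi> (t, H) = 0" "\<And>t. \<psi> (t, -H) = 0"
  shows "cin (snd (snd X)) (E \<psi>) = - cin (fst X) (E (partial (0, 1) \<psi>))"
proof (rule closure_image_eq[OF _ _ _ X])
  fix X assume "X \<in> jet ` QP"
  then obtain w where w: "w \<in> QP" "X = jet w" by blast
  have c1: "C_infinity (\<lambda>x::real \<times> real. 1::complex)" by (rule C_infinity_const)
  have p: "partial (0, 1) (\<lambda>x::real \<times> real. 1::complex) = (\<lambda>x. 0)"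
    by (rule ext) (simp add: partial_eq[OF has_derivative_const])
  have "cin (M (\<lambda>x. 0) (E w)) (E \<psi>) + cin (M (\<lambda>x. 1) (E (partial (0, 1) w))) (E \<psi>)
      + cin (M (\<lambda>x. 1) (E w)) (E (partial (0, 1) \<psi>)) = 0"
    using smooth_green2[OF c1 QP_smooth[OF w(1)] QP_smooth[OF \<psi>(1)]] unfolding p \<psi>(2,3)
    by (simp add: toL_zero cin.zero_right)
  moreover have "M (\<lambda>x. 0) (E w) = 0"
    using w by (subst E_mult[symmetric]) (auto simp: toL_zero)
  ultimately show "cin (snd (snd X)) (E \<psi>) = - cin (fst X) (E (partial (0, 1) \<psi>))"
    using w by (simp add: jet_def M_one_E cin.zero_left eq_neg_iff_add_eq_0)
qed (intro continuous_intros)+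

lemma range_diff:
  assumes "X \<in> E ` L2 \<Omega>" "Y \<in> E ` L2 \<Omega>"
  shows "X - Y \<in> E ` L2 \<Omega>"
proof -
  obtain f g where f: "f \<in> L2 \<Omega>" "X = E f" and g: "g \<in> L2 \<Omega>" "Y = E g" using assms by blast
  have "X - Y = E (\<lambda>x. f x - g x)" using f g by (simp add: toL_diff)
  then show ?thesis using L2_diff[OF Omega_sets(1) f(1) g(1)] by blast
qed

lemma fourier_coeff_trace:
  assumes v: "v \<in> H1 \<Omega>" and S: "(wjet v, S) \<in> closure (graph ` QP)"
  shows "fourier_coeff Lx a (bd_trace Lx H H v) n = cin (fst S) (eb n) / of_real Lx"
    "fourier_coeff Lx a (bd_trace Lx H (-H) v) n = cin (snd S) (eb n) / of_real Lx"
proof -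
  have "(wjet v, S) \<in> closure (graph ` {w. C_infinity w})" using S closure_graph_subset by blast
  note b = bd_trace_eq[OF v this]
  show "fourier_coeff Lx a (bd_trace Lx H H v) n = cin (fst S) (eb n) / of_real Lx"
    "fourier_coeff Lx a (bd_trace Lx H (-H) v) n = cin (snd S) (eb n) / of_real Lx"
    using b by (simp_all add: fourier_coeff_eq)
qed

end

locale helmholtz = qpcell +
  fixes \<kappa> \<epsilon>p \<epsilon>m :: real and \<epsilon> :: "real \<times> real \<Rightarrow> real" and u F :: "real \<times> real \<Rightarrow> complex"
  assumes eps_pm: "\<epsilon>p > 0" "\<epsilon>m > 0"
    and eps_smooth: "C_infinity \<epsilon>" and eps_pos: "\<And>x. \<epsilon> x > 0" and eps_per: "\<And>t s. \<epsilon> (t + Lx, s) = \<epsilon> (t, s)"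
    and F: "F \<in> L2 \<Omega>" and u: "u \<in> H1qp Lx H a"
    and weak: "\<And>v. v \<in> H1qp Lx H a \<Longrightarrow>
      B_form Lx H a \<kappa> \<epsilon>p \<epsilon>m \<epsilon> u v = - (\<integral>x. F x * cnj (v x) \<partial>lebesgue_on \<Omega>)"
begin

definition p where "p x = 1 / \<epsilon> x"

abbreviation P where "P \<equiv> \<lambda>x. complex_of_real (p x)"

abbreviation X where "X \<equiv> wjet u"

lemma p_smooth: "C_infinity p"
  using C_infinity_inverse[OF eps_smooth] eps_pos by (simp add: p_def[abs_def] divide_inverse less_imp_neq[symmetric])

lemma P_smooth: "C_infinity P"
  by (rule C_infinity_of_real[OF p_smooth])

lemma p_per: "p (t + Lx, s) = p (t, s)"
  by (simp add: p_def eps_per)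

lemma p_pos: "p x > 0"
  by (simp add: p_def eps_pos)

lemma u_H1: "u \<in> H1 \<Omega>" and X_closure: "X \<in> closure (jet ` QP)"
  using u by (simp_all add: H1qp_iff)

lemma B_form_eq:
  assumes v: "v \<in> H1 \<Omega>"
  shows "B_form Lx H a \<kappa> \<epsilon>p \<epsilon>m \<epsilon> u v
    = cin (M P (fst (snd X))) (fst (snd (wjet v))) + cin (M P (snd (snd X))) (snd (snd (wjet v)))
      - of_real (\<kappa>\<^sup>2) * cin (fst X) (fst (wjet v))
      - duality Lx a (DtN Lx a \<kappa> \<epsilon>m (bd_trace Lx H (- H) u)) (bd_trace Lx H (- H) v)
      - duality Lx a (DtN Lx a \<kappa> \<epsilon>p (bd_trace Lx H H u)) (bd_trace Lx H H v)"
proof -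
  note u' = H1_weak_partial[OF u_H1] and v' = H1_weak_partial[OF v]
  let ?u1 = "weak_partial \<Omega> (1, 0) u" and ?u2 = "weak_partial \<Omega> (0, 1) u"
  let ?v1 = "weak_partial \<Omega> (1, 0) v" and ?v2 = "weak_partial \<Omega> (0, 1) v"
  have cP: "continuous_on UNIV P" by (rule C_infinity_continuous[OF P_smooth])
  have L: "(\<lambda>x. P x * ?u1 x) \<in> L2 \<Omega>" "(\<lambda>x. P x * ?u2 x) \<in> L2 \<Omega>" "(\<lambda>x. of_real (\<kappa>\<^sup>2) * u x) \<in> L2 \<Omega>"
    using u' cP by (auto intro!: L2_mult(1) restr_bmeas_continuous L2_const_mult simp del: of_real_power)
  have "(\<integral>x. of_real (1 / \<epsilon> x) * (?u1 x * cnj (?v1 x) + ?u2 x * cnj (?v2 x)) - of_real (\<kappa>\<^sup>2) * u x * cnj (v x) \<partial>lebesgue_on \<Omega>)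
    = (\<integral>x. ((P x * ?u1 x) * cnj (?v1 x) + (P x * ?u2 x) * cnj (?v2 x)) - (of_real (\<kappa>\<^sup>2) * u x) * cnj (v x) \<partial>lebesgue_on \<Omega>)"
    by (simp only: p_def distrib_left mult.assoc)
  also have "\<dots> = ((\<integral>x. (P x * ?u1 x) * cnj (?v1 x) \<partial>lebesgue_on \<Omega>) + (\<integral>x. (P x * ?u2 x) * cnj (?v2 x) \<partial>lebesgue_on \<Omega>))
      - (\<integral>x. (of_real (\<kappa>\<^sup>2) * u x) * cnj (v x) \<partial>lebesgue_on \<Omega>)"
    by (subst Bochner_Integration.integral_diff Bochner_Integration.integral_add;
      (intro Bochner_Integration.integrable_add integrable_mult_cnj L v' Omega_sets)?)+ (rule refl)
  also have "\<dots> = cin (M P (E ?u1)) (E ?v1) + cin (M P (E ?u2)) (E ?v2) - of_real (\<kappa>\<^sup>2) * cin (E u) (E v)"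
    using u' v' L
    by (simp only: cin_toL[OF Omega_sets(1), symmetric] E_mult[OF cP] toL_const_mult[OF Omega_sets(1)] cin_mulc_const_left)
  finally show ?thesis unfolding B_form_def wjet_def fst_conv snd_conv by (simp only:)
qed

lemma weak_eq:
  assumes v: "v \<in> H1qp Lx H a"
  shows "cin (M P (fst (snd X))) (fst (snd (wjet v))) + cin (M P (snd (snd X))) (snd (snd (wjet v)))
      - of_real (\<kappa>\<^sup>2) * cin (fst X) (fst (wjet v))
    = duality Lx a (DtN Lx a \<kappa> \<epsilon>m (bd_trace Lx H (- H) u)) (bd_trace Lx H (- H) v)
      + duality Lx a (DtN Lx a \<kappa> \<epsilon>p (bd_trace Lx H H u)) (bd_trace Lx H H v)
      - cin (E F) (fst (wjet v))"
proof -
  have vH: "v \<in> H1 \<Omega>" using v by (simp add: H1qp_iff)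
  have "cin (E F) (fst (wjet v)) = (\<integral>x. F x * cnj (v x) \<partial>lebesgue_on \<Omega>)"
    unfolding wjet_def fst_conv by (rule cin_toL[OF Omega_sets(1) F H1_weak_partial(1)[OF vH]])
  then show ?thesis using weak[OF v] unfolding B_form_eq[OF vH] by (simp add: algebra_simps)
qed

text \<open>The identities with test functions identify components of \<open>Z\<close> as difference
  quotients of \<open>u\<close> and of its normal derivative. Testing the equation with the second
  difference of \<open>u\<close> gives a quadratic inequality for the gradient of the quotient whose
  constants do not depend on \<open>h\<close>.\<close>

lemma tangential_bound:
  obtains C where "\<And>h. 0 < h \<Longrightarrow> h \<le> 1 \<Longrightarrow> \<exists>Z\<in>closure (jet ` QP). norm Z \<le> C \<and>
    (\<forall>\<psi>\<in>QP. cin (fst Z) (E \<psi>) = - cin (fst X) (E (dq (-h) \<psi>)) \<and>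
      cin (snd (snd Z)) (E \<psi>) = - cin (snd (snd X)) (E (dq (-h) \<psi>)))"
proof -
  \<comment> \<open>Widened by 1 on both sides to contain all translates by steps
    \<open>h \<le> 1\<close>.\<close>
  let ?box = "cbox (-1, -H) (Lx + 1, H)"
  have "(0, 0) \<in> ?box" using Lx H by (auto simp: cbox_Pair_eq)
  then obtain x0 where x0: "\<And>x. x \<in> ?box \<Longrightarrow> p x0 \<le> p x"
    using continuous_attains_inf[OF compact_cbox _ C_infinity_continuous[OF p_smooth]] by (metis empty_iff)
  define m where "m = p x0"
  have m0: "m > 0" by (simp add: m_def p_pos)
  obtain K where K: "\<And>x. x \<in> ?box \<Longrightarrow> norm (partial (1, 0) p x) \<le> K" and K0: "K \<ge> 0"
    using smooth_partial_bounded[OF p_smooth] by blast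
  define x where "x = norm X"
  define A where "A = 2 * K * x + 2 * norm (E F)"
  define B where "B = \<kappa>\<^sup>2 * x\<^sup>2"
  have x_pos: "x \<ge> 0" by (simp add: x_def)
  have A0: "A \<ge> 0" and B0: "B \<ge> 0" using x_pos K0 by (simp_all add: A_def B_def)
  obtain w where w: "\<And>j. w j \<in> QP" and wX: "(\<lambda>j. jet (w j)) \<longlonglongrightarrow> X"
    using jets_sequence[OF X_closure] by blast
  obtain T where T: "(\<lambda>j. graph (w j)) \<longlonglongrightarrow> (X, T)" "(X, T) \<in> closure (graph ` QP)"
    using jet_trace_exists[OF w wX] by blast
  show ?thesis
  proof (rule that[of "x + max 1 (2 * (A + B) / m)"])
    fix h :: real assume h: "0 < h" "h \<le> 1"
    have wh: "dq h (w j) \<in> QP" "dq (-h) (dq h (w j)) \<in> QP" for j by (intro QP_dq w)+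
    obtain Z where Z: "(\<lambda>j. jet (dq h (w j))) \<longlonglongrightarrow> Z" using jet_dq_convergent[OF w wX] by blast
    obtain Y where Y: "(\<lambda>j. jet (dq (-h) (dq h (w j)))) \<longlonglongrightarrow> Y" using jet_dq_convergent[OF wh(1) Z] by blast
    have Zc: "Z \<in> closure (jet ` QP)"
      unfolding closure_sequential using Z wh by (intro exI[of _ "\<lambda>j. jet (dq h (w j))"] conjI allI imageI)
    have Yc: "Y \<in> closure (jet ` QP)"
      unfolding closure_sequential using Y wh by (intro exI[of _ "\<lambda>j. jet (dq (-h) (dq h (w j)))"] conjI allI imageI)
    obtain S where S: "(\<lambda>j. graph (dq (-h) (dq h (w j)))) \<longlonglongrightarrow> (Y, S)" "(Y, S) \<in> closure (graph ` QP)"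
      using jet_trace_exists[OF wh(2) Y] by blast
    \<comment> \<open>A test function whose jet is the second difference of that of
      \<open>u\<close>. It is obtained from a limit, since difference quotients need functions on
      the whole plane.\<close>
    obtain v where v: "v \<in> H1qp Lx H a" "wjet v = Y" using H1qp_exists[OF Yc] by blast
    have vH: "v \<in> H1 \<Omega>" using v(1) by (simp add: H1qp_iff)
    have tlim: "(\<lambda>j. EG (\<lambda>t. w j (t, H))) \<longlonglongrightarrow> fst T" "(\<lambda>j. EG (\<lambda>t. w j (t, -H))) \<longlonglongrightarrow> snd T"
      using tendsto_fst[OF tendsto_snd[OF T(1)]] tendsto_snd[OF tendsto_snd[OF T(1)]] by (simp_all add: graph_def tr_def)
    have slim: "(\<lambda>j. EG (\<lambda>t. dq (-h) (dq h (w j)) (t, H))) \<longlonglongrightarrow> fst S"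
      "(\<lambda>j. EG (\<lambda>t. dq (-h) (dq h (w j)) (t, -H))) \<longlonglongrightarrow> snd S"
      using tendsto_fst[OF tendsto_snd[OF S(1)]] tendsto_snd[OF tendsto_snd[OF S(1)]] by (simp_all add: graph_def tr_def)
    have coef: "cin S' (eb n) = of_real (second_diff_mult h n) * cin T' (eb n)"
      if "(\<lambda>j. EG (\<lambda>t. w j (t, s))) \<longlonglongrightarrow> T'" "(\<lambda>j. EG (\<lambda>t. dq (-h) (dq h (w j)) (t, s))) \<longlonglongrightarrow> S'" for s S' T' n
    proof (rule LIMSEQ_unique)
      show "(\<lambda>j. cin (EG (\<lambda>t. dq (-h) (dq h (w j)) (t, s))) (eb n)) \<longlonglongrightarrow> cin S' (eb n)"
        by (intro tendsto_cin that(2) tendsto_const)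
      show "(\<lambda>j. cin (EG (\<lambda>t. dq (-h) (dq h (w j)) (t, s))) (eb n)) \<longlonglongrightarrow> of_real (second_diff_mult h n) * cin T' (eb n)"
        unfolding coeff_second_difference[OF w less_imp_neq[OF h(1), symmetric]]
        by (intro tendsto_mult tendsto_const tendsto_cin that(1))
    qed
    \<comment> \<open>The Fourier coefficients of the traces of \<open>v\<close> are those of
      \<open>u\<close> times the nonpositive multiplier of the second difference, which gives both
      boundary terms their sign.\<close>
    have d: "0 \<le> Re (duality Lx a (DtN Lx a \<kappa> \<epsilon>m (bd_trace Lx H (- H) u)) (bd_trace Lx H (- H) v))"
      "0 \<le> Re (duality Lx a (DtN Lx a \<kappa> \<epsilon>p (bd_trace Lx H H u)) (bd_trace Lx H H v))"
      using coef[OF tlim(1) slim(1)] coef[OF tlim(2) slim(2)] second_diff_mult_le_0 eps_pm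
        fourier_coeff_trace[OF u_H1 T(2)] fourier_coeff_trace[OF vH, of S] S(2) v(2)
      by (auto intro!: dual_nonneg[where r = "second_diff_mult h"])
    define G where "G = cin (M P (fst (snd X))) (fst (snd Y)) + cin (M P (snd (snd X))) (snd (snd Y))
      - of_real (\<kappa>\<^sup>2) * cin (fst X) (fst Y)"
    have "Re G = Re (duality Lx a (DtN Lx a \<kappa> \<epsilon>m (bd_trace Lx H (- H) u)) (bd_trace Lx H (- H) v))
      + Re (duality Lx a (DtN Lx a \<kappa> \<epsilon>p (bd_trace Lx H H u)) (bd_trace Lx H H v)) - Re (cin (E F) (fst Y))"
      unfolding G_def weak_eq[OF v(1), unfolded v(2)] by simp
    moreover have "\<bar>Re (cin (E F) (fst Y))\<bar> \<le> 2 * (norm (E F) * norm (fst Y))"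
      using abs_Re_le_cmod norm_cin_le order_trans by blast
    ultimately have G1: "- 2 * (norm (E F) * norm (fst Y)) \<le> Re G" using d by (simp add: abs_le_iff)
    have ju: "\<And>f. fst (jet f) = E f" "\<And>f. fst (snd (jet f)) = E (partial (1, 0) f)" "\<And>f. snd (snd (jet f)) = E (partial (0, 1) f)"
      by (simp_all add: jet_def)
    \<comment> \<open>The second difference is bounded by the tangential derivative of the first
      one, so the source term is linear in a quantity that the coercive part controls
      quadratically.\<close>
    have n1: "norm (fst Y) \<le> norm (fst (snd Z))"
    proof (rule LIMSEQ_le)
      show "(\<lambda>j. norm (fst (jet (dq (-h) (dq h (w j)))))) \<longlonglongrightarrow> norm (fst Y)" by (intro tendsto_intros Y)
      show "(\<lambda>j. norm (fst (snd (jet (dq h (w j)))))) \<longlonglongrightarrow> norm (fst (snd Z))" by (intro tendsto_intros Z)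
      show "\<exists>N. \<forall>j\<ge>N. norm (fst (jet (dq (-h) (dq h (w j))))) \<le> norm (fst (snd (jet (dq h (w j)))))"
        unfolding ju norm_dq_minus[OF wh(1)] using norm_dq_le_partial[OF wh(1) h(1)] by blast
    qed
    \<comment> \<open>The zero-order term is controlled by the derivative that \<open>u\<close> is
      known to have, uniformly in \<open>h\<close>.\<close>
    have n0: "norm (fst Z) \<le> x"
    proof (rule order_trans)
      show "norm (fst Z) \<le> norm (fst (snd X))"
      proof (rule LIMSEQ_le)
        show "(\<lambda>j. norm (fst (jet (dq h (w j))))) \<longlonglongrightarrow> norm (fst Z)" by (intro tendsto_intros Z)
        show "(\<lambda>j. norm (fst (snd (jet (w j))))) \<longlonglongrightarrow> norm (fst (snd X))" by (intro tendsto_intros wX)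
        show "\<exists>N. \<forall>j\<ge>N. norm (fst (jet (dq h (w j)))) \<le> norm (fst (snd (jet (w j))))"
          unfolding ju using norm_dq_le_partial[OF w h(1)] by blast
      qed
      show "norm (fst (snd X)) \<le> x" unfolding x_def by (rule norm_jet_components)
    qed
    have G2: "Re G \<le> - m * ((norm (fst (snd Z)))\<^sup>2 + (norm (snd (snd Z)))\<^sup>2)
      + 2 * K * (norm (fst (snd X)) * norm (fst (snd Z)) + norm (snd (snd X)) * norm (snd (snd Z)))
      + \<kappa>\<^sup>2 * (norm (fst Z))\<^sup>2"
      unfolding G_def
    proof (rule LIMSEQ_le)
      let ?X = "\<lambda>j. jet (w j)" and ?Y = "\<lambda>j. jet (dq (-h) (dq h (w j)))" and ?Z = "\<lambda>j. jet (dq h (w j))"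
      show "(\<lambda>j. Re (cin (M P (fst (snd (?X j)))) (fst (snd (?Y j))) + cin (M P (snd (snd (?X j)))) (snd (snd (?Y j)))
          - of_real (\<kappa>\<^sup>2) * cin (fst (?X j)) (fst (?Y j))))
        \<longlonglongrightarrow> Re (cin (M P (fst (snd X))) (fst (snd Y)) + cin (M P (snd (snd X))) (snd (snd Y))
          - of_real (\<kappa>\<^sup>2) * cin (fst X) (fst Y))"
        by (intro tendsto_intros wX Y)
      show "(\<lambda>j. - m * ((norm (fst (snd (?Z j))))\<^sup>2 + (norm (snd (snd (?Z j))))\<^sup>2)
          + 2 * K * (norm (fst (snd (?X j))) * norm (fst (snd (?Z j))) + norm (snd (snd (?X j))) * norm (snd (snd (?Z j))))
          + \<kappa>\<^sup>2 * (norm (fst (?Z j)))\<^sup>2)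
        \<longlonglongrightarrow> - m * ((norm (fst (snd Z)))\<^sup>2 + (norm (snd (snd Z)))\<^sup>2)
          + 2 * K * (norm (fst (snd X)) * norm (fst (snd Z)) + norm (snd (snd X)) * norm (snd (snd Z)))
          + \<kappa>\<^sup>2 * (norm (fst Z))\<^sup>2"
        by (intro tendsto_intros wX Z)
      have mm: "m \<le> p (y + (h, 0))" if "y \<in> \<Omega>" for y
        unfolding m_def using that h by (intro x0) (cases y, auto simp: Omega_def cbox_Pair_eq)
      have KK: "\<bar>dq h p y\<bar> \<le> K" if "y \<in> \<Omega>" for y
      proof -
        have y: "0 < fst y" "fst y < Lx" "-H < snd y" "snd y < H" using that by (auto simp: Omega_def)
        have "norm (p (fst y + h, snd y) - p (fst y, snd y)) \<le> K * \<bar>h\<bar>"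
          using smooth_difference_bound[where B = 1 and H = H and L = Lx, OF p_smooth K, of "fst y" "snd y" h] y h by simp
        moreover have "dq h p y = (1 / h) * (p (fst y + h, snd y) - p (fst y, snd y))" by (cases y) (simp add: dq_def)
        ultimately show ?thesis using h by (simp add: abs_mult divide_le_eq)
      qed
      show "\<exists>N. \<forall>j\<ge>N. Re (cin (M P (fst (snd (?X j)))) (fst (snd (?Y j))) + cin (M P (snd (snd (?X j)))) (snd (snd (?Y j)))
          - of_real (\<kappa>\<^sup>2) * cin (fst (?X j)) (fst (?Y j)))
        \<le> - m * ((norm (fst (snd (?Z j))))\<^sup>2 + (norm (snd (snd (?Z j))))\<^sup>2)
          + 2 * K * (norm (fst (snd (?X j))) * norm (fst (snd (?Z j))) + norm (snd (snd (?X j))) * norm (snd (snd (?Z j))))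
          + \<kappa>\<^sup>2 * (norm (fst (?Z j)))\<^sup>2"
        using smooth_energy[OF w p_smooth p_per mm KK K0] by blast
    qed
    define N1 where "N1 = norm (fst (snd Z))"
    define N2 where "N2 = norm (snd (snd Z))"
    have N0: "N1 \<ge> 0" "N2 \<ge> 0" by (simp_all add: N1_def N2_def)
    have "norm (fst (snd X)) * N1 + norm (snd (snd X)) * N2 \<le> x * N1 + x * N2"
      unfolding x_def by (intro add_mono mult_right_mono norm_jet_components N0)
    then have a1: "2 * K * (norm (fst (snd X)) * N1 + norm (snd (snd X)) * N2) \<le> 2 * K * (x * N1 + x * N2)"
      using K0 by (intro mult_left_mono) auto
    have a2: "\<kappa>\<^sup>2 * (norm (fst Z))\<^sup>2 \<le> B" unfolding B_def using n0 by (intro mult_left_mono power_mono) auto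
    have a3: "norm (E F) * norm (fst Y) \<le> norm (E F) * (N1 + N2)"
      using n1 N0(2) unfolding N1_def[symmetric] by (intro mult_left_mono) auto
    have "m * (N1\<^sup>2 + N2\<^sup>2) \<le> A * (N1 + N2) + B"
      using G1 G2 a1 a2 a3 unfolding N1_def[symmetric] N2_def[symmetric] A_def by (simp add: algebra_simps)
    from energy_bound_aux[OF this m0 N0 A0 B0] have s: "N1 + N2 \<le> max 1 (2 * (A + B) / m)" .
    have "norm Z \<le> norm (fst Z) + (N1 + N2)"
      using norm_Pair_le[of "fst Z" "snd Z"] norm_Pair_le[of "fst (snd Z)" "snd (snd Z)"] by (simp add: N1_def N2_def)
    then have nZ: "norm Z \<le> x + max 1 (2 * (A + B) / m)" using n0 s by linarith
    have "cin (fst Z) (E \<psi>) = - cin (fst X) (E (dq (-h) \<psi>)) \<and> cin (snd (snd Z)) (E \<psi>) = - cin (snd (snd X)) (E (dq (-h) \<psi>))"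
      if \<psi>: "\<psi> \<in> QP" for \<psi>
    proof
      show "cin (fst Z) (E \<psi>) = - cin (fst X) (E (dq (-h) \<psi>))"
      proof (rule LIMSEQ_unique)
        show "(\<lambda>j. cin (fst (jet (dq h (w j)))) (E \<psi>)) \<longlonglongrightarrow> cin (fst Z) (E \<psi>)" by (intro tendsto_intros Z)
        have "(\<lambda>j. - cin (fst (jet (w j))) (E (dq (-h) \<psi>))) \<longlonglongrightarrow> - cin (fst X) (E (dq (-h) \<psi>))" by (intro tendsto_intros wX)
        then show "(\<lambda>j. cin (fst (jet (dq h (w j)))) (E \<psi>)) \<longlonglongrightarrow> - cin (fst X) (E (dq (-h) \<psi>))"
          unfolding ju dq_adjoint[OF w \<psi>] .
      qed
      show "cin (snd (snd Z)) (E \<psi>) = - cin (snd (snd X)) (E (dq (-h) \<psi>))"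
      proof (rule LIMSEQ_unique)
        have pw: "partial (0, 1) (w j) \<in> QP" for j by (intro QP_partial w) simp
        show "(\<lambda>j. cin (snd (snd (jet (dq h (w j))))) (E \<psi>)) \<longlonglongrightarrow> cin (snd (snd Z)) (E \<psi>)" by (intro tendsto_intros Z)
        have "(\<lambda>j. - cin (snd (snd (jet (w j)))) (E (dq (-h) \<psi>))) \<longlonglongrightarrow> - cin (snd (snd X)) (E (dq (-h) \<psi>))" by (intro tendsto_intros wX)
        then show "(\<lambda>j. cin (snd (snd (jet (dq h (w j))))) (E \<psi>)) \<longlonglongrightarrow> - cin (snd (snd X)) (E (dq (-h) \<psi>))"
          unfolding ju partial_dq[OF QP_smooth[OF w]] dq_adjoint[OF pw \<psi>] .
      qed
    qed
    with Zc nZ show "\<exists>Z\<in>closure (jet ` QP). norm Z \<le> x + max 1 (2 * (A + B) / m) \<and>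
      (\<forall>\<psi>\<in>QP. cin (fst Z) (E \<psi>) = - cin (fst X) (E (dq (-h) \<psi>)) \<and>
        cin (snd (snd Z)) (E \<psi>) = - cin (snd (snd X)) (E (dq (-h) \<psi>)))"
      by blast
  qed
qed

text \<open>The quotients for steps \<open>1 / (k + 1)\<close> are bounded, and their pairings with
  functions in \<open>QP\<close> converge because the quotients of the test functions do. A weak
  limit point inherits these pairings, and its value component is the tangential derivative of
  \<open>u\<close> since \<open>QP\<close> is dense.\<close>

lemma tangential_regularity:
  obtains \<zeta> where "\<zeta> \<in> closure (jet ` QP)" "fst \<zeta> = fst (snd X)"
    "\<And>\<psi>. \<psi> \<in> QP \<Longrightarrow> cin (snd (snd \<zeta>)) (E \<psi>) = - cin (snd (snd X)) (E (partial (1, 0) \<psi>))"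
proof -
  obtain C where C: "\<And>h. 0 < h \<Longrightarrow> h \<le> 1 \<Longrightarrow> \<exists>Z\<in>closure (jet ` QP). norm Z \<le> C \<and>
    (\<forall>\<psi>\<in>QP. cin (fst Z) (E \<psi>) = - cin (fst X) (E (dq (-h) \<psi>)) \<and>
      cin (snd (snd Z)) (E \<psi>) = - cin (snd (snd X)) (E (dq (-h) \<psi>)))"
    using tangential_bound by blast
  define h where "h k = inverse (real (Suc k))" for k
  have h: "0 < h k" "h k \<le> 1" for k by (auto simp: h_def field_simps)
  have hlim: "(\<lambda>k. - h k) \<longlonglongrightarrow> 0"
    using tendsto_minus[OF LIMSEQ_inverse_real_of_nat] by (simp add: h_def)
  have "\<forall>k. \<exists>Z. Z \<in> closure (jet ` QP) \<and> norm Z \<le> C \<and>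
    (\<forall>\<psi>\<in>QP. cin (fst Z) (E \<psi>) = - cin (fst X) (E (dq (- h k) \<psi>)) \<and>
      cin (snd (snd Z)) (E \<psi>) = - cin (snd (snd X)) (E (dq (- h k) \<psi>)))"
    using C[OF h] by blast
  from choice[OF this] obtain Z where "\<forall>k. Z k \<in> closure (jet ` QP) \<and> norm (Z k) \<le> C \<and>
    (\<forall>\<psi>\<in>QP. cin (fst (Z k)) (E \<psi>) = - cin (fst X) (E (dq (- h k) \<psi>)) \<and>
      cin (snd (snd (Z k))) (E \<psi>) = - cin (snd (snd X)) (E (dq (- h k) \<psi>)))"
    by blast
  then have Z: "\<And>k. Z k \<in> closure (jet ` QP)" "\<And>k. norm (Z k) \<le> C"
    and Zt: "\<And>k \<psi>. \<psi> \<in> QP \<Longrightarrow> cin (fst (Z k)) (E \<psi>) = - cin (fst X) (E (dq (- h k) \<psi>))"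
      "\<And>k \<psi>. \<psi> \<in> QP \<Longrightarrow> cin (snd (snd (Z k))) (E \<psi>) = - cin (snd (snd X)) (E (dq (- h k) \<psi>))"
    by blast+
  obtain \<zeta> where \<zeta>': "\<zeta> \<in> closure (jet ` QP)"
    "\<forall>l L. bounded_linear (l :: jet \<Rightarrow> complex) \<longrightarrow> (\<lambda>k. l (Z k)) \<longlonglongrightarrow> L \<longrightarrow> l \<zeta> = L"
  proof (rule weak_limit_exists[where Z = Z, OF Z subspace_imp_convex[OF subspace_jets] closed_closure])
    fix z assume z: "z \<in> closure (jet ` QP)"
      "\<And>(l :: jet \<Rightarrow> complex) L. bounded_linear l \<Longrightarrow> (\<lambda>k. l (Z k)) \<longlonglongrightarrow> L \<Longrightarrow> l z = L"
    have "\<forall>l L. bounded_linear (l :: jet \<Rightarrow> complex) \<longrightarrow> (\<lambda>k. l (Z k)) \<longlonglongrightarrow> L \<longrightarrow> l z = L"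
    proof (intro allI impI)
      fix l :: "jet \<Rightarrow> complex" and L assume l: "bounded_linear l" "(\<lambda>k. l (Z k)) \<longlonglongrightarrow> L"
      show "l z = L" by (rule z(2)[OF l])
    qed
    with z(1) show thesis by (rule that)
  qed
  note \<zeta> = \<zeta>'(1) \<zeta>'(2)[rule_format]
  have lim: "(\<lambda>k. E (dq (- h k) \<psi>)) \<longlonglongrightarrow> E (partial (1, 0) \<psi>)" if "\<psi> \<in> QP" for \<psi>
    by (rule dq_tendsto[OF _ hlim, where B = 1]) (use that h less_imp_neq[OF h(1)] in \<open>auto simp: abs_of_pos\<close>)
  have e0: "cin (fst \<zeta>) (E \<psi>) = - cin (fst X) (E (partial (1, 0) \<psi>))" if \<psi>: "\<psi> \<in> QP" for \<psi>
  proof (rule \<zeta>(2)[where l = "\<lambda>z. cin (fst z) (E \<psi>)"])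
    show "bounded_linear (\<lambda>z. cin (fst z) (E \<psi>))"
      by (rule bounded_linear_compose[OF cin.bounded_linear_left bounded_linear_fst])
    show "(\<lambda>k. cin (fst (Z k)) (E \<psi>)) \<longlonglongrightarrow> - cin (fst X) (E (partial (1, 0) \<psi>))"
      unfolding Zt(1)[OF \<psi>] by (intro tendsto_intros lim \<psi>)
  qed
  have e2: "cin (snd (snd \<zeta>)) (E \<psi>) = - cin (snd (snd X)) (E (partial (1, 0) \<psi>))" if \<psi>: "\<psi> \<in> QP" for \<psi>
  proof (rule \<zeta>(2)[where l = "\<lambda>z. cin (snd (snd z)) (E \<psi>)"])
    show "bounded_linear (\<lambda>z::jet. cin (snd (snd z)) (E \<psi>))"
      by (rule bounded_linear_compose[OF cin.bounded_linear_left bounded_linear_compose[OF bounded_linear_snd bounded_linear_snd]])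
    show "(\<lambda>k. cin (snd (snd (Z k))) (E \<psi>)) \<longlonglongrightarrow> - cin (snd (snd X)) (E (partial (1, 0) \<psi>))"
      unfolding Zt(2)[OF \<psi>] by (intro tendsto_intros lim \<psi>)
  qed
  have "fst \<zeta> - fst (snd X) = 0"
  proof (rule orthogonal_QP_zero)
    show "fst \<zeta> - fst (snd X) \<in> E ` L2 \<Omega>"
      by (intro range_diff closed_range_components \<zeta>(1) X_closure)
    show "cin (fst \<zeta> - fst (snd X)) (E \<psi>) = 0" if "\<psi> \<in> QP" for \<psi>
      using e0[OF that] ibp1[OF X_closure that] by (simp add: cin.diff_left)
  qed
  then show ?thesis using that[OF \<zeta>(1) _ e2] by simp
qed

end

subsection \<open>Regularity in the normal direction\<close>

lemma weighted_norm:
  assumes S: "S \<in> sets lebesgue" "bounded S" and c: "continuous_on UNIV c" and f: "f \<in> L2 S"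
  shows "integrable (lebesgue_on S) (\<lambda>x. c x * (norm (f x))\<^sup>2)"
    "cin (mulc (restr S (\<lambda>x. complex_of_real (c x))) (toL S f)) (toL S f) = of_real (\<integral>x. c x * (norm (f x))\<^sup>2 \<partial>lebesgue_on S)"
proof -
  have cc: "continuous_on UNIV (\<lambda>x. complex_of_real (c x))" by (intro continuous_intros c)
  note m = L2_mult[OF S(1) restr_bmeas_continuous[OF S(2,1) cc] f]
  have "integrable (lebesgue_on S) (\<lambda>x. Re ((complex_of_real (c x) * f x) * cnj (f x)))"
    by (intro integrable_Re integrable_mult_cnj[OF S(1)] m f)
  also have "(\<lambda>x. Re ((complex_of_real (c x) * f x) * cnj (f x))) = (\<lambda>x. c x * (norm (f x))\<^sup>2)"
    by (rule ext) (simp only: mult.assoc mult_cnj_eq_norm_power of_real_mult[symmetric] Re_complex_of_real)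
  finally show "integrable (lebesgue_on S) (\<lambda>x. c x * (norm (f x))\<^sup>2)" .
  show "cin (mulc (restr S (\<lambda>x. complex_of_real (c x))) (toL S f)) (toL S f) = of_real (\<integral>x. c x * (norm (f x))\<^sup>2 \<partial>lebesgue_on S)"
    unfolding m(2)[symmetric] cin_toL[OF S(1) m(1) f]
    by (simp only: mult.assoc mult_cnj_eq_norm_power of_real_mult[symmetric] integral_complex_of_real)
qed

context cell
begin

lemma hexp_partial: "partial (1, 0) (hexp b) x = \<i> * of_real b * hexp b x" "partial (0, 1) (hexp b) x = 0"
proof -
  have "(hexp b has_derivative (\<lambda>h. hexp b x * (\<i> * of_real (b * fst h)))) (at x)"
  proof -
    have "((\<lambda>x. \<i> * complex_of_real (b * fst x)) has_derivative (\<lambda>h. \<i> * complex_of_real (b * fst h))) (at x)"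
      by (intro has_derivative_mult_right has_derivative_of_real has_derivative_fst has_derivative_ident)
    from has_derivative_compose[OF this DERIV_exp[unfolded has_field_derivative_def]] show ?thesis
      unfolding hexp_def .
  qed
  note d = partial_eq[OF this]
  show "partial (1, 0) (hexp b) x = \<i> * of_real b * hexp b x" "partial (0, 1) (hexp b) x = 0"
    by (simp_all add: d)
qed

lemma trig_vert_partial:
  "partial (1, 0) (\<lambda>x. complex_of_real (cos (r * vert x))) x = 0"
  "partial (0, 1) (\<lambda>x. complex_of_real (cos (r * vert x))) x = - of_real (r * (pi / (2 * H))) * of_real (sin (r * vert x))"
  "partial (0, 1) (\<lambda>x. complex_of_real (sin (r * vert x))) x = of_real (r * (pi / (2 * H))) * of_real (cos (r * vert x))"
proof -
  have v: "((\<lambda>x. r * vert x) has_derivative (\<lambda>h. r * (pi / (2 * H) * snd h))) (at x)"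
    unfolding vert_def using H by (auto intro!: derivative_eq_intros)
  have "((\<lambda>x. complex_of_real (cos (r * vert x))) has_derivative (\<lambda>h. of_real (- (r * (pi / (2 * H) * snd h)) * sin (r * vert x)))) (at x)"
    by (rule has_derivative_of_real, rule has_derivative_eq_rhs, rule has_derivative_cos[OF v]) (simp add: mult_ac)
  note d = partial_eq[OF this]
  have "((\<lambda>x. complex_of_real (sin (r * vert x))) has_derivative (\<lambda>h. of_real ((r * (pi / (2 * H) * snd h)) * cos (r * vert x)))) (at x)"
    by (rule has_derivative_of_real, rule has_derivative_eq_rhs, rule has_derivative_sin[OF v]) (simp add: mult_ac)
  note e = partial_eq[OF this]
  show "partial (1, 0) (\<lambda>x. complex_of_real (cos (r * vert x))) x = 0"
    "partial (0, 1) (\<lambda>x. complex_of_real (cos (r * vert x))) x = - of_real (r * (pi / (2 * H))) * of_real (sin (r * vert x))"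
    "partial (0, 1) (\<lambda>x. complex_of_real (sin (r * vert x))) x = of_real (r * (pi / (2 * H))) * of_real (cos (r * vert x))"
    by (simp_all add: d e)
qed

end

context qpcell
begin

text \<open>Normal derivatives of \<open>cb\<close>, up to factors; they vanish on both edges and so
  serve as test functions without boundary terms.\<close>

definition sbas :: "int \<Rightarrow> nat \<Rightarrow> real \<times> real \<Rightarrow> complex" where
  "sbas n m x = hexp (a n) x * of_real (sin (real m * vert x))"

definition mu :: "nat \<Rightarrow> real" where "mu m = real m * (pi / (2 * H))"

abbreviation cb where "cb n m \<equiv> cbas (a 0) n m"

lemma cb_eq: "cb n m x = hexp (a n) x * of_real (cos (real m * vert x))"
  by (simp add: cbas_def a[symmetric])

lemma C_infinity_sbas: "C_infinity (sbas n m)"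
  unfolding sbas_def [abs_def]
  by (intro C_infinity_mult C_infinity_hexp C_infinity_of_real C_infinity_sin_vert)

lemma QP_sbas: "sbas n m \<in> QP"
  by (rule QP_I[OF C_infinity_sbas]) (simp add: sbas_def QP_hexp vert_def)

lemma sbas_boundary: "sbas n m (t, H) = 0" "sbas n m (t, -H) = 0"
  using H by (simp_all add: sbas_def vert_def sin_npi)

lemma cb_partial: "partial (1, 0) (cb n m) = (\<lambda>x. \<i> * of_real (a n) * cb n m x)"
  "partial (0, 1) (cb n m) = (\<lambda>x. - of_real (mu m) * sbas n m x)"
  and sbas_partial: "partial (0, 1) (sbas n m) = (\<lambda>x. of_real (mu m) * cb n m x)"
proof -
  have c: "C_infinity (\<lambda>x. complex_of_real (cos (real m * vert x)))" "C_infinity (\<lambda>x. complex_of_real (sin (real m * vert x)))"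
    by (intro C_infinity_of_real C_infinity_cos_vert C_infinity_sin_vert)+
  have e: "cb n m = (\<lambda>x. hexp (a n) x * of_real (cos (real m * vert x)))" by (rule ext) (rule cb_eq)
  show "partial (1, 0) (cb n m) = (\<lambda>x. \<i> * of_real (a n) * cb n m x)"
    unfolding e by (rule ext) (simp only: partial_mult[OF C_infinity_hexp c(1)] hexp_partial trig_vert_partial, simp)
  show "partial (0, 1) (cb n m) = (\<lambda>x. - of_real (mu m) * sbas n m x)"
    unfolding e by (rule ext) (simp only: partial_mult[OF C_infinity_hexp c(1)] hexp_partial trig_vert_partial, simp add: sbas_def mu_def)
  show "partial (0, 1) (sbas n m) = (\<lambda>x. of_real (mu m) * cb n m x)"
    unfolding e sbas_def [abs_def] by (rule ext) (simp only: partial_mult[OF C_infinity_hexp c(2)] hexp_partial trig_vert_partial, simp add: mu_def)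
qed

text \<open>The sine is positive in the open cell. Multiplying by it turns an arbitrary test
  function into one that vanishes on the edges, and loses no information.\<close>

lemma zero_if_sin_multiple_zero:
  assumes R: "R \<in> E ` L2 \<Omega>" and z: "M (\<lambda>x. complex_of_real (sin (vert x))) R = 0"
  shows "R = 0"
proof -
  obtain g where g: "g \<in> L2 \<Omega>" "R = E g" using R by blast
  have c: "continuous_on UNIV (\<lambda>x. complex_of_real (sin (vert x)))"
    by (intro continuous_intros continuous_vert)
  have L: "(\<lambda>x. complex_of_real (sin (vert x)) * g x) \<in> L2 \<Omega>"
    by (intro L2_mult(1) restr_bmeas_continuous c g) auto
  have "E (\<lambda>x. complex_of_real (sin (vert x)) * g x) = E (\<lambda>x. 0)"
    using z g by (simp add: E_mult[OF c g(1)] toL_zero)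
  then have "AE x in lebesgue_on \<Omega>. complex_of_real (sin (vert x)) * g x = 0"
    using toL_eq_iff[OF Omega_sets(1) L L2_zero[OF Omega_sets(1)]] by blast
  moreover have "AE x in lebesgue_on \<Omega>. x \<in> \<Omega>" by (intro AE_I2) simp
  ultimately have "AE x in lebesgue_on \<Omega>. g x = 0"
  proof eventually_elim
    case (elim x)
    have q: "0 < pi / (2 * H)" using H by simp
    have "0 < snd x + H" "snd x + H < 2 * H" using elim(2) by (auto simp: Omega_def)
    note mult_pos_pos[OF q this(1)] mult_strict_left_mono[OF this(2) q]
    then have "sin (vert x) > 0" using H by (intro sin_gt_zero) (auto simp: vert_def)
    then show ?case using elim(1) by simp
  qed
  then have "E g = E (\<lambda>x. 0)" using toL_eq_iff[OF Omega_sets(1) g(1) L2_zero[OF Omega_sets(1)]] by blast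
  then show ?thesis using g by (simp add: toL_zero)
qed

text \<open>The residual of the orthogonal projection onto the jets is orthogonal to the jet of each
  \<open>cb n m\<close>; integrating by parts, its value component is orthogonal to \<open>cb n m\<close>
  up to the factor \<open>1 + \<alpha>\<^sub>n\<^sup>2 + \<mu>\<^sub>m\<^sup>2\<close>.\<close>

lemma jet_if_weak_derivatives:
  assumes L: "Q0 \<in> E ` L2 \<Omega>" "Q1 \<in> E ` L2 \<Omega>" "Q2 \<in> E ` L2 \<Omega>"
    and w1: "\<And>\<psi>. \<psi> \<in> QP \<Longrightarrow> cin Q1 (E \<psi>) = - cin Q0 (E (partial (1, 0) \<psi>))"
    and w2: "\<And>\<psi>. \<psi> \<in> QP \<Longrightarrow> (\<And>t. \<psi> (t, H) = 0) \<Longrightarrow> (\<And>t. \<psi> (t, -H) = 0) \<Longrightarrow>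
      cin Q2 (E \<psi>) = - cin Q0 (E (partial (0, 1) \<psi>))"
  shows "(Q0, Q1, Q2) \<in> closure (jet ` QP)"
proof -
  obtain Y where Y: "Y \<in> closure (jet ` QP)" and orth: "\<And>v. v \<in> closure (jet ` QP) \<Longrightarrow> inner ((Q0, Q1, Q2) - Y) v = 0"
    using orthogonal_projection_exists[OF subspace_jets closed_closure, of "(Q0, Q1, Q2)"] by blast
  define R0 where "R0 = Q0 - fst Y"
  define R1 where "R1 = Q1 - fst (snd Y)"
  define R2 where "R2 = Q2 - snd (snd Y)"
  have R: "(Q0, Q1, Q2) - Y = (R0, R1, R2)" by (simp add: R0_def R1_def R2_def prod_eq_iff)
  have RL: "R0 \<in> E ` L2 \<Omega>" "R1 \<in> E ` L2 \<Omega>" "R2 \<in> E ` L2 \<Omega>"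
    unfolding R0_def R1_def R2_def by (intro range_diff L closed_range_components[OF Y])+
  have r1: "cin R1 (E \<psi>) = - cin R0 (E (partial (1, 0) \<psi>))" if "\<psi> \<in> QP" for \<psi>
    unfolding R0_def R1_def cin.diff_left w1[OF that] ibp1[OF Y that] by simp
  have r2: "cin R2 (E \<psi>) = - cin R0 (E (partial (0, 1) \<psi>))"
    if "\<psi> \<in> QP" "\<And>t. \<psi> (t, H) = 0" "\<And>t. \<psi> (t, -H) = 0" for \<psi>
    unfolding R0_def R2_def cin.diff_left w2[OF that] ibp2[OF Y that] by simp
  \<comment> \<open>\<open>inner\<close> yields only the real part of this relation; testing with
    \<open>\<i>\<close> times \<open>\<psi>\<close> yields the imaginary part.\<close>
  have o: "cin R0 (E \<psi>) + cin R1 (E (partial (1, 0) \<psi>)) + cin R2 (E (partial (0, 1) \<psi>)) = 0" if \<psi>: "\<psi> \<in> QP" for \<psi>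
  proof -
    have re: "Re (cin R0 (E \<phi>) + cin R1 (E (partial (1, 0) \<phi>)) + cin R2 (E (partial (0, 1) \<phi>))) = 0" if "\<phi> \<in> QP" for \<phi>
    proof -
      have "jet \<phi> \<in> closure (jet ` QP)"
        by (rule subsetD[OF closure_subset imageI[OF that]])
      then have "inner (R0, R1, R2) (jet \<phi>) = 0" using orth R by metis
      then show ?thesis by (simp add: jet_def inner_prod_def inner_lsq_def)
    qed
    have i: "(\<lambda>x. \<i> * \<psi> x) \<in> QP" by (rule QP_cmult[OF \<psi>])
    have pe: "partial b (\<lambda>x. \<i> * \<psi> x) = (\<lambda>x. \<i> * partial b \<psi> x)" for b
      by (rule ext) (rule partial_linear[OF bounded_linear_mult_right QP_smooth[OF \<psi>]])
    have Ei: "E (\<lambda>x. \<i> * f x) = mulc (\<lambda>_. \<i>) (E f)" if "f \<in> L2 \<Omega>" for f by (rule toL_const_mult[OF Omega_sets(1) that])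
    note s = smooth_L2(1-3)[OF QP_smooth[OF \<psi>]]
    have "Re (- \<i> * (cin R0 (E \<psi>) + cin R1 (E (partial (1, 0) \<psi>)) + cin R2 (E (partial (0, 1) \<psi>)))) = 0"
      using re[OF i] unfolding pe Ei[OF s(1)] Ei[OF s(2)] Ei[OF s(3)] cin_mulc_const_right by (simp only: complex_cnj_i distrib_left)
    then show ?thesis using re[OF \<psi>] by (simp add: complex_eq_iff)
  qed
  have R0: "R0 = 0"
  proof -
    have "cin R0 (E (cb n m)) = 0" for n m
    proof -
      let ?c = "E (cb n m)" and ?s = "E (sbas n m)"
      have L: "cb n m \<in> L2 \<Omega>" "sbas n m \<in> L2 \<Omega>"
        using QP_cbas QP_sbas by auto
      have E1: "E (partial (1, 0) (cb n m)) = mulc (\<lambda>_. \<i> * of_real (a n)) ?c"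
        and E2: "E (partial (0, 1) (cb n m)) = mulc (\<lambda>_. - of_real (mu m)) ?s"
        and E3: "E (partial (0, 1) (sbas n m)) = mulc (\<lambda>_. of_real (mu m)) ?c"
        unfolding cb_partial sbas_partial by (rule toL_const_mult[OF Omega_sets(1)], rule L)+
      have 1: "cin R1 ?c = - (cnj (\<i> * of_real (a n)) * cin R0 ?c)"
        using r1[OF QP_cbas[of n m]] unfolding E1 cin_mulc_const_right .
      have 2: "cin R2 ?s = - (of_real (mu m) * cin R0 ?c)"
        using r2[OF QP_sbas[of n m] sbas_boundary] unfolding E3 cin_mulc_const_right complex_cnj_complex_of_real .
      have "cin R0 ?c + cnj (\<i> * of_real (a n)) * cin R1 ?c + cnj (- of_real (mu m)) * cin R2 ?s = 0"
        using o[OF QP_cbas[of n m]] unfolding E1 E2 cin_mulc_const_right .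
      then have "of_real (1 + (a n)\<^sup>2 + (mu m)\<^sup>2) * cin R0 ?c = 0"
        unfolding 1 2 by (simp add: algebra_simps power2_eq_square)
      moreover have "1 + (a n)\<^sup>2 + (mu m)\<^sup>2 \<noteq> 0"
        using zero_le_power2[of "a n"] zero_le_power2[of "mu m"] by linarith
      ultimately show ?thesis by (simp only: mult_eq_0_iff of_real_eq_0_iff) simp
    qed
    then show ?thesis using RL(1) cbas_complete by blast
  qed
  have R1: "R1 = 0"
    by (rule orthogonal_QP_zero[OF RL(2)]) (simp add: r1 R0 cin.zero_left)
  \<comment> \<open>\<open>R2\<close> is controlled only against functions vanishing on the edges,
    which the factor \<open>sin (vert x)\<close> enforces.\<close>
  have R2: "R2 = 0"
  proof (rule zero_if_sin_multiple_zero[OF RL(3)])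
    obtain g where g: "g \<in> L2 \<Omega>" "R2 = E g" using RL(3) by blast
    have c: "continuous_on UNIV (\<lambda>x. sin (vert x))" by (intro continuous_intros continuous_vert)
    have c': "continuous_on UNIV (\<lambda>x. complex_of_real (sin (vert x)))" by (intro continuous_intros c)
    have L: "(\<lambda>x. complex_of_real (sin (vert x)) * g x) \<in> L2 \<Omega>"
      by (intro L2_mult(1) restr_bmeas_continuous c' g) auto
    have sv: "C_infinity (\<lambda>x. complex_of_real (sin (vert x)))"
      using C_infinity_of_real[OF C_infinity_sin_vert[of 1]] by simp
    show "M (\<lambda>x. complex_of_real (sin (vert x))) R2 = 0"
    proof (rule orthogonal_QP_zero)
      show "M (\<lambda>x. complex_of_real (sin (vert x))) R2 \<in> E ` L2 \<Omega>"
        unfolding g(2) E_mult[OF c' g(1), symmetric] using L by blast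
      fix \<psi> assume \<psi>: "\<psi> \<in> QP"
      have q: "(\<lambda>x. complex_of_real (sin (vert x)) * \<psi> x) \<in> QP"
        by (rule QP_mult[OF \<psi> sv]) (simp add: vert_def)
      have "cin (M (\<lambda>x. complex_of_real (sin (vert x))) R2) (E \<psi>) = cin R2 (E (\<lambda>x. complex_of_real (sin (vert x)) * \<psi> x))"
        unfolding M_adjoint[OF c] E_mult[OF c' smooth_L2(1)[OF QP_smooth[OF \<psi>]]] ..
      also have "\<dots> = - cin R0 (E (partial (0, 1) (\<lambda>x. complex_of_real (sin (vert x)) * \<psi> x)))"
        by (rule r2[OF q]) (use H in \<open>simp_all add: vert_def\<close>)
      finally show "cin (M (\<lambda>x. complex_of_real (sin (vert x))) R2) (E \<psi>) = 0" by (simp add: R0 cin.zero_left)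
    qed
  qed
  have "(Q0, Q1, Q2) = Y" using R unfolding R0 R1 R2 by (metis eq_iff_diff_eq_0 zero_prod_def)
  then show ?thesis using Y by simp
qed

end

context qpcell
begin

lemma range_scaleR: "X \<in> E ` L2 \<Omega> \<Longrightarrow> r *\<^sub>R X \<in> E ` L2 \<Omega>"
proof -
  assume "X \<in> E ` L2 \<Omega>"
  then obtain f where f: "f \<in> L2 \<Omega>" "X = E f" by blast
  have "r *\<^sub>R X = E (\<lambda>x. r *\<^sub>R f x)" using f by (simp add: toL_scaleR)
  then show ?thesis using L2_scaleR[OF Omega_sets(1) f(1)] by blast
qed

lemma range_M:
  assumes "X \<in> E ` L2 \<Omega>" "continuous_on UNIV c"
  shows "M c X \<in> E ` L2 \<Omega>"
proof -
  obtain f where f: "f \<in> L2 \<Omega>" "X = E f" using assms(1) by blast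
  have "(\<lambda>x. c x * f x) \<in> L2 \<Omega>" by (intro L2_mult(1) restr_bmeas_continuous assms f) auto
  then show ?thesis unfolding f(2) E_mult[OF assms(2) f(1), symmetric] by blast
qed

lemma M_one: "X \<in> E ` L2 \<Omega> \<Longrightarrow> M (\<lambda>x. 1) X = X"
  using M_one_E by blast

lemma trace_of_jet:
  assumes "X \<in> closure (jet ` QP)"
  obtains T where "(X, T) \<in> closure (graph ` QP)"
proof -
  obtain w where w: "\<And>j. w j \<in> QP" "(\<lambda>j. jet (w j)) \<longlonglongrightarrow> X" using jets_sequence[OF assms] by blast
  show ?thesis using jet_trace_exists[OF w] that by blast
qed

lemma Re_cin_swap:
  assumes c: "continuous_on UNIV c"
  shows "Re (cin (M (\<lambda>x. complex_of_real (c x)) X) Y) = Re (cin (M (\<lambda>x. complex_of_real (c x)) Y) X)"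
  unfolding M_adjoint[OF c, of X Y] cin_commute[of X] by simp

end

context helmholtz
begin

abbreviation D1 where "D1 \<equiv> fst (snd X)"
abbreviation D2 where "D2 \<equiv> snd (snd X)"
abbreviation p1 where "p1 \<equiv> partial (1, 0) p"
abbreviation p2 where "p2 \<equiv> partial (0, 1) p"

lemma P_partial: "partial b P = (\<lambda>x. complex_of_real (partial b p x))"
  by (rule ext) (rule partial_linear[OF bounded_linear_of_real p_smooth])

text \<open>The equation in nondivergence form is solved for the second normal derivative:
  \<open>G\<close> is what \<open>F\<close> leaves for \<open>p\<close> times it, and
  \<open>U22\<close> is \<open>G\<close> divided by \<open>p\<close>. The weak equation, tested with
  functions vanishing on the edges, shows that \<open>U22\<close> is the normal derivative of
  \<open>D2\<close>.\<close>

lemma normal_regularity: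
  obtains A1 A2 U22 where "(D1, A1, A2) \<in> closure (jet ` QP)" "(D2, A2, U22) \<in> closure (jet ` QP)"
    "E F = \<kappa>\<^sup>2 *\<^sub>R fst X + M (\<lambda>x. complex_of_real (p1 x)) D1 + M P A1 + M (\<lambda>x. complex_of_real (p2 x)) D2 + M P U22"
proof -
  obtain \<zeta> where \<zeta>: "\<zeta> \<in> closure (jet ` QP)" "fst \<zeta> = D1"
    "\<And>\<psi>. \<psi> \<in> QP \<Longrightarrow> cin (snd (snd \<zeta>)) (E \<psi>) = - cin D2 (E (partial (1, 0) \<psi>))"
    using tangential_regularity by blast
  define A1 where "A1 = fst (snd \<zeta>)"
  define A2 where "A2 = snd (snd \<zeta>)"
  have \<zeta>_eq: "\<zeta> = (D1, A1, A2)" using \<zeta>(2) by (simp add: A1_def A2_def prod_eq_iff)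
  let ?P1 = "\<lambda>x. complex_of_real (p1 x)" and ?P2 = "\<lambda>x. complex_of_real (p2 x)" and ?e = "\<lambda>x. complex_of_real (\<epsilon> x)"
  have c1: "continuous_on UNIV p1" and c2: "continuous_on UNIV p2" and cp: "continuous_on UNIV p" and ce: "continuous_on UNIV \<epsilon>"
    by (intro C_infinity_continuous C_infinity_partial p_smooth eps_smooth)+
  have C: "continuous_on UNIV ?P1" "continuous_on UNIV ?P2" "continuous_on UNIV P" "continuous_on UNIV ?e"
    by (intro continuous_on_of_real c1 c2 cp ce)+
  note XL = closed_range_components[OF X_closure]
  have AL: "A1 \<in> E ` L2 \<Omega>" "A2 \<in> E ` L2 \<Omega>"
    unfolding A1_def A2_def by (rule closed_range_components[OF \<zeta>(1)])+
  define G where "G = E F - \<kappa>\<^sup>2 *\<^sub>R fst X - M ?P1 D1 - M P A1 - M ?P2 D2"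
  define U22 where "U22 = M ?e G"
  have "E F \<in> E ` L2 \<Omega>" using F by blast
  then have GL: "G \<in> E ` L2 \<Omega>"
    unfolding G_def by (intro range_diff range_scaleR range_M XL AL C)
  then have UL: "U22 \<in> E ` L2 \<Omega>" unfolding U22_def by (intro range_M C)
  have pe: "P x * ?e x = 1" for x
    using eps_pos[of x] by (simp add: p_def flip: of_real_mult)
  have PU: "M P U22 = G"
    unfolding U22_def M_mult[OF C(3,4), symmetric] pe by (rule M_one[OF GL])
  have w2: "cin U22 (E \<psi>) = - cin D2 (E (partial (0, 1) \<psi>))"
    if \<psi>: "\<psi> \<in> QP" and b: "\<And>t. \<psi> (t, H) = 0" "\<And>t. \<psi> (t, -H) = 0" for \<psi>
  proof -
    \<comment> \<open>Dividing the test function by \<open>p\<close> undoes the coefficient: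
      \<open>\<psi>\<close> is \<open>p\<close> times \<open>v\<close>, so \<open>p\<close> times
      the normal derivative of \<open>v\<close> is that of \<open>\<psi>\<close> up to the term with
      \<open>p2\<close>.\<close>
    define v where "v x = ?e x * \<psi> x" for x
    have v: "v \<in> QP"
      unfolding v_def [abs_def] by (rule QP_mult[OF \<psi> C_infinity_of_real[OF eps_smooth]]) (simp add: eps_per)
    have vs: "C_infinity v" using v by simp
    note vL = smooth_L2(1-3)[OF vs]
    have vH: "v \<in> H1 \<Omega>" "wjet v = jet v" using C_infinity_H1[OF vs] by auto
    have vqp: "v \<in> H1qp Lx H a"
      unfolding H1qp_iff vH(2) using vH(1) subsetD[OF closure_subset imageI[OF v]] by blast
    have gr: "(wjet v, tr v) \<in> closure (graph ` QP)"
      unfolding vH(2) using subsetD[OF closure_subset imageI[OF v, of graph]] by (simp add: graph_def)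
    \<comment> \<open>With zero traces on the edges both DtN terms drop out of the weak
      equation.\<close>
    have "tr v = 0" using b by (simp add: tr_def v_def toL_zero zero_prod_def)
    then have "fourier_coeff Lx a (bd_trace Lx H H v) n = 0" "fourier_coeff Lx a (bd_trace Lx H (-H) v) n = 0" for n
      using fourier_coeff_trace[OF vH(1) gr] by (simp_all add: cin.zero_left)
    then have dual: "duality Lx a g (bd_trace Lx H H v) = 0" "duality Lx a g (bd_trace Lx H (-H) v) = 0" for g
      by (simp_all add: duality_def)
    have w: "cin (M P D1) (E (partial (1, 0) v)) + cin (M P D2) (E (partial (0, 1) v)) - of_real (\<kappa>\<^sup>2) * cin (fst X) (E v) = - cin (E F) (E v)"
      using weak_eq[OF vqp] unfolding vH(2) dual by (simp add: jet_def)
    have "cin (M (partial (1, 0) P) (fst \<zeta>)) (fst (jet v)) + cin (M P (fst (snd \<zeta>))) (fst (jet v))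
        + cin (M P (fst \<zeta>)) (fst (snd (jet v))) = 0"
      by (rule green1_closure[OF P_smooth _ \<zeta>(1) subsetD[OF closure_subset imageI[OF v]]])
        (use p_per[of 0] in simp)
    then have g1: "cin (M ?P1 D1) (E v) + cin (M P A1) (E v) + cin (M P D1) (E (partial (1, 0) v)) = 0"
      unfolding P_partial \<zeta>_eq by (simp add: jet_def)
    have "\<psi> = (\<lambda>x. P x * v x)"
      by (rule ext) (simp add: v_def pe flip: mult.assoc)
    then have d\<psi>: "partial (0, 1) \<psi> = (\<lambda>x. ?P2 x * v x + P x * partial (0, 1) v x)"
      using partial_mult[OF P_smooth vs, of "(0, 1)"] P_partial[of "(0, 1)"] by (metis (no_types, lifting))
    have e\<psi>: "E (partial (0, 1) \<psi>) = M ?P2 (E v) + M P (E (partial (0, 1) v))"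
      unfolding d\<psi> using vL C
      by (subst toL_add) (auto simp: E_mult intro!: L2_mult(1) restr_bmeas_continuous)
    have "cin U22 (E \<psi>) = cin G (E v)"
      unfolding U22_def M_adjoint[OF ce] E_mult[OF C(4) smooth_L2(1)[OF QP_smooth[OF \<psi>]], symmetric] v_def [abs_def] ..
    also have "\<dots> = cin (E F) (E v) - of_real (\<kappa>\<^sup>2) * cin (fst X) (E v) - cin (M ?P1 D1) (E v) - cin (M P A1) (E v) - cin (M ?P2 D2) (E v)"
      unfolding G_def by (simp only: cin.diff_left cin.scaleR_left scaleR_conv_of_real)
    also have "\<dots> = - cin (M P D2) (E (partial (0, 1) v)) - cin (M ?P2 D2) (E v)"
      using w g1 by algebra
    also have "\<dots> = - cin D2 (E (partial (0, 1) \<psi>))"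
      unfolding e\<psi> cin.add_right M_adjoint[OF c2] M_adjoint[OF cp] by simp
    finally show ?thesis .
  qed
  have "(D2, A2, U22) \<in> closure (jet ` QP)"
    by (rule jet_if_weak_derivatives[OF XL(3) AL(2) UL _ w2]) (use \<zeta>(3) in \<open>auto simp: A2_def\<close>)
  moreover have "(D1, A1, A2) \<in> closure (jet ` QP)" using \<zeta>(1) \<zeta>_eq by simp
  moreover have "E F = \<kappa>\<^sup>2 *\<^sub>R fst X + M ?P1 D1 + M P A1 + M ?P2 D2 + M P U22"
    unfolding PU by (simp add: G_def)
  ultimately show ?thesis using that by blast
qed

subsection \<open>The Rellich identity\<close>

definition height :: "real \<times> real \<Rightarrow> real" where "height x = snd x + H"

lemma height_smooth: "C_infinity height"
  unfolding height_def [abs_def] by (rule C_infinity_snd_add)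

lemma height_partial: "partial (1, 0) height x = 0" "partial (0, 1) height x = 1"
proof -
  have d: "(height has_derivative snd) (at x)"
    unfolding height_def by (auto intro!: derivative_eq_intros)
  show "partial (1, 0) height x = 0" "partial (0, 1) height x = 1"
    unfolding partial_eq[OF d] by simp_all
qed

text \<open>The equation is paired with \<open>height\<close> times \<open>D2\<close>, and the
  second derivatives cancel: \<open>A1\<close> is removed by Green's formula in the tangential
  direction, and the real parts that remain with \<open>A2\<close> and \<open>U22\<close>, like the
  zero-order term, are halves of weighted normal derivatives of squares.\<close>

lemma rellich_abstract:
  assumes \<alpha>: "(D1, A1, A2) \<in> closure (jet ` QP)" and \<beta>: "(D2, A2, U22) \<in> closure (jet ` QP)"
    and eq: "E F = \<kappa>\<^sup>2 *\<^sub>R fst X + M (\<lambda>x. complex_of_real (p1 x)) D1 + M P A1 + M (\<lambda>x. complex_of_real (p2 x)) D2 + M P U22"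
    and S: "((D1, A1, A2), S1) \<in> closure (graph ` QP)" "((D2, A2, U22), S2) \<in> closure (graph ` QP)" "(X, T) \<in> closure (graph ` QP)"
  shows "2 * Re (cin (E F) (M (\<lambda>x. complex_of_real (height x)) D2))
    = \<kappa>\<^sup>2 * (2 * H * (norm (fst T))\<^sup>2 - (norm (fst X))\<^sup>2)
      + Re (cin (M P D1) D1) - Re (cin (M P D2) D2)
      + Re (cin (M (\<lambda>x. complex_of_real (height x * p2 x)) D1) D1) + Re (cin (M (\<lambda>x. complex_of_real (height x * p2 x)) D2) D2)
      - 2 * H * Re (cin (N (\<lambda>t. P (t, H)) (fst S1)) (fst S1)) + 2 * H * Re (cin (N (\<lambda>t. P (t, H)) (fst S2)) (fst S2))"
proof -
  let ?y = "\<lambda>x. complex_of_real (height x)" and ?q = "\<lambda>x. complex_of_real (height x * p x)"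
  let ?q1 = "\<lambda>x. complex_of_real (height x * p1 x)" and ?q2 = "\<lambda>x. complex_of_real (height x * p2 x)"
  let ?P1 = "\<lambda>x. complex_of_real (p1 x)" and ?P2 = "\<lambda>x. complex_of_real (p2 x)"
  have c1: "continuous_on UNIV p1" and c2: "continuous_on UNIV p2" and cp: "continuous_on UNIV p" and cy: "continuous_on UNIV height"
    by (intro C_infinity_continuous C_infinity_partial p_smooth height_smooth)+
  have C: "continuous_on UNIV ?P1" "continuous_on UNIV ?P2" "continuous_on UNIV P" "continuous_on UNIV ?y"
    by (intro continuous_on_of_real c1 c2 cp cy)+
  have cq: "continuous_on UNIV (\<lambda>x. height x * p x)" "continuous_on UNIV (\<lambda>x. height x * p2 x)" by (intro continuous_on_mult cy cp c2)+
  have qs: "C_infinity (\<lambda>x. height x * p x)" by (intro C_infinity_mult height_smooth p_smooth)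
  have Qs: "C_infinity ?q" "C_infinity ?y" by (intro C_infinity_of_real qs height_smooth)+
  have dq: "partial b ?q = (\<lambda>x. complex_of_real (partial b height x * p x + height x * partial b p x))" for b
    by (rule ext, subst partial_linear[OF bounded_linear_of_real qs]) (simp only: partial_mult[OF height_smooth p_smooth])
  have dq1: "partial (1, 0) ?q = ?q1" unfolding dq by (rule ext) (simp add: height_partial)
  have dq2: "partial (0, 1) ?q = (\<lambda>x. P x + ?q2 x)" unfolding dq by (rule ext) (simp add: height_partial)
  have dy: "partial (0, 1) ?y = (\<lambda>x. 1)"
    by (rule ext, subst partial_linear[OF bounded_linear_of_real height_smooth]) (simp add: height_partial)
  note XL = closed_range_components[OF X_closure]
  have qper: "?q (Lx, s) = ?q (0, s)" for s using p_per[of 0 s] by (simp add: height_def)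
  have I1: "cin (M ?q1 D1) D2 + cin (M ?q A1) D2 + cin (M ?q D1) A2 = 0"
    using green1_closure[OF Qs(1) qper \<alpha> \<beta>] unfolding dq1 by simp
  \<comment> \<open>The weight \<open>height\<close> is \<open>2 * H\<close> on the top edge and 0
    on the bottom edge, so only traces at the top survive.\<close>
  have top: "(\<lambda>t. ?q (t, H)) = (\<lambda>t. of_real (2 * H) * P (t, H))" "(\<lambda>t. ?q (t, -H)) = (\<lambda>t. 0)"
    "(\<lambda>t. ?y (t, H)) = (\<lambda>t. of_real (2 * H))" "(\<lambda>t. ?y (t, -H)) = (\<lambda>t. 0)"
    by (rule ext, simp add: height_def)+
  have N0: "N (\<lambda>t. 0) Y = 0" for Y
  proof -
    have "N (\<lambda>t. 0) Y = mulc (\<lambda>_. 0) Y" by (rule arg_cong2[where f = mulc]) (auto simp: restr_def)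
    also have "\<dots> = 0"
      using cin_self[of "mulc (\<lambda>_. 0) Y"] unfolding cin_mulc_const_left by simp
    finally show ?thesis .
  qed
  have cPH: "continuous_on UNIV (\<lambda>t. P (t, H))" by (rule continuous_trace[OF P_smooth])
  have N2: "N (\<lambda>t. of_real (2 * H) * P (t, H)) Y = mulc (\<lambda>_. of_real (2 * H)) (N (\<lambda>t. P (t, H)) Y)" for Y
  proof -
    have "mulc (\<lambda>_. of_real (2 * H)) (N (\<lambda>t. P (t, H)) Y) = mulc (\<lambda>x. of_real (2 * H) * restr \<Gamma> (\<lambda>t. P (t, H)) x) Y"
      by (rule mulc_mulc) (auto intro: restr_bmeas_continuous cPH)
    also have "(\<lambda>x. complex_of_real (2 * H) * restr \<Gamma> (\<lambda>t. P (t, H)) x) = restr \<Gamma> (\<lambda>t. of_real (2 * H) * P (t, H))"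
      by (rule ext) (simp add: restr_def)
    finally show ?thesis by simp
  qed
  note cl = subsetD[OF closure_graph_subset]
  have Mq: "M (\<lambda>x. P x + ?q2 x) Y = M P Y + M ?q2 Y" for Y
    by (rule M_add[OF C(3) continuous_on_of_real[OF cq(2)]])
  have I2: "cin (M P D1) D1 + cin (M ?q2 D1) D1 + cin (M ?q A2) D1 + cin (M ?q D1) A2
    = of_real (2 * H) * cin (N (\<lambda>t. P (t, H)) (fst S1)) (fst S1)"
    using green2_closure[OF Qs(1) cl[OF S(1)] cl[OF S(1)]]
    unfolding dq2 top N0 N2 cin_mulc_const_left Mq cin.add_left cin.zero_left by simp
  have I3: "cin (M P D2) D2 + cin (M ?q2 D2) D2 + cin (M ?q U22) D2 + cin (M ?q D2) U22
    = of_real (2 * H) * cin (N (\<lambda>t. P (t, H)) (fst S2)) (fst S2)"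
    using green2_closure[OF Qs(1) cl[OF S(2)] cl[OF S(2)]]
    unfolding dq2 top N0 N2 cin_mulc_const_left Mq cin.add_left cin.zero_left by simp
  \<comment> \<open>A constant cut off to \<open>\<Gamma>\<close> acts like the constant only on
    classes supported in \<open>\<Gamma>\<close>; limits of traces are of this kind.\<close>
  have NH: "N (\<lambda>t. of_real (2 * H)) (fst T) = mulc (\<lambda>_. of_real (2 * H)) (fst T)"
  proof -
    obtain w where w: "\<And>j. w j \<in> QP" "(\<lambda>j. graph (w j)) \<longlonglongrightarrow> (X, T)"
    proof -
      obtain z where z: "\<And>n. z n \<in> graph ` QP" "z \<longlonglongrightarrow> (X, T)" using S(3) unfolding closure_sequential by blast
      have "\<exists>w. w \<in> QP \<and> z n = graph w" for n using imageE[OF z(1)[of n]] by blast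
      then obtain w where w: "\<And>n. w n \<in> QP" "\<And>n. z n = graph (w n)" by metis
      have "z = (\<lambda>n. graph (w n))" using w(2) by (rule ext)
      then show ?thesis using that w z by blast
    qed
    have l: "(\<lambda>j. EG (\<lambda>t. w j (t, H))) \<longlonglongrightarrow> fst T"
      using tendsto_fst[OF tendsto_snd[OF w(2)]] by (simp add: graph_def tr_def)
    show ?thesis
    proof (rule LIMSEQ_unique)
      show "(\<lambda>j. N (\<lambda>t. of_real (2 * H)) (EG (\<lambda>t. w j (t, H)))) \<longlonglongrightarrow> N (\<lambda>t. of_real (2 * H)) (fst T)"
        by (intro tendsto_mulc l)
      have "N (\<lambda>t. of_real (2 * H)) (EG (\<lambda>t. w j (t, H))) = mulc (\<lambda>_. of_real (2 * H)) (EG (\<lambda>t. w j (t, H)))" for j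
        unfolding EG_mult[OF continuous_on_const smooth_L2(4)[OF QP_smooth[OF w(1)]], symmetric]
        by (rule toL_const_mult[OF Gamma_sets(1) smooth_L2(4)[OF QP_smooth[OF w(1)]]])
      then show "(\<lambda>j. N (\<lambda>t. of_real (2 * H)) (EG (\<lambda>t. w j (t, H)))) \<longlonglongrightarrow> mulc (\<lambda>_. of_real (2 * H)) (fst T)"
        by (simp only:) (intro tendsto_mulc l)
    qed
  qed
  have I4: "cin (fst X) (fst X) + cin (M ?y D2) (fst X) + cin (M ?y (fst X)) D2
    = of_real (2 * H) * cin (fst T) (fst T)"
    using green2_closure[OF Qs(2) cl[OF S(3)] cl[OF S(3)]]
    unfolding fst_conv snd_conv dy top N0 NH cin_mulc_const_left M_one[OF XL(1)] cin.zero_left by simp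
  \<comment> \<open>Symmetry of the real parts merges the two cross terms in each of the
    squares.\<close>
  have sw: "Re (cin (M ?q A2) D1) = Re (cin (M ?q D1) A2)" "Re (cin (M ?q D2) U22) = Re (cin (M ?q U22) D2)"
    "Re (cin (M ?y D2) (fst X)) = Re (cin (M ?y (fst X)) D2)"
    by (rule Re_cin_swap, intro cq cy)+
  have adj: "cin (M c Y) (M ?y D2) = cin (M (\<lambda>x. ?y x * c x) Y) D2" if "continuous_on UNIV c" for c Y
    unfolding M_mult[OF C(4) that] M_adjoint[OF cy, of "M c Y"] ..
  have "cin (E F) (M ?y D2) = of_real (\<kappa>\<^sup>2) * cin (M ?y (fst X)) D2 + cin (M ?q1 D1) D2 + cin (M ?q A1) D2
      + cin (M ?q2 D2) D2 + cin (M ?q U22) D2"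
    unfolding eq cin.add_left cin.scaleR_left scaleR_conv_of_real adj[OF C(1)] adj[OF C(2)] adj[OF C(3)]
      of_real_mult[symmetric] M_adjoint[OF cy, of "fst X"] ..
  then have "Re (cin (E F) (M ?y D2)) = \<kappa>\<^sup>2 * Re (cin (M ?y (fst X)) D2) + Re (cin (M ?q1 D1) D2) + Re (cin (M ?q A1) D2)
      + Re (cin (M ?q2 D2) D2) + Re (cin (M ?q U22) D2)"
    by (simp del: of_real_power)
  moreover have "Re (cin (M ?q1 D1) D2) + Re (cin (M ?q A1) D2) + Re (cin (M ?q D1) A2) = 0"
    using arg_cong[OF I1, of Re] by simp
  moreover have "Re (cin (M P D1) D1) + Re (cin (M ?q2 D1) D1) + 2 * Re (cin (M ?q D1) A2)
    = 2 * H * Re (cin (N (\<lambda>t. P (t, H)) (fst S1)) (fst S1))"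
    using arg_cong[OF I2, of Re] sw(1) by simp
  moreover have "Re (cin (M P D2) D2) + Re (cin (M ?q2 D2) D2) + 2 * Re (cin (M ?q U22) D2)
    = 2 * H * Re (cin (N (\<lambda>t. P (t, H)) (fst S2)) (fst S2))"
    using arg_cong[OF I3, of Re] sw(2) by simp
  moreover have "(norm (fst X))\<^sup>2 + 2 * Re (cin (M ?y (fst X)) D2) = 2 * H * (norm (fst T))\<^sup>2"
    using arg_cong[OF I4, of Re] sw(3) unfolding cin_self by (simp del: of_real_power)
  then have "\<kappa>\<^sup>2 * (2 * Re (cin (M ?y (fst X)) D2)) = \<kappa>\<^sup>2 * (2 * H * (norm (fst T))\<^sup>2 - (norm (fst X))\<^sup>2)"
    by (intro arg_cong[where f = "\<lambda>z. \<kappa>\<^sup>2 * z"]) linarith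
  ultimately show ?thesis by linarith
qed

end

text \<open>\<open>bd_trace\<close> is a choice, so the boundary terms in \<open>d1\<close> and
  \<open>d2\<close> mean what they should only when these functions have traces; hence the
  regularity is part of the conclusion.\<close>

theorem theorem1:
  fixes Lx H \<kappa> \<epsilon>p \<epsilon>m \<theta> :: real
    and a :: "int \<Rightarrow> real"
    and \<Omega> :: "(real \<times> real) set"
    and \<epsilon> :: "real \<times> real \<Rightarrow> real"
    and u F d1 d2 :: "real \<times> real \<Rightarrow> complex"
    and u_top u_bot d1_top d2_top :: "real \<Rightarrow> complex"
  assumes "Lx > 0" and "H > 0" and "\<kappa> > 0" and "\<epsilon>p > 0" and "\<epsilon>m > 0"
    and "- pi / 2 < \<theta>" and "\<theta> < pi / 2"
    and a_def: "a = alpha Lx \<kappa> \<epsilon>p \<theta>"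
    and "\<And>n. (a n)\<^sup>2 \<noteq> \<kappa>\<^sup>2 * \<epsilon>p" and "\<And>n. (a n)\<^sup>2 \<noteq> \<kappa>\<^sup>2 * \<epsilon>m"
    and "\<And>x1 x2. \<epsilon> (x1 + Lx, x2) = \<epsilon> (x1, x2)"
    and "\<And>x1 x2. x2 > H \<Longrightarrow> \<epsilon> (x1, x2) = \<epsilon>p"
    and "\<And>x1 x2. x2 < - H \<Longrightarrow> \<epsilon> (x1, x2) = \<epsilon>m"
    and "C_infinity \<epsilon>" and "\<And>x. \<epsilon> x > 0"
    and \<Omega>_def: "\<Omega> = Omega Lx H"
    and "F \<in> L2 \<Omega>"
    and "u \<in> H1qp Lx H a"
    and "\<And>v. v \<in> H1qp Lx H a \<Longrightarrow>
           B_form Lx H a \<kappa> \<epsilon>p \<epsilon>m \<epsilon> u v = - (\<integral>x. F x * cnj (v x) \<partial>lebesgue_on \<Omega>)"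
    and d1_def: "d1 = weak_partial \<Omega> (1, 0) u" and d2_def: "d2 = weak_partial \<Omega> (0, 1) u"
    and u_top_def: "u_top = bd_trace Lx H H u" and u_bot_def: "u_bot = bd_trace Lx H (- H) u"
    and d1_top_def: "d1_top = bd_trace Lx H H d1" and d2_top_def: "d2_top = bd_trace Lx H H d2"
  shows "d1 \<in> H1 \<Omega> \<and> d2 \<in> H1 \<Omega> \<and>
    of_real (\<integral>x. 2 / \<epsilon> x * (norm (d2 x))\<^sup>2
                 - (snd x + H) * partial (0, 1) (\<lambda>y. 1 / \<epsilon> y) x
                     * ((norm (d1 x))\<^sup>2 + (norm (d2 x))\<^sup>2) \<partial>lebesgue_on \<Omega>)
    + of_real (2 * H * (\<integral>t. - 2 / \<epsilon> (t, H) * (norm (d2_top t))\<^sup>2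
                 + 1 / \<epsilon> (t, H) * ((norm (d1_top t))\<^sup>2 + (norm (d2_top t))\<^sup>2)
                 - \<kappa>\<^sup>2 * (norm (u_top t))\<^sup>2 \<partial>lebesgue_on {0<..<Lx}))
    - duality Lx a (DtN Lx a \<kappa> \<epsilon>p u_top) u_top
    - duality Lx a (DtN Lx a \<kappa> \<epsilon>m u_bot) u_bot
    = - of_real (2 * (\<integral>x. (snd x + H) * Re (cnj (F x) * d2 x) \<partial>lebesgue_on \<Omega>))
      - (\<integral>x. F x * cnj (u x) \<partial>lebesgue_on \<Omega>)"
proof -
  interpret helmholtz Lx H a \<kappa> \<epsilon>p \<epsilon>m \<epsilon> u F
  proof unfold_locales
    show "a n = a 0 + 2 * pi * of_int n / Lx" for n by (simp add: a_def alpha_def)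
  qed (use assms in auto)
  note \<Omega> = \<Omega>_def
  obtain A1 A2 U22 where \<alpha>: "(D1, A1, A2) \<in> closure (jet ` QP)" and \<beta>: "(D2, A2, U22) \<in> closure (jet ` QP)"
    and eq: "E F = \<kappa>\<^sup>2 *\<^sub>R fst X + M (\<lambda>x. complex_of_real (p1 x)) D1 + M P A1 + M (\<lambda>x. complex_of_real (p2 x)) D2 + M P U22"
    by (rule normal_regularity)
  obtain S1 where S1: "((D1, A1, A2), S1) \<in> closure (graph ` QP)" by (rule trace_of_jet[OF \<alpha>])
  obtain S2 where S2: "((D2, A2, U22), S2) \<in> closure (graph ` QP)" by (rule trace_of_jet[OF \<beta>])
  obtain T where T: "(X, T) \<in> closure (graph ` QP)" by (rule trace_of_jet[OF X_closure])
  note rel = rellich_abstract[OF \<alpha> \<beta> eq S1 S2 T]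
  note uL = H1_weak_partial[OF u_H1]
  have X: "X = (E u, E d1, E d2)" by (simp add: wjet_def d1_def d2_def \<Omega>)
  have dL: "d1 \<in> L2 (Omega Lx H)" "d2 \<in> L2 (Omega Lx H)" using uL by (simp_all add: d1_def d2_def \<Omega>)
  note smooth = subsetD[OF closure_jet_subset] subsetD[OF closure_graph_subset]
  \<comment> \<open>The classes of the second derivatives need representing functions before
    \<open>d1\<close> and \<open>d2\<close> can be recognised as H1 functions.\<close>
  obtain f11 f12 f22 where f: "f11 \<in> L2 (Omega Lx H)" "f12 \<in> L2 (Omega Lx H)" "f22 \<in> L2 (Omega Lx H)"
    "A1 = E f11" "A2 = E f12" "U22 = E f22"
    using closed_range_components[OF \<alpha>] closed_range_components[OF \<beta>] by auto
  have dd: "d1 \<in> H1 (Omega Lx H)" "wjet d1 = (D1, A1, A2)" "d2 \<in> H1 (Omega Lx H)" "wjet d2 = (D2, A2, U22)"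
    using H1_if_limit[OF dL(1) f(1,2)] H1_if_limit[OF dL(2) f(2,3)] smooth(1)[OF \<alpha>] smooth(1)[OF \<beta>] f X by auto
  have t1: "d1_top \<in> L2 \<Gamma>" "EG d1_top = fst S1"
    using bd_trace_eq[OF dd(1), of S1] smooth(2)[OF S1] dd(2) by (auto simp: d1_top_def)
  have t2: "d2_top \<in> L2 \<Gamma>" "EG d2_top = fst S2"
    using bd_trace_eq[OF dd(3), of S2] smooth(2)[OF S2] dd(4) by (auto simp: d2_top_def)
  have t0: "u_top \<in> L2 \<Gamma>" "EG u_top = fst T"
    using bd_trace_eq[OF u_H1 smooth(2)[OF T]] by (auto simp: u_top_def)
  have cp: "continuous_on UNIV p" and cq: "continuous_on UNIV (\<lambda>x. height x * p2 x)" and cH: "continuous_on UNIV (\<lambda>t. p (t, H))"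
    and cy: "continuous_on UNIV (\<lambda>x. complex_of_real (height x))"
    by (intro continuous_on_mult continuous_on_of_real C_infinity_continuous C_infinity_partial continuous_trace p_smooth height_smooth)+
  note wO = weighted_norm[OF Omega_sets(1,2)] and wG = weighted_norm[OF Gamma_sets(1,2)]
  let ?O = "\<lambda>c d. \<integral>x. c x * (norm (d x))\<^sup>2 \<partial>lebesgue_on (Omega Lx H)"
  let ?G = "\<lambda>c d. \<integral>t. c t * (norm (d t))\<^sup>2 \<partial>lebesgue_on \<Gamma>"
  have D: "D1 = E d1" "D2 = E d2" "fst X = E u" using X by simp_all
  have n0: "(norm (E u))\<^sup>2 = ?O (\<lambda>_. 1) u" and nT: "(norm (fst T))\<^sup>2 = ?G (\<lambda>_. 1) u_top"
    using norm_toL[OF Omega_sets(1) uL(1)] norm_toL[OF Gamma_sets(1) t0(1)] t0(2) by simp_all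
  have i1: "(\<integral>x. 2 / \<epsilon> x * (norm (d2 x))\<^sup>2 - (snd x + H) * partial (0, 1) (\<lambda>y. 1 / \<epsilon> y) x
      * ((norm (d1 x))\<^sup>2 + (norm (d2 x))\<^sup>2) \<partial>lebesgue_on \<Omega>)
    = 2 * ?O p d2 - ?O (\<lambda>x. height x * p2 x) d1 - ?O (\<lambda>x. height x * p2 x) d2"
  proof -
    have "(\<lambda>x. 2 / \<epsilon> x * (norm (d2 x))\<^sup>2 - (snd x + H) * partial (0, 1) (\<lambda>y. 1 / \<epsilon> y) x * ((norm (d1 x))\<^sup>2 + (norm (d2 x))\<^sup>2))
      = (\<lambda>x. 2 * (p x * (norm (d2 x))\<^sup>2) - (height x * p2 x) * (norm (d1 x))\<^sup>2 - (height x * p2 x) * (norm (d2 x))\<^sup>2)"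
      by (rule ext) (simp add: p_def [abs_def] height_def algebra_simps)
    then show ?thesis
      using wO(1)[OF cp dL(2)] wO(1)[OF cq dL(1)] wO(1)[OF cq dL(2)] by (simp add: \<Omega>)
  qed
  have i2: "(\<integral>t. - 2 / \<epsilon> (t, H) * (norm (d2_top t))\<^sup>2 + 1 / \<epsilon> (t, H) * ((norm (d1_top t))\<^sup>2 + (norm (d2_top t))\<^sup>2)
      - \<kappa>\<^sup>2 * (norm (u_top t))\<^sup>2 \<partial>lebesgue_on {0<..<Lx})
    = ?G (\<lambda>t. p (t, H)) d1_top - ?G (\<lambda>t. p (t, H)) d2_top - \<kappa>\<^sup>2 * ?G (\<lambda>_. 1) u_top"
  proof -
    have "(\<lambda>t. - 2 / \<epsilon> (t, H) * (norm (d2_top t))\<^sup>2 + 1 / \<epsilon> (t, H) * ((norm (d1_top t))\<^sup>2 + (norm (d2_top t))\<^sup>2) - \<kappa>\<^sup>2 * (norm (u_top t))\<^sup>2)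
      = (\<lambda>t. p (t, H) * (norm (d1_top t))\<^sup>2 - p (t, H) * (norm (d2_top t))\<^sup>2 - \<kappa>\<^sup>2 * (1 * (norm (u_top t))\<^sup>2))"
      by (rule ext) (simp add: p_def algebra_simps add_divide_distrib)
    then show ?thesis
      using wG(1)[OF cH t1(1)] wG(1)[OF cH t2(1)] wG(1)[OF continuous_on_const t0(1), of 1] by simp
  qed
  have i3: "(\<integral>x. (snd x + H) * Re (cnj (F x) * d2 x) \<partial>lebesgue_on \<Omega>) = Re (cin (E F) (M (\<lambda>x. complex_of_real (height x)) D2))"
  proof -
    have yL: "(\<lambda>x. complex_of_real (height x) * d2 x) \<in> L2 (Omega Lx H)"
      by (intro L2_mult(1) restr_bmeas_continuous cy dL) auto
    have "Re (cin (E F) (M (\<lambda>x. complex_of_real (height x)) D2)) = Re (\<integral>x. F x * cnj (complex_of_real (height x) * d2 x) \<partial>lebesgue_on (Omega Lx H))"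
      unfolding D(2) E_mult[OF cy dL(2), symmetric] cin_toL[OF Omega_sets(1) F yL] ..
    also have "\<dots> = (\<integral>x. Re (F x * cnj (complex_of_real (height x) * d2 x)) \<partial>lebesgue_on (Omega Lx H))"
      by (rule integral_Re[symmetric, OF integrable_mult_cnj[OF Omega_sets(1) F yL]])
    also have "(\<lambda>x. Re (F x * cnj (complex_of_real (height x) * d2 x))) = (\<lambda>x. (snd x + H) * Re (cnj (F x) * d2 x))"
      by (rule ext) (simp add: height_def algebra_simps)
    finally show ?thesis by (simp add: \<Omega>)
  qed
  have i4: "(\<integral>x. F x * cnj (u x) \<partial>lebesgue_on \<Omega>) = cin (E F) (E u)"
    unfolding \<Omega> by (rule cin_toL[OF Omega_sets(1) F uL(1), symmetric])
  define dm where "dm = duality Lx a (DtN Lx a \<kappa> \<epsilon>m u_bot) u_bot"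
  define dp where "dp = duality Lx a (DtN Lx a \<kappa> \<epsilon>p u_top) u_top"
  \<comment> \<open>The weak equation with \<open>v = u\<close>. It is the source of the complex
    boundary terms; the identity obtained from the multiplier is real.\<close>
  have "of_real (?O p d1) + of_real (?O p d2) - of_real (\<kappa>\<^sup>2) * of_real (?O (\<lambda>_. 1) u) = dm + dp - cin (E F) (E u)"
    using weak_eq[OF u] unfolding D wO(2)[OF cp dL(1)] wO(2)[OF cp dL(2)] cin_self n0
    by (simp add: dm_def dp_def u_top_def u_bot_def)
  then have e: "of_real (?O p d1 + ?O p d2 - \<kappa>\<^sup>2 * ?O (\<lambda>_. 1) u) = dm + dp - cin (E F) (E u)"
    by (simp only: of_real_add of_real_diff of_real_mult)
  have "2 * Re (cin (E F) (M (\<lambda>x. complex_of_real (height x)) D2))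
    = \<kappa>\<^sup>2 * (2 * H * ?G (\<lambda>_. 1) u_top - ?O (\<lambda>_. 1) u) + ?O p d1 - ?O p d2
      + ?O (\<lambda>x. height x * p2 x) d1 + ?O (\<lambda>x. height x * p2 x) d2
      - 2 * H * ?G (\<lambda>t. p (t, H)) d1_top + 2 * H * ?G (\<lambda>t. p (t, H)) d2_top"
    using rel unfolding t1(2)[symmetric] t2(2)[symmetric] D(1,3) nT n0
      wG(2)[OF cH t1(1)] wG(2)[OF cH t2(1)] wO(2)[OF cp dL(1)] wO(2)[OF cq dL(1)]
    unfolding D(2) wO(2)[OF cp dL(2)] wO(2)[OF cq dL(2)] by (simp only: Re_complex_of_real)
  \<comment> \<open>Rearranged so that the right-hand side is the energy which the weak equation
    expresses by boundary terms and the source.\<close>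
  then have r: "2 * ?O p d2 - ?O (\<lambda>x. height x * p2 x) d1 - ?O (\<lambda>x. height x * p2 x) d2
      + 2 * H * (?G (\<lambda>t. p (t, H)) d1_top - ?G (\<lambda>t. p (t, H)) d2_top - \<kappa>\<^sup>2 * ?G (\<lambda>_. 1) u_top)
      + 2 * Re (cin (E F) (M (\<lambda>x. complex_of_real (height x)) D2))
    = ?O p d1 + ?O p d2 - \<kappa>\<^sup>2 * ?O (\<lambda>_. 1) u"
    by (simp add: algebra_simps)
  show ?thesis
    unfolding i1 i2 i3 i4 dm_def[symmetric] dp_def[symmetric]
  proof (intro conjI)
    show "d1 \<in> H1 \<Omega>" "d2 \<in> H1 \<Omega>" using dd by (simp_all add: \<Omega>)
    show "of_real (2 * ?O p d2 - ?O (\<lambda>x. height x * p2 x) d1 - ?O (\<lambda>x. height x * p2 x) d2)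
      + of_real (2 * H * (?G (\<lambda>t. p (t, H)) d1_top - ?G (\<lambda>t. p (t, H)) d2_top - \<kappa>\<^sup>2 * ?G (\<lambda>_. 1) u_top)) - dp - dm
      = - of_real (2 * Re (cin (E F) (M (\<lambda>x. complex_of_real (height x)) D2))) - cin (E F) (E u)"
      using e[folded r] unfolding of_real_add by algebra
  qed
qed

end
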